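(* Assuming the $\mathsf{APSP}$ conjecture, there is no truly sub-cubic algorithm (i.e. no algorithm running in time $O(n^{3-\varepsilon})$ for some $\varepsilon>0$) for $\mathsf{2D\;LWS}$ with slice rank $3$.
   Context: $\mathsf{APSP}$ conjecture: there is no $O(n^{3-\varepsilon})$-time algorithm (for any $\varepsilon>0$) computing all-pairs shortest path distances in an $n$-node directed graph with integer edge weights. $\mathsf{2D\;LWS}$ of size $n$: given tensors $w_1,w_2:[n]^3\to\{-W,\ldots,W,\infty\}$, define $T[1,1]=0$ and otherwise $T[i,j]=\min\bigl(\min_{1\le k<i}(T[k,j]+w_1[i,j,k]),\ \min_{1\le k<j}(T[i,k]+w_2[i,j,k])\bigr)$; output $T[n,n]$. A tensor $w:[n]^3\to\mathbb{R}$ has slice rank $1$ if it is of one of the forms $w[i,j,k]=a(i)b(j,k)$, $a(j)b(i,k)$, or $a(k)b(i,j)$ for some functions $a,b$; it has slice rank $r$ if it is a sum of $r$ slice-rank-$1$ tensors. "$\mathsf{2D\;LWS}$ with slice rank $3$" means both $w_1,w_2$ have slice rank (at most) $3$ and are given as input via such decompositions. *)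

theory Defs
  imports "Graph_Theory.Shortest_Path" "HOL-Library.Landau_Symbols"
begin

section \<open>The word RAM\<close>

text \<open>
  Programs are deterministic, structured programs over random-access memory. The memory is divided
  into finitely many banks (those named in the program); a register is a bank of which only cell 0
  is used. With word length w all data, addresses and intermediate results are integers
  in [-2^w, 2^w), and a program that produces anything else has no execution. Every
  assignment and every test takes one time step: the expressions of a fixed program have
  bounded size, so this agrees with counting single operations up to a constant factor.
\<close>

type_synonym mem = "nat \<Rightarrow> int \<Rightarrow> int"

datatype binop = Add | Sub | Mul | Quot | Rem | Band | Bor | Bxor | Shl | Shr | Lt | Eq

datatype exp = Const int | Cell nat exp | Bin binop exp exp

datatype com =
    Skip
  | Store nat exp exp  \<comment> \<open>\<open>Store b e1 e2\<close>: write \<open>e2\<close> to cell \<open>e1\<close> of bank \<open>b\<close>\<close>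
  | Seq com com
  | If exp com com
  | While exp com

definition is_word :: "nat \<Rightarrow> int \<Rightarrow> bool" where
  "is_word w v \<longleftrightarrow> - (2 ^ w) \<le> v \<and> v < 2 ^ w"

fun apply_op :: "binop \<Rightarrow> int \<Rightarrow> int \<Rightarrow> int" where
  "apply_op Add x y = x + y"
| "apply_op Sub x y = x - y"
| "apply_op Mul x y = x * y"
| "apply_op Quot x y = x div y"
| "apply_op Rem x y = x mod y"
| "apply_op Band x y = semiring_bit_operations_class.and x y"
| "apply_op Bor x y = semiring_bit_operations_class.or x y"
| "apply_op Bxor x y = semiring_bit_operations_class.xor x y"
| "apply_op Shl x y = push_bit (nat y) x"
| "apply_op Shr x y = drop_bit (nat y) x"
| "apply_op Lt x y = (if x < y then 1 else 0)"
| "apply_op Eq x y = (if x = y then 1 else 0)"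

fun val :: "mem \<Rightarrow> exp \<Rightarrow> int" where
  "val m (Const v) = v"
| "val m (Cell b e) = m b (val m e)"
| "val m (Bin f e1 e2) = apply_op f (val m e1) (val m e2)"

fun fits :: "nat \<Rightarrow> mem \<Rightarrow> exp \<Rightarrow> bool" where
  "fits w m (Const v) \<longleftrightarrow> is_word w v"
| "fits w m (Cell b e) \<longleftrightarrow> fits w m e \<and> is_word w (m b (val m e))"
| "fits w m (Bin f e1 e2) \<longleftrightarrow>
     fits w m e1 \<and> fits w m e2 \<and> is_word w (apply_op f (val m e1) (val m e2))"

text \<open>\<open>run w c m t m'\<close>: on word length \<open>w\<close>, the program \<open>c\<close> started in memory \<open>m\<close> halts after
  exactly \<open>t\<close> steps with memory \<open>m'\<close>.\<close>

inductive run :: "nat \<Rightarrow> com \<Rightarrow> mem \<Rightarrow> nat \<Rightarrow> mem \<Rightarrow> bool" for w where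
  Skip: "run w Skip m 1 m"
| Store: "fits w m e1 \<Longrightarrow> fits w m e2 \<Longrightarrow>
    run w (Store b e1 e2) m 1 (m(b := (m b)(val m e1 := val m e2)))"
| Seq: "run w c1 m t1 m1 \<Longrightarrow> run w c2 m1 t2 m2 \<Longrightarrow> run w (Seq c1 c2) m (t1 + t2) m2"
| IfTrue: "fits w m e \<Longrightarrow> val m e \<noteq> 0 \<Longrightarrow> run w c1 m t m1 \<Longrightarrow> run w (If e c1 c2) m (1 + t) m1"
| IfFalse: "fits w m e \<Longrightarrow> val m e = 0 \<Longrightarrow> run w c2 m t m1 \<Longrightarrow> run w (If e c1 c2) m (1 + t) m1"
| WhileFalse: "fits w m e \<Longrightarrow> val m e = 0 \<Longrightarrow> run w (While e c) m 1 m"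
| WhileTrue: "fits w m e \<Longrightarrow> val m e \<noteq> 0 \<Longrightarrow> run w c m t1 m1 \<Longrightarrow> run w (While e c) m1 t2 m2 \<Longrightarrow>
    run w (While e c) m (1 + t1 + t2) m2"

text \<open>
  A computational problem is given by its set of instances \<open>inst n\<close> of each size \<open>n\<close>, by the
  predicate \<open>inp n x m\<close> stating that \<open>m\<close> holds the encoding of the instance \<open>x\<close>, and by the
  predicate \<open>outp n x m\<close> stating that \<open>m\<close> holds a correct answer. An algorithm is one program
  for all sizes, running on words of logarithmic length: it has to be correct, within the same
  time bound, for every word length \<open>w\<close> with \<open>w \<ge> d * log 2 (n + 1)\<close>, for a constant \<open>d\<close> of its
  own. Memory outside the encoding of the input is uninitialised, i.e. holds arbitrary words.
\<close>

definition truly_subcubic ::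
  "(nat \<Rightarrow> 'x set) \<Rightarrow> (nat \<Rightarrow> 'x \<Rightarrow> mem \<Rightarrow> bool) \<Rightarrow> (nat \<Rightarrow> 'x \<Rightarrow> mem \<Rightarrow> bool) \<Rightarrow> bool" where
  "truly_subcubic inst inp outp \<longleftrightarrow>
     (\<exists>(p :: com) (d :: nat) (\<epsilon> :: real) (T :: nat \<Rightarrow> real).
        \<epsilon> > 0 \<and> T \<in> O(\<lambda>n. real n powr (3 - \<epsilon>)) \<and>
        (\<forall>n \<ge> 1. \<forall>x \<in> inst n. \<forall>w m.
           (n + 1) ^ d \<le> 2 ^ w \<and> (\<forall>b i. is_word w (m b i)) \<and> inp n x m \<longrightarrow>
           (\<exists>t m'. run w p m t m' \<and> real t \<le> T n \<and> outp n x m')))"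


section \<open>All-pairs shortest paths\<close>

definition graph_on :: "nat \<Rightarrow> (nat \<times> nat) set \<Rightarrow> (nat, nat \<times> nat) pre_digraph" where
  "graph_on n E = \<lparr> verts = {..<n}, arcs = E, tail = fst, head = snd \<rparr>"

text \<open>Instances are pairs of an edge set and a weight function. Weights are polynomially bounded,
  and negative weights but no negative cycles are allowed.\<close>

definition apsp_instances :: "nat \<Rightarrow> nat \<Rightarrow> ((nat \<times> nat) set \<times> (nat \<times> nat \<Rightarrow> int)) set" where
  "apsp_instances c n = {(E, wt).
     E \<subseteq> {..<n} \<times> {..<n} \<and>
     (\<forall>e \<in> E. \<bar>wt e\<bar> \<le> int n ^ c) \<and>
     (\<forall>u p. pre_digraph.awalk (graph_on n E) u p u \<longrightarrow>
        wf_digraph.awalk_cost (\<lambda>e. real_of_int (wt e)) p \<ge> 0)}"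

definition apsp_input :: "nat \<Rightarrow> (nat \<times> nat) set \<times> (nat \<times> nat \<Rightarrow> int) \<Rightarrow> mem \<Rightarrow> bool" where
  "apsp_input n = (\<lambda>(E, wt) m.
     m 0 0 = int n \<and>
     (\<forall>u<n. \<forall>v<n.
        m 1 (int (u * n + v)) = (if (u, v) \<in> E then 1 else 0) \<and>
        ((u, v) \<in> E \<longrightarrow> m 2 (int (u * n + v)) = wt (u, v))))"

text \<open>Bank 3 flags the reachable pairs, bank 4 holds their distances.\<close>

definition apsp_output :: "nat \<Rightarrow> (nat \<times> nat) set \<times> (nat \<times> nat \<Rightarrow> int) \<Rightarrow> mem \<Rightarrow> bool" where
  "apsp_output n = (\<lambda>(E, wt) m.
     \<forall>u<n. \<forall>v<n.
       let dist = wf_digraph.\<mu> (graph_on n E) (\<lambda>e. real_of_int (wt e)) u v in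
       if dist = \<infinity> then m 3 (int (u * n + v)) = 0
       else m 3 (int (u * n + v)) = 1 \<and> dist = ereal (real_of_int (m 4 (int (u * n + v)))))"

definition APSP_conjecture :: bool where
  "APSP_conjecture \<longleftrightarrow> (\<exists>c. \<not> truly_subcubic (apsp_instances c) apsp_input apsp_output)"


section \<open>Two-dimensional least weight subsequence\<close>

type_synonym 'a tensor = "nat \<Rightarrow> nat \<Rightarrow> nat \<Rightarrow> 'a"

declare INF_cong [fundef_cong]

text \<open>Indices run from 1. A minimum over an empty range is the infimum \<open>\<infinity>\<close> in \<open>ereal\<close>.\<close>

function lws2d :: "ereal tensor \<Rightarrow> ereal tensor \<Rightarrow> nat \<Rightarrow> nat \<Rightarrow> ereal" where
  "lws2d w1 w2 i j =
     (if i = 1 \<and> j = 1 then 0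
      else min (INF k \<in> {1..<i}. lws2d w1 w2 k j + w1 i j k)
               (INF k \<in> {1..<j}. lws2d w1 w2 i k + w2 i j k))"
  by auto
termination
  by (relation "measure (\<lambda>(_, _, i, j). i + j)") auto

declare lws2d.simps [simp del]

text \<open>\<open>Slice ax a b\<close> represents a tensor of slice rank 1, \<open>ax\<close> being the index on which the
  factor \<open>a\<close> depends.\<close>

datatype axis = AxI | AxJ | AxK

datatype slice =
  Slice (slice_axis: axis) (slice_vec: "nat \<Rightarrow> int") (slice_mat: "nat \<Rightarrow> nat \<Rightarrow> int")

fun slice_tensor :: "slice \<Rightarrow> int tensor" where
  "slice_tensor (Slice AxI a b) i j k = a i * b j k"
| "slice_tensor (Slice AxJ a b) i j k = a j * b i k"
| "slice_tensor (Slice AxK a b) i j k = a k * b i j"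

definition decomp_tensor :: "slice list \<Rightarrow> int tensor" where
  "decomp_tensor D i j k = (\<Sum>s\<leftarrow>D. slice_tensor s i j k)"

text \<open>Slice rank is a notion for finite tensors, so the weight \<open>\<infinity>\<close> does not occur in these
  instances. Decompositions into fewer than \<open>r\<close> slices are included, since slices may vanish.\<close>

definition lws2d_slice_instances :: "nat \<Rightarrow> nat \<Rightarrow> nat \<Rightarrow> (slice list \<times> slice list) set" where
  "lws2d_slice_instances r c n = {(D1, D2).
     length D1 = r \<and> length D2 = r \<and>
     (\<forall>s \<in> set D1 \<union> set D2. \<forall>i\<in>{1..n}. \<forall>j\<in>{1..n}.
        \<bar>slice_vec s i\<bar> \<le> int n ^ c \<and> \<bar>slice_mat s i j\<bar> \<le> int n ^ c) \<and>
     (\<forall>D \<in> {D1, D2}. \<forall>i\<in>{1..n}. \<forall>j\<in>{1..n}. \<forall>k\<in>{1..n}.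
        \<bar>decomp_tensor D i j k\<bar> \<le> int n ^ c)}"

fun axis_code :: "axis \<Rightarrow> int" where
  "axis_code AxI = 0"
| "axis_code AxJ = 1"
| "axis_code AxK = 2"

text \<open>The slices of both tensors are stored one after another. Distinct entries get distinct
  addresses, as \<open>i\<close> and \<open>j\<close> lie between 1 and \<open>n\<close>.\<close>

definition lws2d_slice_input :: "nat \<Rightarrow> slice list \<times> slice list \<Rightarrow> mem \<Rightarrow> bool" where
  "lws2d_slice_input n = (\<lambda>(D1, D2) m.
     m 0 0 = int n \<and>
     (\<forall>q < length (D1 @ D2). let s = (D1 @ D2) ! q in
        m 1 (int q) = axis_code (slice_axis s) \<and>
        (\<forall>i\<in>{1..n}. m 2 (int (q * n + i)) = slice_vec s i) \<and>
        (\<forall>i\<in>{1..n}. \<forall>j\<in>{1..n}. m 3 (int ((q * n + i) * n + j)) = slice_mat s i j)))"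

definition lws2d_slice_output :: "nat \<Rightarrow> slice list \<times> slice list \<Rightarrow> mem \<Rightarrow> bool" where
  "lws2d_slice_output n = (\<lambda>(D1, D2) m.
     ereal (real_of_int (m 4 0)) =
       lws2d (\<lambda>i j k. ereal (real_of_int (decomp_tensor D1 i j k)))
             (\<lambda>i j k. ereal (real_of_int (decomp_tensor D2 i j k))) n n)"

end

theory Submission
  imports Defs "HOL-Library.Log_Nat"
begin

text \<open>
  Distances arise from \<open>O(log n)\<close> min-plus squarings of the weight matrix, missing arcs getting a large
  weight. The min-plus square of \<open>D\<close> is found by bisecting all its entries simultaneously: given
  thresholds \<open>Y\<close>, one has to find all pairs \<open>(i, j)\<close> with \<open>D i k + D k j < Y i j\<close> for some \<open>k\<close>. As in the
  reduction of Vassilevska Williams and Williams to negative triangles, the indices are split into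
  blocks of size \<open>s \<approx> n^(1/3)\<close>, and every triple of blocks is searched until it contains no such
  triangle; each successful search removes a pair, so there are \<open>O(n^2)\<close> searches.

  One search is one 2D LWS instance of size \<open>2 * s\<close>: with \<open>w2 = 0\<close> and
  \<open>w1 i j k = A i k + B k j + C i j\<close> for \<open>k \<le> s < i\<close>, \<open>w1 i j k = 0\<close> otherwise, a path crosses from the rows
  \<open>\<le> s\<close> to the rows \<open>> s\<close> exactly once, and everything else is free. The three summands are slices along
  the three axes. The entries are scaled by \<open>n^2\<close> and the index of \<open>(i, j)\<close> is added to \<open>C\<close>, so that the
  value of the optimum reveals the pair to be removed.
\<close>

section \<open>Executions with a time bound\<close>

text \<open>The block size balances two counts. A scan makes one oracle call per triple of blocks
  that turns out to be free of triangles, about \<open>(n / s)^3\<close> of them, and one per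
  removed pair, at most \<open>n^2\<close>; for \<open>s\<close> near \<open>n^(1/3)\<close> both
  are of order \<open>n^2\<close>. A call on size \<open>2 * s\<close> costs
  \<open>O(n^(1 - \<epsilon> / 3))\<close>, hence a scan \<open>O(n^(3 - \<epsilon> / 3))\<close>,
  and the two logarithmic factors, for bisection and for repeated squaring, use up half of the gain.
  A pair is removed at most once per scan because its threshold is reset to the lower end of its
  interval, which no sum undercuts. Small blocks have a price: the weights given to the oracle must
  be polynomial in \<open>2 * s\<close> rather than in \<open>n\<close>, which roughly triples the
  exponent. The rest of the effort is due to the machine: an execution exists only if no
  intermediate result overflows, so every piece of program comes with value bounds; and the oracle
  may destroy its input, so the instance is written anew before each call. Writing takes
  \<open>O(s^2)\<close> steps, which the assumed time bound of the oracle absorbs once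
  \<open>\<epsilon> \<le> 1\<close>.\<close>

definition wordmem :: "nat \<Rightarrow> mem \<Rightarrow> bool" where
  "wordmem w m \<longleftrightarrow> (\<forall>b a. is_word w (m b a))"

fun reads :: "exp \<Rightarrow> nat set" where
  "reads (Const v) = {}"
| "reads (Cell b e) = insert b (reads e)"
| "reads (Bin f e1 e2) = reads e1 \<union> reads e2"

fun writes :: "com \<Rightarrow> nat set" where
  "writes Skip = {}"
| "writes (Store b e1 e2) = {b}"
| "writes (Seq c1 c2) = writes c1 \<union> writes c2"
| "writes (If e c1 c2) = writes c1 \<union> writes c2"
| "writes (While e c) = writes c"

lemma finite_writes: "finite (writes c)"
  by (induction c) auto

lemma val_cong: "(\<And>b. b \<in> reads e \<Longrightarrow> m b = m' b) \<Longrightarrow> val m e = val m' e"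
  by (induction e) auto

lemma fits_cong: "(\<And>b. b \<in> reads e \<Longrightarrow> m b = m' b) \<Longrightarrow> fits w m e = fits w m' e"
proof (induction e)
  case (Cell b e)
  then show ?case using val_cong[of e m m'] by auto
next
  case (Bin f e1 e2)
  then show ?case using val_cong[of e1 m m'] val_cong[of e2 m m'] by auto
qed auto

lemma fits_val: "fits w m e \<Longrightarrow> is_word w (val m e)"
  by (cases e) auto

text \<open>Frame conditions are tracked per bank: addresses are computed at run time, but the banks
  written can be read off the program.\<close>

lemma run_frame: "run w c m t m' \<Longrightarrow> b \<notin> writes c \<Longrightarrow> m' b = m b"
  by (induction rule: run.induct) auto

lemma run_wordmem: "run w c m t m' \<Longrightarrow> wordmem w m \<Longrightarrow> wordmem w m'"
  by (induction rule: run.induct) (auto simp: wordmem_def dest: fits_val)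

text \<open>An upper bound on the number of steps, instead of the exact number, lets specifications
  be weakened and composed. Existence of the run includes the absence of overflow.\<close>

definition exec :: "nat \<Rightarrow> com \<Rightarrow> mem \<Rightarrow> nat \<Rightarrow> (mem \<Rightarrow> bool) \<Rightarrow> bool" where
  "exec w c m \<tau> Q \<longleftrightarrow> (\<exists>t m'. run w c m t m' \<and> t \<le> \<tau> \<and> Q m')"

lemma exec_mono:
  assumes "exec w c m \<tau> Q" "\<tau> \<le> \<tau>'" "\<And>m'. Q m' \<Longrightarrow> Q' m'"
  shows "exec w c m \<tau>' Q'"
  using assms unfolding exec_def by (meson le_trans)

text \<open>Unwritten banks and word-sized contents are preserved by every run, so both facts are
  added to a postcondition afterwards, and a specification states only what its piece
  computes.\<close>

lemma exec_frame:
  assumes "exec w c m \<tau> Q" "wordmem w m" "\<tau> \<le> \<tau>'"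
    "\<And>m'. Q m' \<Longrightarrow> wordmem w m' \<Longrightarrow> (\<And>b. b \<notin> writes c \<Longrightarrow> m' b = m b) \<Longrightarrow> Q' m'"
  shows "exec w c m \<tau>' Q'"
  using assms unfolding exec_def by (meson le_trans run_frame run_wordmem)

lemma exec_Store:
  assumes "fits w m e1" "fits w m e2" "1 \<le> \<tau>"
    "Q (m(b := (m b)(val m e1 := val m e2)))"
  shows "exec w (Store b e1 e2) m \<tau> Q"
  using assms unfolding exec_def by (blast intro: run.Store)

lemma exec_Seq:
  assumes "exec w c1 m \<tau>1 (\<lambda>m'. exec w c2 m' \<tau>2 Q)" "\<tau>1 + \<tau>2 \<le> \<tau>"
  shows "exec w (Seq c1 c2) m \<tau> Q"
proof -
  from assms(1) obtain t1 m1 t2 m2 where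
    "run w c1 m t1 m1" "t1 \<le> \<tau>1" "run w c2 m1 t2 m2" "t2 \<le> \<tau>2" "Q m2"
    unfolding exec_def by blast
  then show ?thesis
    using run.Seq[of w c1 m t1 m1 c2 t2 m2] assms(2) unfolding exec_def
    by (meson add_mono le_trans)
qed

lemma exec_SeqI:
  assumes "exec w c1 m \<tau>1 P" "\<And>m1. P m1 \<Longrightarrow> exec w c2 m1 \<tau>2 Q" "\<tau>1 + \<tau>2 \<le> \<tau>"
  shows "exec w (Seq c1 c2) m \<tau> Q"
  using assms(1,3) by (intro exec_Seq[of w c1 m \<tau>1 c2 \<tau>2 Q \<tau>]) (auto elim!: exec_mono intro: assms(2))

lemma exec_Seq_frame:
  assumes "exec w c1 m \<tau>1 P" "wordmem w m"
    "\<And>m1. P m1 \<Longrightarrow> wordmem w m1 \<Longrightarrow> (\<And>b. b \<notin> writes c1 \<Longrightarrow> m1 b = m b) \<Longrightarrow> exec w c2 m1 \<tau>2 Q"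
    "\<tau>1 + \<tau>2 \<le> \<tau>"
  shows "exec w (Seq c1 c2) m \<tau> Q"
  by (rule exec_Seq[OF exec_frame[OF assms(1,2)] assms(4)]) (auto intro: assms(3))

lemma exec_If:
  assumes "fits w m e" "val m e \<noteq> 0 \<Longrightarrow> exec w c1 m \<tau> Q" "val m e = 0 \<Longrightarrow> exec w c2 m \<tau> Q"
    "1 + \<tau> \<le> \<tau>'"
  shows "exec w (If e c1 c2) m \<tau>' Q"
proof (cases "val m e = 0")
  case True
  with assms(3) obtain t m1 where "run w c2 m t m1" "t \<le> \<tau>" "Q m1"
    unfolding exec_def by blast
  then show ?thesis
    using True run.IfFalse[OF assms(1) True, of c2 t m1 c1] assms(4) unfolding exec_def
    by (meson add_left_mono le_trans)
next
  case False
  with assms(2) obtain t m1 where "run w c1 m t m1" "t \<le> \<tau>" "Q m1"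
    unfolding exec_def by blast
  then show ?thesis
    using False run.IfTrue[OF assms(1) False, of c1 t m1 c2] assms(4) unfolding exec_def
    by (meson add_left_mono le_trans)
qed

text \<open>\<open>V\<close> bounds the number of rounds, each of which pays for a successful test
  and \<open>\<tau>\<close> steps of the body; the leading 1 is the final test.\<close>

lemma exec_While:
  fixes V :: "mem \<Rightarrow> nat"
  assumes step: "\<And>m. I m \<Longrightarrow> val m e \<noteq> 0 \<Longrightarrow> exec w c m \<tau> (\<lambda>m'. I m' \<and> V m' < V m)"
    and fits: "\<And>m. I m \<Longrightarrow> fits w m e"
    and fin: "\<And>m. I m \<Longrightarrow> val m e = 0 \<Longrightarrow> Q m"
    and init: "I m" and bnd: "1 + V m * (1 + \<tau>) \<le> \<tau>'"
  shows "exec w (While e c) m \<tau>' Q"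
proof -
  have "exec w (While e c) m (1 + V m * (1 + \<tau>)) Q"
    using init
  proof (induction "V m" arbitrary: m rule: less_induct)
    case less
    show ?case
    proof (cases "val m e = 0")
      case True
      then show ?thesis
        using run.WhileFalse[of w m e c] fits[OF less(2)] fin[OF less(2) True]
        unfolding exec_def by (metis le_add1)
    next
      case False
      obtain t1 m1 where 1: "run w c m t1 m1" "t1 \<le> \<tau>" "I m1" "V m1 < V m"
        using step[OF less(2) False] unfolding exec_def by blast
      obtain t2 m2 where 2: "run w (While e c) m1 t2 m2" "t2 \<le> 1 + V m1 * (1 + \<tau>)" "Q m2"
        using less(1)[OF 1(4,3)] unfolding exec_def by blast
      have "V m1 * (1 + \<tau>) + (1 + \<tau>) \<le> V m * (1 + \<tau>)"
        using 1(4) mult_le_mono1[of "Suc (V m1)" "V m" "1 + \<tau>"] by simp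
      then have "1 + t1 + t2 \<le> 1 + V m * (1 + \<tau>)" using 1(2) 2(2) by linarith
      then show ?thesis
        using run.WhileTrue[OF fits[OF less(2)] False 1(1) 2(1)] 2(3) unfolding exec_def by blast
    qed
  qed
  then show ?thesis using bnd by (rule exec_mono)
qed

section \<open>Registers and the loop that fills an array\<close>

abbreviation Reg :: "nat \<Rightarrow> exp" where "Reg r \<equiv> Cell r (Const 0)"

abbreviation Set :: "nat \<Rightarrow> exp \<Rightarrow> com" where "Set r e \<equiv> Store r (Const 0) e"

lemma is_word_0 [simp]: "is_word w 0"
  by (simp add: is_word_def)

lemma exec_Set:
  assumes "fits w m e" "1 \<le> \<tau>" "Q (m(r := (m r)(0 := val m e)))"
  shows "exec w (Set r e) m \<tau> Q"
  using assms by (intro exec_Store) auto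

definition fill :: "nat \<Rightarrow> nat \<Rightarrow> exp \<Rightarrow> exp \<Rightarrow> exp \<Rightarrow> com" where
  "fill r b e0 ec ev =
     Seq (Set r (Const 0))
         (While (Bin Lt (Reg r) ec)
            (Seq (Store b (Bin Add e0 (Reg r)) ev) (Set r (Bin Add (Reg r) (Const 1)))))"

lemma writes_fill [simp]: "writes (fill r b e0 ec ev) = {r, b}"
  by (auto simp: fill_def)

text \<open>A round consists of the test and two stores; the remaining two steps are the initial
  store and the last test. The expression \<open>ev\<close> is evaluated only in memories that agree
  with \<open>m\<close> outside the counter and the target bank, so \<open>fits_ev\<close> has to
  know nothing about earlier rounds. The postcondition keeps the cells outside the range, which
  allows a bank to be filled in several passes.\<close>

lemma exec_fill:
  fixes cnt :: nat and base :: int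
  assumes rb: "r \<noteq> b" "r \<notin> reads e0 \<union> reads ec" "b \<notin> reads e0 \<union> reads ec \<union> reads ev"
    and cnt: "val m ec = int cnt" and base: "val m e0 = base"
    and fits_ec: "fits w m ec" and fits_e0: "fits w m e0"
    and word: "is_word w (int cnt + 1)" "is_word w (base)" "is_word w (base + int cnt)"
    and fits_ev: "\<And>h mh. h < cnt \<Longrightarrow> mh r 0 = int h \<Longrightarrow> (\<And>b'. b' \<noteq> r \<Longrightarrow> b' \<noteq> b \<Longrightarrow> mh b' = m b')
        \<Longrightarrow> fits w mh ev \<and> val mh ev = V h"
    and tau: "3 * cnt + 2 \<le> \<tau>"
    and post: "\<And>m'. (\<And>h. h < cnt \<Longrightarrow> m' b (base + int h) = V h)
      \<Longrightarrow> (\<And>a. a < base \<or> base + int cnt \<le> a \<Longrightarrow> m' b a = m b a)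
      \<Longrightarrow> (\<And>b'. b' \<noteq> r \<Longrightarrow> b' \<noteq> b \<Longrightarrow> m' b' = m b') \<Longrightarrow> Q m'"
  shows "exec w (fill r b e0 ec ev) m \<tau> Q"
proof -
  define I where "I m' \<longleftrightarrow> (\<exists>h \<le> cnt. m' r 0 = int h
      \<and> (\<forall>h'<h. m' b (base + int h') = V h')
      \<and> (\<forall>a. a < base \<or> base + int cnt \<le> a \<longrightarrow> m' b a = m b a)
      \<and> (\<forall>b'. b' \<noteq> r \<longrightarrow> b' \<noteq> b \<longrightarrow> m' b' = m b'))" for m'
  have mono: "is_word w x" if "0 \<le> x" "x \<le> int cnt + 1" for x
    using word(1) that unfolding is_word_def by (smt (verit) zero_le_power)
  have cong: "val m' ec = int cnt" "val m' e0 = base" "fits w m' ec" "fits w m' e0"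
    if "\<And>b'. b' \<noteq> r \<Longrightarrow> b' \<noteq> b \<Longrightarrow> m' b' = m b'" for m'
    using val_cong[of ec m' m] val_cong[of e0 m' m] fits_cong[of ec m' m w] fits_cong[of e0 m' m w]
      that rb cnt base fits_ec fits_e0 by (metis UnCI)+
  show ?thesis
    unfolding fill_def
  proof (rule exec_Seq[where ?\<tau>1.0 = 1 and ?\<tau>2.0 = "1 + cnt * 3"], rule exec_Set)
    let ?m0 = "m(r := (m r)(0 := val m (Const 0)))"
    let ?V = "\<lambda>m'. nat (int cnt - m' r 0)"
    show "exec w (While (Bin Lt (Reg r) ec)
            (Seq (Store b (Bin Add e0 (Reg r)) ev) (Set r (Bin Add (Reg r) (Const 1))))) ?m0
           (1 + cnt * 3) Q"
    proof (rule exec_While[where I = I and V = ?V and \<tau> = 2])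
      fix m' assume I: "I m'" and g: "val m' (Bin Lt (Reg r) ec) \<noteq> 0"
      from I obtain h where h: "h \<le> cnt" "m' r 0 = int h"
        "\<forall>h'<h. m' b (base + int h') = V h'"
        "\<forall>a. a < base \<or> base + int cnt \<le> a \<longrightarrow> m' b a = m b a"
        and fr: "\<And>b'. b' \<noteq> r \<Longrightarrow> b' \<noteq> b \<Longrightarrow> m' b' = m b'" unfolding I_def by blast
      note c = cong[of m', OF fr]
      have hc: "h < cnt" using g h c by (auto split: if_splits)
      have f: "fits w m' ev" "val m' ev = V h" using fits_ev[OF hc h(2) fr] by auto
      have wa: "is_word w (base + int h)" using word(2,3) hc unfolding is_word_def by auto
      let ?m1 = "m'(b := (m' b)(val m' (Bin Add e0 (Reg r)) := val m' ev))"
      let ?m2 = "?m1(r := (?m1 r)(0 := int h + 1))"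
      have I2: "I ?m2" unfolding I_def
        apply (rule exI[of _ "Suc h"])
        using h hc rb f c fr by (auto simp: less_Suc_eq)
      show "exec w (Seq (Store b (Bin Add e0 (Reg r)) ev) (Set r (Bin Add (Reg r) (Const 1)))) m' 2
          (\<lambda>m''. I m'' \<and> ?V m'' < ?V m')"
      proof (rule exec_Seq[where ?\<tau>1.0 = 1 and ?\<tau>2.0 = 1], rule exec_Store)
        show "fits w m' (Bin Add e0 (Reg r))" using c wa h hc mono[of "int h"] by simp
        show "fits w m' ev" by fact
        show "exec w (Set r (Bin Add (Reg r) (Const 1))) ?m1 1 (\<lambda>m''. I m'' \<and> ?V m'' < ?V m')"
        proof (rule exec_Set)
          show "fits w ?m1 (Bin Add (Reg r) (Const 1))"
            using rb h hc mono[of 1] mono[of "int h"] mono[of "int h + 1"] by simp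
          show "I (?m1(r := (?m1 r)(0 := val ?m1 (Bin Add (Reg r) (Const 1))))) \<and>
            ?V (?m1(r := (?m1 r)(0 := val ?m1 (Bin Add (Reg r) (Const 1))))) < ?V m'"
            using I2 rb h hc by simp
        qed simp
      qed auto
    next
      fix m' assume I: "I m'"
      then obtain h where h: "h \<le> cnt" "m' r 0 = int h"
        and fr: "\<And>b'. b' \<noteq> r \<Longrightarrow> b' \<noteq> b \<Longrightarrow> m' b' = m b'" unfolding I_def by blast
      show "fits w m' (Bin Lt (Reg r) ec)"
        using cong[of m', OF fr] h mono[of 1] mono[of "int h"] by auto
    next
      fix m' assume I: "I m'" and g: "val m' (Bin Lt (Reg r) ec) = 0"
      then obtain h where h: "h \<le> cnt" "m' r 0 = int h"
        "\<forall>h'<h. m' b (base + int h') = V h'"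
        "\<forall>a. a < base \<or> base + int cnt \<le> a \<longrightarrow> m' b a = m b a"
        and fr: "\<And>b'. b' \<noteq> r \<Longrightarrow> b' \<noteq> b \<Longrightarrow> m' b' = m b'" unfolding I_def by blast
      have "h = cnt" using cong[of m', OF fr] h g by (auto split: if_splits)
      then show "Q m'" using h fr by (intro post) auto
    next
      show "I ?m0" unfolding I_def using rb by (intro exI[of _ 0]) auto
    qed auto
  qed (use tau in auto)
qed

section \<open>Ruling out overflow\<close>

text \<open>Every value of an expression over cells of absolute value at most \<open>Q\<close> is bounded by
  a power of \<open>Q\<close> that can be read off the expression; hence one bound on \<open>w\<close> rules out overflow.\<close>

fun deg :: "exp \<Rightarrow> nat" where
  "deg (Const v) = nat \<bar>v\<bar>"
| "deg (Cell b e) = 1"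
| "deg (Bin Add e1 e2) = Suc (max (deg e1) (deg e2))"
| "deg (Bin Sub e1 e2) = Suc (max (deg e1) (deg e2))"
| "deg (Bin Mul e1 e2) = deg e1 + deg e2"
| "deg (Bin f e1 e2) = Suc (max (deg e1) (deg e2))"

fun plain :: "exp \<Rightarrow> bool" where
  "plain (Const v) = True"
| "plain (Cell b e) = plain e"
| "plain (Bin f e1 e2) = (f \<in> {Add, Sub, Mul, Quot, Rem, Lt, Eq} \<and> plain e1 \<and> plain e2)"

fun small_cells :: "int \<Rightarrow> mem \<Rightarrow> exp \<Rightarrow> bool" where
  "small_cells Q m (Const v) = True"
| "small_cells Q m (Cell b e) = (small_cells Q m e \<and> \<bar>m b (val m e)\<bar> \<le> Q)"
| "small_cells Q m (Bin f e1 e2) = (small_cells Q m e1 \<and> small_cells Q m e2)"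

text \<open>Rounding towards minus infinity may push a negative quotient away from zero, but never
  beyond the quotient by a divisor of absolute value 1; each sign pattern is compared with that
  divisor.\<close>

lemma abs_div_le: "\<bar>x div y\<bar> \<le> \<bar>x :: int\<bar>"
proof (cases "y = 0")
  case False
  then consider "y > 0" "x \<ge> 0" | "y > 0" "x < 0" | "y < 0" "x > 0" | "y < 0" "x \<le> 0" by linarith
  then show ?thesis
  proof cases
    case 1
    then show ?thesis using zdiv_mono2[of x 1 y] by (simp add: pos_imp_zdiv_nonneg_iff)
  next
    case 2
    then have "x div y \<le> 0" using div_nonpos_pos_le0 by fastforce
    moreover have "x \<le> x div y" using 2 zdiv_mono2_neg[of x 1 y] by simp
    ultimately show ?thesis using 2 by simp
  next
    case 3
    have e: "x div y = (-x) div (-y)" by simp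
    have "(-x) div (-y) \<le> 0" using 3 div_nonpos_pos_le0[of "-x" "-y"] by linarith
    moreover have "-x \<le> (-x) div (-y)" using 3 zdiv_mono2_neg[of "-x" 1 "-y"] by simp
    ultimately show ?thesis using 3 e by linarith
  next
    case 4
    have e: "x div y = (-x) div (-y)" by simp
    have "(-x) div (-y) \<ge> 0" using 4 by (simp add: pos_imp_zdiv_nonneg_iff del: div_minus_minus)
    moreover have "(-x) div (-y) \<le> -x" using 4 zdiv_mono2[of "-x" 1 "-y"] by simp
    ultimately show ?thesis using 4 e by linarith
  qed
qed simp

lemma abs_mod_le: "\<bar>x mod y\<bar> \<le> max \<bar>x\<bar> \<bar>y :: int\<bar>"
proof (cases "y = 0")
  case False
  then show ?thesis using abs_mod_less[of y x] by linarith
qed simp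

text \<open>As \<open>2 \<le> Q\<close>, one further power of \<open>Q\<close> absorbs the factor 2
  of a sum or difference, and \<open>2 ^ nat \<bar>v\<bar>\<close> exceeds a constant
  \<open>v\<close>.\<close>

lemma abs_val_le_power_deg:
  fixes Q :: int
  assumes Q: "2 \<le> Q" and "plain e" "small_cells Q m e"
  shows "\<bar>val m e\<bar> \<le> Q ^ deg e"
  using assms(2,3)
proof (induction e)
  case (Const v)
  have "\<bar>v\<bar> \<le> 2 ^ nat \<bar>v\<bar>"
    using of_nat_less_two_power[of "nat \<bar>v\<bar>", where 'a = int] by simp
  also have "\<dots> \<le> Q ^ nat \<bar>v\<bar>" using Q by (intro power_mono) auto
  finally show ?case by simp
next
  case (Cell b e)
  then show ?case by simp
next
  case (Bin f e1 e2)
  let ?k = "max (deg e1) (deg e2)"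
  have b: "\<bar>val m e1\<bar> \<le> Q ^ deg e1" "\<bar>val m e2\<bar> \<le> Q ^ deg e2" using Bin by auto
  have "Q ^ deg e1 \<le> Q ^ ?k" "Q ^ deg e2 \<le> Q ^ ?k" using Q by (auto intro!: power_increasing)
  then have b': "\<bar>val m e1\<bar> \<le> Q ^ ?k" "\<bar>val m e2\<bar> \<le> Q ^ ?k" using b by auto
  have s: "2 * Q ^ ?k \<le> Q ^ Suc ?k" using Q by simp
  have p: "1 \<le> Q ^ ?k" using Q by simp
  have s': "Q ^ ?k \<le> Q ^ Suc ?k" using Q by (intro power_increasing) auto
  consider "f = Add" | "f = Sub" | "f = Mul" | "f = Quot" | "f = Rem" | "f = Lt" | "f = Eq"
    using Bin by auto
  then show ?case
  proof cases
    case 3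
    then show ?thesis using b Q by (auto simp: abs_mult power_add intro!: mult_mono)
  next
    case 4
    then show ?thesis using b' s' abs_div_le[of "val m e1" "val m e2"] by (simp del: power_Suc)
  next
    case 5
    then show ?thesis using b' s' abs_mod_le[of "val m e1" "val m e2"]
      by (simp add: le_max_iff_disj del: power_Suc) linarith
  qed (use b' s s' p in \<open>simp del: power_Suc, linarith?\<close>)+
qed

text \<open>The maximum of the degrees of all subexpressions, since every intermediate result has to
  be a word. The degree of the whole expression is not enough: a cell has degree 1 whatever its
  address is.\<close>

fun cdeg :: "exp \<Rightarrow> nat" where
  "cdeg (Const v) = nat \<bar>v\<bar>"
| "cdeg (Cell b e) = max 1 (cdeg e)"
| "cdeg (Bin f e1 e2) = max (deg (Bin f e1 e2)) (max (cdeg e1) (cdeg e2))"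

text \<open>The exponent \<open>Suc d\<close> gives a strict inequality below \<open>2 ^ w\<close>,
  which is needed because words exclude \<open>2 ^ w\<close> itself.\<close>

lemma fits_if_small_cells:
  fixes Q :: int
  assumes Q: "2 \<le> Q" and w: "Q ^ Suc d \<le> 2 ^ w"
    and "plain e" "small_cells Q m e" "cdeg e \<le> d"
  shows "fits w m e"
  using assms(3-)
proof (induction e)
  have word: "is_word w v" if "\<bar>v\<bar> \<le> Q ^ k" "k \<le> d" for v k
  proof -
    have "Q ^ k \<le> Q ^ d" using Q that by (auto intro!: power_increasing)
    moreover have "Q ^ d < Q ^ Suc d" using Q by simp
    ultimately show ?thesis using w that unfolding is_word_def by linarith
  qed
  {
    case (Const v)
    then show ?case
      using word[of v "deg (Const v)"] abs_val_le_power_deg[OF Q Const(1,2)] by simp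
  next
    case (Cell b e)
    then show ?case using word[of "m b (val m e)" 1] by simp
  next
    case (Bin f e1 e2)
    have "is_word w (apply_op f (val m e1) (val m e2))"
      using word[of "val m (Bin f e1 e2)" "deg (Bin f e1 e2)"] Bin
        abs_val_le_power_deg[OF Q Bin(3,4)] by simp
    then show ?case using Bin by simp
  }
qed

section \<open>The minimum triangle as a least weight subsequence\<close>

text \<open>In a triangle, \<open>B\<close> does not depend on \<open>i\<close>, \<open>A\<close>
  not on \<open>j\<close> and \<open>C\<close> not on \<open>k\<close>, so each can be the matrix of
  a slice along the missing axis. The indicator of a crossing, \<open>s < i\<close> and
  \<open>k \<le> s\<close>, does not depend on \<open>j\<close> and splits into a part for the
  vector and a part for the matrix. Indices are shifted to start from 0 and reduced modulo
  \<open>s\<close>: row \<open>i > s\<close>, row \<open>k \<le> s\<close> and any column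
  \<open>j\<close> stand for elements of the three blocks. The zero tensor is padded to three slices
  with the same sequence of axes.\<close>

definition gadget :: "nat \<Rightarrow> (nat \<Rightarrow> nat \<Rightarrow> int) \<Rightarrow> (nat \<Rightarrow> nat \<Rightarrow> int) \<Rightarrow> (nat \<Rightarrow> nat \<Rightarrow> int)
    \<Rightarrow> slice list \<times> slice list" where
  "gadget s A B C =
    ([Slice AxI (\<lambda>i. of_bool (s < i)) (\<lambda>j k. of_bool (k \<le> s) * B ((k - 1) mod s) ((j - 1) mod s)),
      Slice AxJ (\<lambda>j. 1) (\<lambda>i k. of_bool (s < i \<and> k \<le> s) * A ((i - 1) mod s) ((k - 1) mod s)),
      Slice AxK (\<lambda>k. of_bool (k \<le> s)) (\<lambda>i j. of_bool (s < i) * C ((i - 1) mod s) ((j - 1) mod s))],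
     map (\<lambda>ax. Slice ax (\<lambda>_. 0) (\<lambda>_ _. 0)) [AxI, AxJ, AxK])"

lemma decomp_gadget:
  "decomp_tensor (fst (gadget s A B C)) i j k = of_bool (s < i \<and> k \<le> s) *
     (A ((i - 1) mod s) ((k - 1) mod s) + B ((k - 1) mod s) ((j - 1) mod s)
      + C ((i - 1) mod s) ((j - 1) mod s))"
  "decomp_tensor (snd (gadget s A B C)) i j k = 0"
  by (auto simp: gadget_def decomp_tensor_def algebra_simps)

lemma lws2d_le_vertical:
  assumes "1 \<le> k" "k < i"
  shows "lws2d w1 w2 i j \<le> lws2d w1 w2 k j + w1 i j k"
proof -
  have "lws2d w1 w2 i j \<le> (INF k \<in> {1..<i}. lws2d w1 w2 k j + w1 i j k)"
    using assms by (subst lws2d.simps) auto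
  also have "\<dots> \<le> lws2d w1 w2 k j + w1 i j k"
    using assms by (intro INF_lower) auto
  finally show ?thesis .
qed

lemma lws2d_le_horizontal:
  assumes "1 \<le> k" "k < j"
  shows "lws2d w1 w2 i j \<le> lws2d w1 w2 i k + w2 i j k"
proof -
  have "lws2d w1 w2 i j \<le> (INF k \<in> {1..<j}. lws2d w1 w2 i k + w2 i j k)"
    using assms by (subst lws2d.simps) auto
  also have "\<dots> \<le> lws2d w1 w2 i k + w2 i j k"
    using assms by (intro INF_lower) auto
  finally show ?thesis .
qed

text \<open>Horizontal moves are free, vertical moves are free except for the single crossing from a row
  \<open>k \<le> s\<close> to a row \<open>i > s\<close>, which costs \<open>f i j k\<close>. Hence the optimum is the minimum of \<open>f\<close>.\<close>

lemma lws2d_single_crossing: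
  fixes f :: "nat \<Rightarrow> nat \<Rightarrow> nat \<Rightarrow> int"
  assumes s: "1 \<le> s"
    and w1: "\<And>i j k. w1 i j k = ereal (real_of_int (of_bool (s < i \<and> k \<le> s) * f i j k))"
    and w2: "\<And>i j k. w2 i j k = 0"
    and v: "ereal (real_of_int v) = lws2d w1 w2 (2 * s) (2 * s)"
  shows "\<exists>i\<in>{s<..2 * s}. \<exists>j\<in>{1..2 * s}. \<exists>k\<in>{1..s}. v = f i j k"
    and "\<And>i j k. i \<in> {s<..2 * s} \<Longrightarrow> j \<in> {1..2 * s} \<Longrightarrow> k \<in> {1..s} \<Longrightarrow> v \<le> f i j k"
proof -
  let ?T = "lws2d w1 w2"
  define S where "S = (\<lambda>(i, j, k). f i j k) ` ({s<..2 * s} \<times> {1..2 * s} \<times> {1..s})"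
  have fin: "finite S" "S \<noteq> {}" unfolding S_def using s by auto
  define \<mu> where "\<mu> = Min S"
  have mu: "\<mu> \<in> S" "\<And>x. x \<in> S \<Longrightarrow> \<mu> \<le> x" unfolding \<mu>_def using fin by auto
  \<comment> \<open>Before the crossing nothing is paid, after it at least one value of
    \<open>f\<close>. Inside each half all moves are free, so the two bounds are carried along by
    induction.\<close>
  have lower: "(i \<le> s \<longrightarrow> 0 \<le> ?T i j) \<and> (s < i \<longrightarrow> ereal (real_of_int \<mu>) \<le> ?T i j)"
    if "1 \<le> i" "1 \<le> j" "i \<le> 2 * s" "j \<le> 2 * s" for i j
    using that
  proof (induction "i + j" arbitrary: i j rule: less_induct)
    case less
    show ?case
    proof (cases "i = 1 \<and> j = 1")
      case True
      then show ?thesis using s by (simp add: lws2d.simps)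
    next
      case False
      define L where "L = (if i \<le> s then 0 else ereal (real_of_int \<mu>))"
      have "L \<le> ?T k j + w1 i j k" if "k \<in> {1..<i}" for k
      proof -
        have ih: "(k \<le> s \<longrightarrow> 0 \<le> ?T k j) \<and> (s < k \<longrightarrow> ereal (real_of_int \<mu>) \<le> ?T k j)"
          using that less.prems by (intro less.hyps) auto
        show ?thesis
        proof (cases "s < i \<and> k \<le> s")
          case True
          have "f i j k \<in> S" unfolding S_def using True less.prems that by force
          then have "ereal (real_of_int \<mu>) \<le> w1 i j k" using mu(2) w1 True by simp
          then have "0 + ereal (real_of_int \<mu>) \<le> ?T k j + w1 i j k"
            using ih True by (intro add_mono) auto
          then show ?thesis using True by (simp add: L_def)
        next
          case F: False
          then have "w1 i j k = 0" using w1 by (auto simp: zero_ereal_def)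
          then show ?thesis using ih F that by (auto simp: L_def)
        qed
      qed
      moreover have "L \<le> ?T i k + w2 i j k" if "k \<in> {1..<j}" for k
      proof -
        have "(i \<le> s \<longrightarrow> 0 \<le> ?T i k) \<and> (s < i \<longrightarrow> ereal (real_of_int \<mu>) \<le> ?T i k)"
          using that less.prems by (intro less.hyps) auto
        then show ?thesis using w2 by (auto simp: L_def)
      qed
      ultimately have "L \<le> ?T i j"
        using False by (subst lws2d.simps) (auto intro!: INF_greatest)
      then show ?thesis by (auto simp: L_def split: if_splits)
    qed
  qed
  \<comment> \<open>The optimal route for a given triple goes along row 1 to column
    \<open>j\<close>, down to row \<open>k\<close>, across to row \<open>i\<close>, down to the last
    row and along it to the last column. A leg of length 0 needs its own case, as a move strictly
    increases an index.\<close>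
  have T11: "?T (Suc 0) (Suc 0) = 0" by (subst lws2d.simps) simp
  have T1: "?T 1 j \<le> 0" if "1 \<le> j" for j
  proof (cases "j = 1")
    case False
    then show ?thesis using lws2d_le_horizontal[of 1 j w1 w2 1] that w2
      by (simp add: T11)
  qed (simp add: T11)
  have Tk: "?T k j \<le> 0" if "1 \<le> j" "1 \<le> k" "k \<le> s" for k j
  proof (cases "k = 1")
    case False
    then show ?thesis using lws2d_le_vertical[of 1 k w1 w2 j] that w1 T1[of j] by simp
  qed (use T1 that in auto)
  have Ti: "?T i j \<le> f i j k" if "1 \<le> j" "1 \<le> k" "k \<le> s" "s < i" for i j k
  proof -
    have "?T i j \<le> ?T k j + w1 i j k" using that by (intro lws2d_le_vertical) auto
    also have "\<dots> \<le> 0 + w1 i j k" using Tk that by (intro add_mono) auto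
    finally show ?thesis using that w1 by simp
  qed
  have TN: "?T (2 * s) j \<le> f i j k"
    if "1 \<le> j" "1 \<le> k" "k \<le> s" "s < i" "i \<le> 2 * s" for i j k
  proof (cases "i = 2 * s")
    case False
    then have "?T (2 * s) j \<le> ?T i j + w1 (2 * s) j i"
      using that by (intro lws2d_le_vertical) auto
    then show ?thesis using Ti[of j k i] that w1 by simp
  qed (use Ti that in auto)
  have upper: "v \<le> f i j k"
    if "i \<in> {s<..2 * s}" "j \<in> {1..2 * s}" "k \<in> {1..s}" for i j k
  proof -
    have "?T (2 * s) (2 * s) \<le> f i j k"
    proof (cases "j = 2 * s")
      case False
      then have "?T (2 * s) (2 * s) \<le> ?T (2 * s) j + w2 (2 * s) (2 * s) j"
        using that by (intro lws2d_le_horizontal) auto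
      also have "\<dots> = ?T (2 * s) j" using w2 by simp
      also have "\<dots> \<le> f i j k" using TN[of j k i] that by simp
      finally show ?thesis .
    qed (use TN[of j k i] that in auto)
    then show ?thesis using v[symmetric] by simp
  qed
  show "\<And>i j k. i \<in> {s<..2 * s} \<Longrightarrow> j \<in> {1..2 * s} \<Longrightarrow> k \<in> {1..s} \<Longrightarrow> v \<le> f i j k"
    by (rule upper)
  have "\<mu> \<le> v" using lower[of "2 * s" "2 * s"] s v[symmetric] by simp
  obtain i j k where ijk: "i \<in> {s<..2 * s}" "j \<in> {1..2 * s}" "k \<in> {1..s}" "\<mu> = f i j k"
    using mu(1) unfolding S_def by auto
  with upper \<open>\<mu> \<le> v\<close> have "v = f i j k" by (intro antisym) auto
  with ijk show "\<exists>i\<in>{s<..2 * s}. \<exists>j\<in>{1..2 * s}. \<exists>k\<in>{1..s}. v = f i j k" by blast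
qed

text \<open>Reduction modulo \<open>s\<close> maps the crossings onto the triples of the block:
  \<open>(i, j, k)\<close>, counted from 0, is met by the crossing in column \<open>j + 1\<close>
  from row \<open>k + 1\<close> to row \<open>s + i + 1\<close>.\<close>

lemma lws2d_gadget:
  assumes s: "1 \<le> s" and out: "lws2d_slice_output (2 * s) (gadget s A B C) m"
  shows "\<exists>i<s. \<exists>j<s. \<exists>k<s. m 4 0 = A i k + B k j + C i j"
    and "\<And>i j k. i < s \<Longrightarrow> j < s \<Longrightarrow> k < s \<Longrightarrow> m 4 0 \<le> A i k + B k j + C i j"
proof -
  define f where "f i j k = A ((i - 1) mod s) ((k - 1) mod s) + B ((k - 1) mod s) ((j - 1) mod s)
      + C ((i - 1) mod s) ((j - 1) mod s)" for i j k
  have "ereal (real_of_int (m 4 0)) =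
     lws2d (\<lambda>i j k. ereal (real_of_int (of_bool (s < i \<and> k \<le> s) * f i j k))) (\<lambda>i j k. 0) (2 * s) (2 * s)"
    using out by (simp add: lws2d_slice_output_def case_prod_beta decomp_gadget f_def
        flip: zero_ereal_def)
  note cross = lws2d_single_crossing[where f = f, OF s refl refl this]
  from cross(1) obtain i j k where "m 4 0 = f i j k" by blast
  moreover have "(i - 1) mod s < s" "(j - 1) mod s < s" "(k - 1) mod s < s" using s by auto
  ultimately show "\<exists>i<s. \<exists>j<s. \<exists>k<s. m 4 0 = A i k + B k j + C i j" unfolding f_def by blast
  fix i j k assume ijk: "i < s" "j < s" "k < s"
  have "m 4 0 \<le> f (s + i + 1) (j + 1) (k + 1)" by (rule cross(2)) (use ijk in auto)
  moreover have "f (s + i + 1) (j + 1) (k + 1) = A i k + B k j + C i j"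
    unfolding f_def using ijk by simp
  ultimately show "m 4 0 \<le> A i k + B k j + C i j" by simp
qed

text \<open>The factor 3 pays for the tensor entries, which are sums of three matrix entries.
  Reduction modulo \<open>s\<close> extends the bounds on the block to all arguments.\<close>

lemma gadget_in_instances:
  fixes b :: int
  assumes "1 \<le> s"
    and "\<And>i j. i < s \<Longrightarrow> j < s \<Longrightarrow> \<bar>A i j\<bar> \<le> b \<and> \<bar>B i j\<bar> \<le> b \<and> \<bar>C i j\<bar> \<le> b"
    and b: "1 \<le> b" "3 * b \<le> int (2 * s) ^ c"
  shows "gadget s A B C \<in> lws2d_slice_instances 3 c (2 * s)"
proof -
  have m: "x mod s < s" for x using assms(1) by simp
  note bd = assms(2)[OF m m]
  have bc: "b \<le> int (2 * s) ^ c" "1 \<le> int (2 * s) ^ c" "0 \<le> int (2 * s) ^ c" using b by auto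
  have bd': "\<bar>A (x mod s) (y mod s)\<bar> \<le> int (2 * s) ^ c" "\<bar>B (x mod s) (y mod s)\<bar> \<le> int (2 * s) ^ c"
    "\<bar>C (x mod s) (y mod s)\<bar> \<le> int (2 * s) ^ c" for x y
    using bd[of x y] bc(1) by auto
  have le: "\<bar>of_bool P * x\<bar> \<le> int (2 * s) ^ c" if "\<bar>x\<bar> \<le> b" for x P
    using that bc by (cases P) auto
  have sum: "\<bar>of_bool P * (x + y + z)\<bar> \<le> int (2 * s) ^ c" if "\<bar>x\<bar> \<le> b" "\<bar>y\<bar> \<le> b" "\<bar>z\<bar> \<le> b" for x y z P
    using that b bc by (cases P) auto
  have d: "\<bar>decomp_tensor D i j k\<bar> \<le> int (2 * s) ^ c"
    if "D \<in> {fst (gadget s A B C), snd (gadget s A B C)}" for D i j k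
    using that sum bd bc by (auto simp: decomp_gadget simp del: of_nat_mult)
  have e: "\<bar>slice_vec sl i\<bar> \<le> int (2 * s) ^ c \<and> \<bar>slice_mat sl i j\<bar> \<le> int (2 * s) ^ c"
    if "sl \<in> set (fst (gadget s A B C)) \<union> set (snd (gadget s A B C))" for sl i j
    using that unfolding gadget_def
    by (auto intro!: le simp: bd bd' bc simp del: of_nat_mult)
  show ?thesis
    unfolding lws2d_slice_instances_def mem_Collect_eq case_prod_beta
    using d e by (auto simp: gadget_def simp del: of_nat_mult)
qed

text \<open>Bridges the encoding, whose indices start from 1, and loops that count from 0: replacing
  \<open>i\<close> and \<open>j\<close> by their successors shifts a vector address by 1 and a
  matrix address by \<open>N + 1\<close>.\<close>

lemma lws2d_slice_input_gadget:
  fixes s :: nat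
  defines "N \<equiv> 2 * s"
  assumes s: "1 \<le> s" and size: "m 0 0 = int N"
    and axes: "\<And>q. q < 6 \<Longrightarrow> m 1 (int q) = int (q mod 3)"
    and vecs: "\<And>q i. q < 6 \<Longrightarrow> i < N \<Longrightarrow> m 2 (int (q * N + i) + 1) =
       (if q = 0 then of_bool (s \<le> i) else if q = 1 then 1 else if q = 2 then of_bool (i < s) else 0)"
    and mats: "\<And>q i j. q < 6 \<Longrightarrow> i < N \<Longrightarrow> j < N \<Longrightarrow> m 3 (int ((q * N + i) * N + j) + int N + 1) =
       (if q = 0 then of_bool (j < s) * B (j mod s) (i mod s)
        else if q = 1 then of_bool (s \<le> i \<and> j < s) * A (i mod s) (j mod s)
        else if q = 2 then of_bool (s \<le> i) * C (i mod s) (j mod s) else 0)"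
  shows "lws2d_slice_input N (gadget s A B C) m"
proof -
  define L where "L = fst (gadget s A B C) @ snd (gadget s A B C)"
  have len: "length L = 6" by (simp add: L_def gadget_def)
  have "m 1 (int q) = axis_code (slice_axis (L ! q))
      \<and> (\<forall>i\<in>{1..N}. m 2 (int (q * N + i)) = slice_vec (L ! q) i)
      \<and> (\<forall>i\<in>{1..N}. \<forall>j\<in>{1..N}. m 3 (int ((q * N + i) * N + j)) = slice_mat (L ! q) i j)"
    if q: "q < 6" for q
  proof -
    consider "q = 0" | "q = 1" | "q = 2" | "q = 3" | "q = 4" | "q = 5" using q by linarith
    note qs = this
    have 1: "m 1 (int q) = axis_code (slice_axis (L ! q))"
      unfolding axes[OF q] by (cases rule: qs) (simp_all add: L_def gadget_def)
    have 2: "m 2 (int (q * N + i)) = slice_vec (L ! q) i" if "i \<in> {1..N}" for i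
    proof -
      define i' where "i' = i - 1"
      have i': "i = Suc i'" "i' < N" using that by (auto simp: i'_def)
      have e: "int (q * N + i) = int (q * N + i') + 1" using i' by simp
      show ?thesis
        unfolding e vecs[OF q i'(2)] unfolding i'(1) by (cases rule: qs) (auto simp: L_def gadget_def)
    qed
    have 3: "m 3 (int ((q * N + i) * N + j)) = slice_mat (L ! q) i j"
      if "i \<in> {1..N}" "j \<in> {1..N}" for i j
    proof -
      define i' where "i' = i - 1"
      have i': "i = Suc i'" "i' < N" using that by (auto simp: i'_def)
      define j' where "j' = j - 1"
      have j': "j = Suc j'" "j' < N" using that by (auto simp: j'_def)
      have e: "int ((q * N + i) * N + j) = int ((q * N + i') * N + j') + int N + 1"
        using i' j' by (simp add: algebra_simps)
      show ?thesis
        unfolding e mats[OF q i'(2) j'(2)] unfolding i'(1) j'(1)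
        by (cases rule: qs) (auto simp: L_def gadget_def)
    qed
    show ?thesis using 1 2 3 by blast
  qed
  then show ?thesis using size len
    unfolding lws2d_slice_input_def case_prod_beta L_def[symmetric] Let_def by auto
qed

section \<open>Distances by min-plus squaring\<close>

definition is_minplus_square :: "nat \<Rightarrow> (nat \<Rightarrow> nat \<Rightarrow> int) \<Rightarrow> (nat \<Rightarrow> nat \<Rightarrow> int) \<Rightarrow> bool" where
  "is_minplus_square n D X \<longleftrightarrow> (\<forall>i<n. \<forall>j<n.
     (\<exists>k<n. X i j = D i k + D k j) \<and> (\<forall>k<n. X i j \<le> D i k + D k j))"

locale apsp_instance =
  fixes n c :: nat and E :: "(nat \<times> nat) set" and wt :: "nat \<times> nat \<Rightarrow> int"
  assumes n: "1 \<le> n" and inst: "(E, wt) \<in> apsp_instances c n"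
begin

lemma E: "E \<subseteq> {..<n} \<times> {..<n}"
  and wt: "e \<in> E \<Longrightarrow> \<bar>wt e\<bar> \<le> int n ^ c"
  and nonneg_cycle: "pre_digraph.awalk (graph_on n E) u p u
    \<Longrightarrow> 0 \<le> wf_digraph.awalk_cost (\<lambda>e. real_of_int (wt e)) p"
  using inst unfolding apsp_instances_def by auto

sublocale G: fin_digraph "graph_on n E"
proof
  show "finite (arcs (graph_on n E))"
    using finite_subset[OF E] by (simp add: graph_on_def)
qed (use E in \<open>auto simp: graph_on_def\<close>)

lemma graph_simps [simp]: "verts (graph_on n E) = {..<n}" "arcs (graph_on n E) = E"
    "tail (graph_on n E) = fst" "head (graph_on n E) = snd"
  by (simp_all add: graph_on_def)

definition cost :: "(nat \<times> nat) list \<Rightarrow> int" where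
  "cost p = (\<Sum>e\<leftarrow>p. wt e)"

lemma cost_append: "cost (p @ q) = cost p + cost q"
  by (simp add: cost_def)

lemma awalk_cost_eq: "G.awalk_cost (\<lambda>e. real_of_int (wt e)) p = real_of_int (cost p)"
  by (induction p) (auto simp: cost_def)

text \<open>A simple path costs less than \<open>n * n ^ c\<close> in absolute value or is 0, hence
  at most \<open>M / 4\<close>. A sum of at most \<open>2 * n\<close> weights with a missing arc
  among them is at least \<open>M - 2 * n * n ^ c = M / 2\<close>. So the threshold
  \<open>M / 2\<close> tells them apart.\<close>

abbreviation M :: int where "M \<equiv> 4 * int n ^ (c + 1)"

lemma W: "1 \<le> int n ^ c" "int n ^ c \<le> M"
proof -
  show 1: "1 \<le> int n ^ c" using n by simp
  have "1 * int n ^ c \<le> 4 * int n * int n ^ c" using n by (intro mult_right_mono) auto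
  then show "int n ^ c \<le> M" by simp
qed

text \<open>An entry need not be a distance while walks of more than \<open>len\<close> arcs may be
  cheaper. It is either the cost of some walk, of whatever length, or so large that it must come
  from a missing arc, and it is no worse than any walk of at most \<open>len\<close> arcs. The outer
  bounds serve to exclude overflow.\<close>

definition approx :: "nat \<Rightarrow> (nat \<Rightarrow> nat \<Rightarrow> int) \<Rightarrow> bool" where
  "approx len D \<longleftrightarrow> (\<forall>u<n. \<forall>v<n.
     - (int len * int n ^ c) \<le> D u v \<and> D u v \<le> int len * M \<and>
     ((\<exists>p. G.awalk u p v \<and> D u v = cost p) \<or> M - int len * int n ^ c \<le> D u v) \<and>
     (\<forall>p. G.awalk u p v \<longrightarrow> length p \<le> len \<longrightarrow> D u v \<le> cost p))"

lemma approx_init: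
  assumes D: "\<And>u v. u < n \<Longrightarrow> v < n \<Longrightarrow>
    D u v = (if u = v then 0 else if (u, v) \<in> E then wt (u, v) else M)"
  shows "approx 1 D"
  unfolding approx_def
proof (intro allI impI conjI)
  fix u v assume uv: "u < n" "v < n"
  show "- (int 1 * int n ^ c) \<le> D u v" "D u v \<le> int 1 * M"
    using D[OF uv] W wt[of "(u, v)"] by auto
  show "(\<exists>p. G.awalk u p v \<and> D u v = cost p) \<or> M - int 1 * int n ^ c \<le> D u v"
  proof (cases "u = v \<or> (u, v) \<in> E")
    case True
    then have "G.awalk u (if u = v then [] else [(u, v)]) v"
      using uv by (auto simp: G.awalk_simps)
    moreover have "D u v = cost (if u = v then [] else [(u, v)])"
      using D[OF uv] True by (auto simp: cost_def)
    ultimately show ?thesis by blast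
  next
    case False
    then show ?thesis using D[OF uv] W by auto
  qed
  fix p assume p: "G.awalk u p v" and len: "length p \<le> 1"
  then consider "p = []" "u = v" | "p = [(u, v)]" "(u, v) \<in> E"
    by (cases p) (auto simp: G.awalk_simps)
  then show "D u v \<le> cost p"
  proof cases
    case 2
    \<comment> \<open>A loop at \<open>u\<close> is a closed walk, hence costs at least the 0 stored
      on the diagonal.\<close>
    then have "u = v \<Longrightarrow> 0 \<le> cost p"
      using nonneg_cycle[of u p] p awalk_cost_eq[of p] by simp
    then show ?thesis using D[OF uv] 2 by (auto simp: cost_def)
  qed (use D[OF uv] in \<open>auto simp: cost_def\<close>)
qed

text \<open>A walk of at most \<open>2 * len\<close> arcs is cut after \<open>len\<close> arcs; if
  it is shorter, the second part is the empty walk. If one of the two summands is the large kind of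
  entry, the other lowers it by at most \<open>len * n ^ c\<close>.\<close>

lemma approx_square:
  assumes D: "approx len D" and X: "is_minplus_square n D X"
  shows "approx (2 * len) X"
  unfolding approx_def
proof (intro allI impI conjI)
  fix u v assume uv: "u < n" "v < n"
  obtain k where k: "k < n" "X u v = D u k + D k v"
    using X uv unfolding is_minplus_square_def by blast
  have 1: "- (int len * int n ^ c) \<le> D u k" "D u k \<le> int len * M"
    "(\<exists>p. G.awalk u p k \<and> D u k = cost p) \<or> M - int len * int n ^ c \<le> D u k"
    using D uv k unfolding approx_def by auto
  have 2: "- (int len * int n ^ c) \<le> D k v" "D k v \<le> int len * M"
    "(\<exists>p. G.awalk k p v \<and> D k v = cost p) \<or> M - int len * int n ^ c \<le> D k v"
    using D uv k unfolding approx_def by auto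
  show "- (int (2 * len) * int n ^ c) \<le> X u v" "X u v \<le> int (2 * len) * M"
    using 1 2 k by (auto simp: algebra_simps)
  have "\<exists>p. G.awalk u p v \<and> X u v = cost p"
    if "G.awalk u p k" "D u k = cost p" "G.awalk k q v" "D k v = cost q" for p q
    using G.awalk_appendI[OF that(1,3)] that k cost_append[of p q] by metis
  then show "(\<exists>p. G.awalk u p v \<and> X u v = cost p) \<or> M - int (2 * len) * int n ^ c \<le> X u v"
    using 1 2 k(2) W(2) W(1) by (auto simp: algebra_simps)
  fix p assume p: "G.awalk u p v" "length p \<le> 2 * len"
  define q r where "q = take len p" and "r = drop len p"
  have pqr: "p = q @ r" "length q \<le> len" "length r \<le> len" using p by (auto simp: q_def r_def)
  then obtain x where x: "G.awalk u q x" "G.awalk x r v"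
    using p by auto
  then have "x < n" using G.awalk_last_in_verts by auto
  then have "X u v \<le> D u x + D x v" using X uv unfolding is_minplus_square_def by blast
  also have "\<dots> \<le> cost q + cost r"
    using D uv \<open>x < n\<close> x pqr unfolding approx_def by (intro add_mono) auto
  finally show "X u v \<le> cost p" using pqr cost_append by simp
qed

text \<open>Without negative cycles the distance is attained by a simple path, which has fewer than
  \<open>n \<le> len\<close> arcs, so the entry is at most the distance. From
  \<open>len \<le> 2 * n\<close> an entry below \<open>M / 2\<close> is the cost of a real walk, so
  it is at least the distance.\<close>

lemma approx_dist:
  assumes D: "approx len D" and len: "n \<le> len" "len \<le> 2 * n" and uv: "u < n" "v < n"
  defines "\<delta> \<equiv> G.\<mu> (\<lambda>e. real_of_int (wt e)) u v"
  shows "if \<delta> = \<infinity> then \<not> 2 * D u v < M else 2 * D u v < M \<and> \<delta> = ereal (real_of_int (D u v))"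
proof -
  have P: "(\<exists>p. G.awalk u p v \<and> D u v = cost p) \<or> M - int len * int n ^ c \<le> D u v"
    "\<And>p. G.awalk u p v \<Longrightarrow> length p \<le> len \<Longrightarrow> D u v \<le> cost p"
    using D uv unfolding approx_def by auto
  have "int len * int n ^ c \<le> 2 * int n * int n ^ c" using len by (intro mult_right_mono) auto
  then have fake: "2 * D u v < M \<Longrightarrow> \<exists>p. G.awalk u p v \<and> D u v = cost p" using P(1) by auto
  show ?thesis
  proof (cases "\<delta> = \<infinity>")
    case True
    then have "\<not> (\<exists>p. G.awalk u p v)"
      using G.\<mu>_reach_conv[of "\<lambda>e. real_of_int (wt e)" u v] G.reachable_awalk[of u v]
      unfolding \<delta>_def by auto
    then show ?thesis using True fake by auto
  next
    case False
    then have reach: "u \<rightarrow>\<^sup>*\<^bsub>graph_on n E\<^esub> v"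
      using G.\<mu>_reach_conv[of "\<lambda>e. real_of_int (wt e)" u v] unfolding \<delta>_def by auto
    obtain p where p: "G.apath u p v" "\<delta> = ereal (G.awalk_cost (\<lambda>e. real_of_int (wt e)) p)"
      using G.no_neg_cyc_reach_imp_path[OF reach, of "\<lambda>e. real_of_int (wt e)"] nonneg_cycle
      unfolding \<delta>_def by (metis not_less)
    have \<delta>: "\<delta> = ereal (real_of_int (cost p))" using p awalk_cost_eq by simp
    have walk: "G.awalk u p v" using p G.awalkI_apath by blast
    have "length p < card (verts (graph_on n E))" using G.length_apath_less[OF p(1)] .
    then have lp: "length p < n" by simp
    have le: "D u v \<le> cost p" using P(2)[OF walk] lp len by auto
    have "set p \<subseteq> E" using walk by (auto simp: G.awalk_def)
    then have "cost p \<le> int (length p) * int n ^ c" unfolding cost_def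
    proof (induction p)
      case (Cons e p)
      then show ?case using wt[of e] by (simp add: algebra_simps)
    qed simp
    also have "\<dots> \<le> int n * int n ^ c" using lp by (intro mult_right_mono) auto
    finally have "cost p \<le> int n * int n ^ c" .
    moreover have "0 < int n * int n ^ c" using n by simp
    ultimately have lt: "2 * D u v < M" using le by simp
    then obtain q where q: "G.awalk u q v" "D u v = cost q" using fake by blast
    have "\<delta> \<le> ereal (real_of_int (cost q))"
      using G.min_cost_le_walk_cost[OF q(1), of "\<lambda>e. real_of_int (wt e)"] awalk_cost_eq
      unfolding \<delta>_def by simp
    then have "D u v = cost p" using le q \<delta> by simp
    then show ?thesis using lt \<delta> False by simp
  qed
qed

end

section \<open>Writing the instances to memory\<close>

abbreviation add_exp (infixl "[+]" 65) where "e1 [+] e2 \<equiv> Bin Add e1 e2"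
abbreviation sub_exp (infixl "[-]" 65) where "e1 [-] e2 \<equiv> Bin Sub e1 e2"
abbreviation mul_exp (infixl "[*]" 70) where "e1 [*] e2 \<equiv> Bin Mul e1 e2"
abbreviation div_exp (infixl "[div]" 70) where "e1 [div] e2 \<equiv> Bin Quot e1 e2"
abbreviation mod_exp (infixl "[mod]" 70) where "e1 [mod] e2 \<equiv> Bin Rem e1 e2"
abbreviation less_exp (infix "[<]" 50) where "e1 [<] e2 \<equiv> Bin Lt e1 e2"
abbreviation eq_exp (infix "[=]" 50) where "e1 [=] e2 \<equiv> Bin Eq e1 e2"
abbreviation seq_com (infixr ";;" 40) where "c1 ;; c2 \<equiv> Seq c1 c2"

text \<open>The banks below \<open>B\<close> are left to the oracle \<open>p\<close> for 2D LWS, which may overwrite all of them.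
  \<open>rI\<close>, \<open>rJ\<close>, \<open>rK\<close> hold the first indices of the current blocks, \<open>rM\<close> the weight of a missing arc,
  \<open>rR\<close> a bound on the matrix in \<open>bD\<close>, and \<open>rg\<close> the current length of the bisection intervals, whose lower
  ends are in \<open>bX\<close> and whose midpoints are in \<open>bY\<close>.\<close>

context
  fixes B :: nat
begin

abbreviation "rh \<equiv> B + 5"
abbreviation "rn \<equiv> B + 6"
abbreviation "rs \<equiv> B + 7"
abbreviation "rN \<equiv> B + 8"
abbreviation "rnb \<equiv> B + 9"
abbreviation "rM \<equiv> B + 10"
abbreviation "rlen \<equiv> B + 11"
abbreviation "rR \<equiv> B + 12"
abbreviation "rg \<equiv> B + 13"
abbreviation "rt \<equiv> B + 14"
abbreviation "rI \<equiv> B + 15"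
abbreviation "rJ \<equiv> B + 16"
abbreviation "rK \<equiv> B + 17"
abbreviation "bD \<equiv> B + 18"
abbreviation "bX \<equiv> B + 19"
abbreviation "bY \<equiv> B + 20"

definition gidx :: "nat \<Rightarrow> exp \<Rightarrow> exp" where
  "gidx r e = (Reg r [+] e [mod] Reg rs) [mod] Reg rn"

definition entry :: "nat \<Rightarrow> exp \<Rightarrow> exp \<Rightarrow> exp" where
  "entry b e1 e2 = Cell b (e1 [*] Reg rn [+] e2)"

abbreviation "hrow \<equiv> Reg rh [div] Reg rN"
abbreviation "hcol \<equiv> Reg rh [mod] Reg rN"

text \<open>The three digits of the counter \<open>rt\<close> in base \<open>rnb\<close> are the
  numbers of the current blocks.\<close>

definition set_block :: com where
  "set_block =
     (Set rI (Reg rt [div] (Reg rnb [*] Reg rnb) [*] Reg rs) ;;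
      Set rJ (Reg rt [div] Reg rnb [mod] Reg rnb [*] Reg rs) ;;
      Set rK (Reg rt [mod] Reg rnb [*] Reg rs))"

definition fill_axes :: com where
  "fill_axes = fill rh 1 (Const 0) (Const 6) (Reg rh [mod] Const 3)"

definition fill_vecs :: com where
  "fill_vecs = fill rh 2 (Const 1) (Const 6 [*] Reg rN)
     ((hrow [=] Const 0) [*] (Const 1 [-] (hcol [<] Reg rs)) [+] (hrow [=] Const 1)
      [+] (hrow [=] Const 2) [*] (hcol [<] Reg rs))"

definition mat_base :: "int \<Rightarrow> exp" where
  "mat_base q = Const q [*] (Reg rN [*] Reg rN) [+] (Reg rN [+] Const 1)"

text \<open>\<open>hrow\<close> and \<open>hcol\<close> are the two arguments of the stored matrix,
  hence \<open>(j, k)\<close>, \<open>(i, k)\<close> and \<open>(i, j)\<close> for the first three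
  slices. The threshold enters negatively, so that a triangle below its threshold has a negative
  weight.\<close>

definition mat_exp :: "nat \<Rightarrow> exp" where
  "mat_exp q =
     (if q = 0 then (hcol [<] Reg rs) [*] (entry bD (gidx rK hcol) (gidx rJ hrow) [*] (Reg rn [*] Reg rn))
      else if q = 1 then (Const 1 [-] (hrow [<] Reg rs)) [*] (hcol [<] Reg rs) [*]
        (entry bD (gidx rI hrow) (gidx rK hcol) [*] (Reg rn [*] Reg rn))
      else if q = 2 then (Const 1 [-] (hrow [<] Reg rs)) [*]
        (gidx rI hrow [*] Reg rn [+] gidx rJ hcol
         [-] entry bY (gidx rI hrow) (gidx rJ hcol) [*] (Reg rn [*] Reg rn))
      else Const 0)"

definition fill_mat :: "nat \<Rightarrow> com" where
  "fill_mat q = fill rh 3 (mat_base (int q)) (Reg rN [*] Reg rN) (mat_exp q)"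

definition fill_gadget :: com where
  "fill_gadget =
     (set_block ;; Set 0 (Reg rN) ;; fill_axes ;; fill_vecs ;;
      fill_mat 0 ;; fill_mat 1 ;; fill_mat 2 ;; fill_mat 3 ;; fill_mat 4 ;; fill_mat 5)"

text \<open>The residue of a negative optimum modulo \<open>n * n\<close> is the address of the pair
  found. Its threshold drops to the lower end of its interval and the same blocks are searched
  again; the counter advances only after an unsuccessful search.\<close>

definition scan_step :: "com \<Rightarrow> com" where
  "scan_step p =
     (fill_gadget ;; p ;;
      If (Reg 4 [<] Const 0)
        (Store bY (Reg 4 [mod] (Reg rn [*] Reg rn)) (Cell bX (Reg 4 [mod] (Reg rn [*] Reg rn))))
        (Set rt (Reg rt [+] Const 1)))"

definition scan :: "com \<Rightarrow> com" where
  "scan p = (Set rt (Const 0) ;;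
     While (Reg rt [<] Reg rnb [*] Reg rnb [*] Reg rnb) (scan_step p))"

definition fill_square :: "nat \<Rightarrow> exp \<Rightarrow> com" where
  "fill_square b e = fill rh b (Const 0) (Reg rn [*] Reg rn) e"

text \<open>All intervals have the same length, so a single register \<open>rg\<close> suffices.
  After the scan \<open>bY\<close> holds the new lower ends: the threshold if no sum lies below it,
  the old lower end otherwise.\<close>

definition bisect_step :: "com \<Rightarrow> com" where
  "bisect_step p =
     (fill_square bY (Cell bX (Reg rh) [+] (Reg rg [+] Const 1) [div] Const 2) ;;
      scan p ;;
      fill_square bX (Cell bY (Reg rh)) ;;
      Set rg (Reg rg [div] Const 2))"

definition minplus_square :: "com \<Rightarrow> com" where
  "minplus_square p =
     (fill_square bX (Const 0 [-] Const 2 [*] Reg rR) ;;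
      Set rg (Const 4 [*] Reg rR) ;;
      While (Reg rg) (bisect_step p) ;;
      fill_square bD (Cell bX (Reg rh)))"

end

locale machine =
  fixes w n s N nb B c2 \<tau>p :: nat and p :: com and Q Rm :: int
  assumes n: "1 \<le> n" and s: "1 \<le> s" "s \<le> n" and N: "N = 2 * s" and nb: "nb = n div s + 1"
    and B: "5 \<le> B" and wp: "writes p \<subseteq> {..<B}"
    and Qw: "Q ^ 20 \<le> 2 ^ w" and Rm: "1 \<le> Rm" and QR: "24 * (int n + 1) ^ 3 * Rm \<le> Q"
    and QN: "3 * Q \<le> int (2 * s) ^ c2"
    and p: "\<And>m D. wordmem w m \<Longrightarrow> D \<in> lws2d_slice_instances 3 c2 (2 * s)
      \<Longrightarrow> lws2d_slice_input (2 * s) D m \<Longrightarrow> exec w p m \<tau>p (lws2d_slice_output (2 * s) D)"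
begin

lemma bank_neq [simp]: "b < 5 \<Longrightarrow> B + k \<noteq> b" "b < 5 \<Longrightarrow> b \<noteq> B + k"
  using B by auto

lemma not_writes_p [simp]: "B + k \<notin> writes p"
  using wp by auto

lemma n3: "1 \<le> (int n + 1) ^ 3" "int n \<le> (int n + 1) ^ 3" "int n * int n \<le> (int n + 1) ^ 3"
  using n by (auto simp: power3_eq_cube algebra_simps)

lemma Q_ge: "24 * (int n + 1) ^ 3 \<le> Q"
proof -
  have "24 * (int n + 1) ^ 3 * 1 \<le> 24 * (int n + 1) ^ 3 * Rm"
    using Rm n3 by (intro mult_left_mono) auto
  then show ?thesis using QR by linarith
qed

lemma Q2: "24 \<le> Q" using Q_ge n3 by linarith

text \<open>One uniform degree bound serves most expressions of the program. Expressions that read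
  the result of the oracle or uninitialised cells, and the power of \<open>n\<close>, are treated by
  hand.\<close>

lemma fitsI: "plain e \<Longrightarrow> small_cells Q m e \<Longrightarrow> cdeg e \<le> 19 \<Longrightarrow> fits w m e"
  using fits_if_small_cells[of Q 19 w e m] Q2 Qw by simp

lemma small_is_word: "\<bar>v\<bar> \<le> Q \<Longrightarrow> is_word w v"
proof -
  assume v: "\<bar>v\<bar> \<le> Q"
  have "Q ^ 1 < Q ^ 20" using Q2 by (intro power_strict_increasing) auto
  then show ?thesis using v Qw unfolding is_word_def by auto
qed

definition params :: "mem \<Rightarrow> bool" where
  "params m \<longleftrightarrow> m (rn B) 0 = int n \<and> m (rs B) 0 = int s \<and> m (rN B) 0 = int N \<and> m (rnb B) 0 = int nb"

definition arr :: "mem \<Rightarrow> nat \<Rightarrow> (nat \<Rightarrow> nat \<Rightarrow> int) \<Rightarrow> bool" where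
  "arr m b f \<longleftrightarrow> (\<forall>u<n. \<forall>v<n. m b (int (u * n + v)) = f u v)"

lemma nb_s: "nb * s \<le> 2 * n" "nb \<le> n + 1" "1 \<le> nb"
proof -
  have "nb * s = n div s * s + s" by (simp add: nb)
  moreover have "n div s * s \<le> n" by simp
  ultimately show "nb * s \<le> 2 * n" using s(2) by linarith
  show "nb \<le> n + 1" "1 \<le> nb" using nb by auto
qed

lemma nb3: "int (nb * nb * nb) \<le> (int n + 1) ^ 3"
proof -
  have "nb * nb * nb \<le> (n + 1) * (n + 1) * (n + 1)" using nb_s by (intro mult_mono) auto
  then have "int (nb * nb * nb) \<le> int ((n + 1) * (n + 1) * (n + 1))" by (rule zle_int[THEN iffD2])
  then show ?thesis by (simp add: power3_eq_cube algebra_simps)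
qed

lemma size_bounds: "int n \<le> Q" "int s \<le> Q" "int N \<le> Q" "int nb \<le> Q" "int (n * n) + 1 \<le> Q"
  "int (nb * nb * nb) + 1 \<le> Q" "2 * int n \<le> Q"
  "6 * int (N * N) + 3 * int N + 10 \<le> Q" "1 \<le> N"
proof -
  have q: "24 * (int n + 1) ^ 3 = 24 * (int n * int n * int n) + 72 * (int n * int n) + 72 * int n + 24"
    by (simp add: power3_eq_cube algebra_simps)
  show "1 \<le> N" using N s by simp
  have ss: "int s * int s \<le> int n * int n" using s by (intro mult_mono) auto
  have nn: "0 \<le> int n * int n" "0 \<le> int n * int n * int n" by auto
  have sn: "int s \<le> int n" "int N = 2 * int s" "int nb \<le> int n + 1" "int (n * n) = int n * int n"
    using s nb_s N by auto
  note Q' = Q_ge[unfolded q]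
  show "int n \<le> Q" "int s \<le> Q" "int N \<le> Q" "int nb \<le> Q" "int (n * n) + 1 \<le> Q" "2 * int n \<le> Q"
    using Q' sn nn by linarith+
  show "int (nb * nb * nb) + 1 \<le> Q" using nb3 Q_ge n3 by linarith
  have "int (N * N) = 4 * (int s * int s)" using N by simp
  then show "6 * int (N * N) + 3 * int N + 10 \<le> Q" using Q' sn nn ss by linarith
qed

text \<open>Indices of the last block wrap around modulo \<open>n\<close>; the repetitions do not change the minimum.\<close>

definition blk :: "nat \<Rightarrow> nat \<Rightarrow> nat" where
  "blk I a = (I * s + a) mod n"

lemma blk_less [simp]: "blk I a < n"
  using n by (simp add: blk_def)

lemma val_gidx:
  assumes "params m" "m r 0 = int (I * s)" "val m e = int x"
  shows "val m (gidx B r e) = int (blk I (x mod s))"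
  using assms by (simp add: gidx_def blk_def params_def zmod_int)

lemma small_gidx:
  assumes "params m" "\<bar>m r 0\<bar> \<le> Q" "small_cells Q m e"
  shows "small_cells Q m (gidx B r e)"
  using assms by (simp add: gidx_def params_def size_bounds)

lemma val_entry:
  assumes "params m" "val m e1 = int u" "val m e2 = int v" "u < n" "v < n" "arr m b f"
  shows "val m (entry B b e1 e2) = f u v"
  using assms by (simp add: entry_def params_def arr_def)

lemma small_entry:
  assumes "params m" "val m e1 = int u" "val m e2 = int v" "u < n" "v < n" "arr m b f"
    "\<bar>f u v\<bar> \<le> Q" "small_cells Q m e1" "small_cells Q m e2"
  shows "small_cells Q m (entry B b e1 e2)"
  using assms val_entry[OF assms(1-6)] by (simp add: entry_def params_def size_bounds)

end

section \<open>The instance for one triple of blocks\<close>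

locale scan_state = machine +
  fixes t :: nat and D Y :: "nat \<Rightarrow> nat \<Rightarrow> int"
  assumes t: "t < nb * nb * nb"
    and D_bound: "\<And>u v. u < n \<Longrightarrow> v < n \<Longrightarrow> \<bar>D u v\<bar> \<le> Rm"
    and Y_bound: "\<And>u v. u < n \<Longrightarrow> v < n \<Longrightarrow> \<bar>Y u v\<bar> \<le> 8 * Rm"
begin

definition "gI = blk (t div (nb * nb))"
definition "gJ = blk (t div nb mod nb)"
definition "gK = blk (t mod nb)"

lemma g_less [simp]: "gI a < n" "gJ a < n" "gK a < n"
  by (simp_all add: gI_def gJ_def gK_def)

definition "tA i k = D (gI i) (gK k) * (int n * int n)"
definition "tB k j = D (gK k) (gJ j) * (int n * int n)"
definition "tC i j = int (gI i) * int n + int (gJ j) - Y (gI i) (gJ j) * (int n * int n)"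

lemma entry_bounds: "\<bar>tA i k\<bar> \<le> Q" "\<bar>tB k j\<bar> \<le> Q" "\<bar>tC i j\<bar> \<le> Q"
  "u < n \<Longrightarrow> v < n \<Longrightarrow> \<bar>D u v\<bar> \<le> Q" "u < n \<Longrightarrow> v < n \<Longrightarrow> \<bar>Y u v\<bar> \<le> Q"
proof -
  let ?nn = "int n * int n"
  have nn: "1 \<le> ?nn" using n by (simp add: mult_le_mono order_trans[OF _ mult_mono[of 1 "int n" 1 "int n"]])
  have R: "Rm * ?nn * 24 \<le> Q"
  proof -
    have "24 * ?nn * Rm \<le> 24 * (int n + 1) ^ 3 * Rm" using n3 Rm by (intro mult_right_mono) auto
    then show ?thesis using QR by (simp add: algebra_simps)
  qed
  have R0: "0 \<le> Rm * ?nn" using Rm nn by auto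
  have R1: "Rm * 1 \<le> Rm * ?nn" "1 * ?nn \<le> Rm * ?nn"
    using Rm nn by (auto intro!: mult_left_mono mult_right_mono simp del: mult_1_left mult_1_right)
  have mulD: "\<bar>D u v * ?nn\<bar> \<le> Rm * ?nn" if "u < n" "v < n" for u v
    using D_bound[OF that] nn by (simp add: abs_mult mult_right_mono)
  have mulY: "\<bar>Y u v * ?nn\<bar> \<le> 8 * Rm * ?nn" if "u < n" "v < n" for u v
    using Y_bound[OF that] nn by (simp add: abs_mult mult_right_mono del: mult.assoc)
  show "\<bar>tA i k\<bar> \<le> Q" "\<bar>tB k j\<bar> \<le> Q" using mulD R R0 unfolding tA_def tB_def
    by (smt (verit) g_less)+
  have "int (gI i) * int n + int (gJ j) < ?nn"
  proof -
    have "int (gI i) + 1 \<le> int n" using g_less(1)[of i] by linarith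
    then have "(int (gI i) + 1) * int n \<le> ?nn" by (intro mult_right_mono) auto
    then show ?thesis using g_less(2)[of j] unfolding distrib_right by linarith
  qed
  moreover have "0 \<le> int (gI i) * int n + int (gJ j)" by simp
  moreover have "\<bar>Y (gI i) (gJ j) * ?nn\<bar> \<le> 8 * (Rm * ?nn)" using mulY[of "gI i" "gJ j"] by simp
  ultimately show "\<bar>tC i j\<bar> \<le> Q" using R R0 R1 unfolding tC_def by linarith
  show "u < n \<Longrightarrow> v < n \<Longrightarrow> \<bar>D u v\<bar> \<le> Q" "u < n \<Longrightarrow> v < n \<Longrightarrow> \<bar>Y u v\<bar> \<le> Q"
    using D_bound[of u v] Y_bound[of u v] R R0 R1 by linarith+
qed

definition St :: "mem \<Rightarrow> bool" where
  "St m \<longleftrightarrow> params m \<and> m (rI B) 0 = int (t div (nb * nb) * s) \<and> m (rJ B) 0 = int (t div nb mod nb * s)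
     \<and> m (rK B) 0 = int (t mod nb * s) \<and> arr m (bD B) D \<and> arr m (bY B) Y"

text \<open>From offset 6 on lie all registers and arrays of the reduction except the loop counter
  \<open>rh\<close>, which every fill changes.\<close>

lemma St_cong: "St m \<Longrightarrow> (\<And>k. 6 \<le> k \<Longrightarrow> m' (B + k) = m (B + k)) \<Longrightarrow> St m'"
  by (simp add: St_def params_def arr_def)

lemma t_bounds: "t div (nb * nb) < nb" "t div nb mod nb < nb" "t mod nb < nb"
  using t nb_s by (auto simp: less_mult_imp_div_less algebra_simps)

lemma blk_bound: "I < nb \<Longrightarrow> int (I * s) \<le> Q"
proof -
  assume "I < nb"
  then have "I * s \<le> nb * s" by simp
  then have "I * s \<le> 2 * n" using nb_s by linarith
  then have "int (I * s) \<le> 2 * int n" by linarith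
  then show ?thesis using size_bounds(7) by linarith
qed

lemma St_facts:
  assumes "St m"
  shows "params m" "m (rI B) 0 = int (t div (nb * nb) * s)" "m (rJ B) 0 = int (t div nb mod nb * s)"
    "m (rK B) 0 = int (t mod nb * s)" "arr m (bD B) D" "arr m (bY B) Y"
    "\<bar>m (rI B) 0\<bar> \<le> Q" "\<bar>m (rJ B) 0\<bar> \<le> Q" "\<bar>m (rK B) 0\<bar> \<le> Q"
  using assms blk_bound[OF t_bounds(1)] blk_bound[OF t_bounds(2)] blk_bound[OF t_bounds(3)]
  unfolding St_def by auto

definition mat_val :: "nat \<Rightarrow> nat \<Rightarrow> nat \<Rightarrow> int" where
  "mat_val q i j =
       (if q = 0 then of_bool (j < s) * tB (j mod s) (i mod s)
        else if q = 1 then of_bool (s \<le> i \<and> j < s) * tA (i mod s) (j mod s)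
        else if q = 2 then of_bool (s \<le> i) * tC (i mod s) (j mod s) else 0)"

lemma mat_exp:
  assumes St: "St m" and h: "m (rh B) 0 = int h" "h < N * N"
  shows "fits w m (mat_exp B q) \<and> val m (mat_exp B q) = mat_val q (h div N) (h mod N)"
proof -
  note F = St_facts[OF St]
  have c: "m (rn B) 0 = int n" "m (rs B) 0 = int s" "m (rN B) 0 = int N" using F(1) by (auto simp: params_def)
  have hv: "val m (hrow B) = int (h div N)" "val m (hcol B) = int (h mod N)"
    using h c by (auto simp: zdiv_int zmod_int)
  have hQ: "int h \<le> Q" using h size_bounds(8) by linarith
  have hs: "small_cells Q m (hrow B)" "small_cells Q m (hcol B)"
    using h(1) c hQ by (simp_all add: size_bounds)
  have gv: "val m (gidx B (rI B) (hrow B)) = int (gI (h div N mod s))"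
    "val m (gidx B (rK B) (hcol B)) = int (gK (h mod N mod s))"
    "val m (gidx B (rJ B) (hrow B)) = int (gJ (h div N mod s))"
    "val m (gidx B (rJ B) (hcol B)) = int (gJ (h mod N mod s))"
    unfolding gI_def gJ_def gK_def using val_gidx F hv by blast+
  have gs: "small_cells Q m (gidx B (rI B) (hrow B))" "small_cells Q m (gidx B (rK B) (hcol B))"
    "small_cells Q m (gidx B (rJ B) (hrow B))" "small_cells Q m (gidx B (rJ B) (hcol B))"
    using small_gidx F hs by blast+
  note at_v = val_entry[OF F(1) gv(2,3) g_less(3,2) F(5)] val_entry[OF F(1) gv(1,2) g_less(1,3) F(5)]
    val_entry[OF F(1) gv(1,4) g_less(1,2) F(6)]
  note at_s = small_entry[OF F(1) gv(2,3) g_less(3,2) F(5) entry_bounds(4)[OF g_less(3,2)] gs(2,3)]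
    small_entry[OF F(1) gv(1,2) g_less(1,3) F(5) entry_bounds(4)[OF g_less(1,3)] gs(1,2)]
    small_entry[OF F(1) gv(1,4) g_less(1,2) F(6) entry_bounds(5)[OF g_less(1,2)] gs(1,4)]
  have pl: "plain (gidx B r (hrow B))" "plain (gidx B r (hcol B))"
     "cdeg (gidx B r (hrow B)) = 5" "cdeg (gidx B r (hcol B)) = 5"
     "deg (gidx B r (hrow B)) = 5" "deg (gidx B r (hcol B)) = 5" for r
    by (auto simp: gidx_def)
  have atd: "plain (entry B b e1 e2) = (plain e1 \<and> plain e2)"
    "cdeg (entry B b e1 e2) = max 1 (cdeg (e1 [*] Reg (rn B) [+] e2))"
    "deg (entry B b e1 e2) = 1" for b e1 e2
    by (auto simp: entry_def)
  note cells = F(7-9) c h(1) hQ size_bounds(1,2,3)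
  have f: "fits w m (mat_exp B q)"
  proof (rule fitsI)
    show "plain (mat_exp B q)" "cdeg (mat_exp B q) \<le> 19"
      by (auto simp: mat_exp_def pl atd)
    show "small_cells Q m (mat_exp B q)"
      using at_s gs cells hs by (simp add: mat_exp_def)
  qed
  have lt: "val m (hcol B [<] Reg (rs B)) = of_bool (h mod N < s)"
    "val m (hrow B [<] Reg (rs B)) = of_bool (h div N < s)"
    using hv c by auto
  have arith: "val m (e1 [*] e2) = val m e1 * val m e2" "val m (e1 [+] e2) = val m e1 + val m e2"
    "val m (e1 [-] e2) = val m e1 - val m e2" for e1 e2 by simp_all
  have reg: "val m (Reg (rn B)) = int n" "val m (Const 1) = 1" "val m (Const 0) = 0" using c by simp_all
  have ge: "1 - of_bool (h div N < s) = (of_bool (s \<le> h div N) :: int)" by auto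
  have conj: "of_bool (s \<le> h div N) * of_bool (h mod N < s) = (of_bool (s \<le> h div N \<and> h mod N < s) :: int)"
    by auto
  have "val m (mat_exp B q) = mat_val q (h div N) (h mod N)"
    unfolding mat_exp_def mat_val_def tA_def tB_def tC_def
    by (simp only: arith reg lt ge conj at_v gv split: if_split) simp
  with f show ?thesis by blast
qed

text \<open>Matrix \<open>q\<close> occupies the \<open>N * N\<close> cells from
  \<open>q * (N * N) + N + 1\<close> on, so writing it leaves the earlier matrices intact.
  Hypothesis and conclusion on bank 3 have the same form, with \<open>q\<close> increased by one, so
  that six passes can be chained.\<close>

lemma exec_fill_mat:
  assumes St: "St m" and q: "q < 6"
    and mats: "\<And>q' h. q' < q \<Longrightarrow> h < N * N \<Longrightarrow>
      m 3 (int (q' * (N * N) + h) + int N + 1) = mat_val q' (h div N) (h mod N)"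
  shows "exec w (fill_mat B q) m (3 * (N * N) + 2) (\<lambda>m'. St m' \<and> m' 0 = m 0 \<and> m' 1 = m 1 \<and> m' 2 = m 2 \<and>
    (\<forall>q' h. q' < Suc q \<longrightarrow> h < N * N \<longrightarrow>
      m' 3 (int (q' * (N * N) + h) + int N + 1) = mat_val q' (h div N) (h mod N)))"
proof -
  have c: "m (rN B) 0 = int N" using St_facts[OF St] by (simp add: params_def)
  have b: "val m (mat_base B (int q)) = int (q * (N * N)) + int N + 1"
    by (simp add: mat_base_def c algebra_simps)
  have qN: "q * (N * N) + N * N \<le> 6 * (N * N)"
  proof -
    have "(q + 1) * (N * N) \<le> 6 * (N * N)" using q by (intro mult_right_mono) auto
    then show ?thesis by (simp only: distrib_right mult_1_left)
  qed
  have N0: "0 \<le> int (N * N)" "0 \<le> int (q * (N * N))" by simp_all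
  have qN': "int (q * (N * N)) + int (N * N) \<le> 6 * int (N * N)"
    using qN by linarith
  show ?thesis
    unfolding fill_mat_def
  proof (rule exec_fill[where cnt = "N * N" and base = "int (q * (N * N)) + int N + 1"
        and V = "\<lambda>h. mat_val q (h div N) (h mod N)"])
    show "rh B \<notin> reads (mat_base B (int q)) \<union> reads (Reg (rN B) [*] Reg (rN B))"
      "3 \<notin> reads (mat_base B (int q)) \<union> reads (Reg (rN B) [*] Reg (rN B)) \<union> reads (mat_exp B q)"
      by (auto simp: mat_base_def mat_exp_def entry_def gidx_def)
    show "val m (Reg (rN B) [*] Reg (rN B)) = int (N * N)" by (simp add: c)
    show "val m (mat_base B (int q)) = int (q * (N * N)) + int N + 1" by (fact b)
    show "fits w m (Reg (rN B) [*] Reg (rN B))" by (rule fitsI) (simp_all add: c size_bounds)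
    show "fits w m (mat_base B (int q))"
      using q by (intro fitsI) (simp_all add: c size_bounds mat_base_def)
    show "is_word w (int (N * N) + 1)" "is_word w (int (q * (N * N)) + int N + 1)"
      "is_word w (int (q * (N * N)) + int N + 1 + int (N * N))"
      using N0 qN' size_bounds(8) by (auto intro!: small_is_word simp del: of_nat_mult)
    fix h and mh :: mem assume h: "h < N * N" "mh (rh B) 0 = int h" and fr: "\<And>b'. b' \<noteq> rh B \<Longrightarrow> b' \<noteq> 3 \<Longrightarrow> mh b' = m b'"
    have "St mh" by (rule St_cong[OF St]) (simp add: fr)
    then show "fits w mh (mat_exp B q) \<and> val mh (mat_exp B q) = mat_val q (h div N) (h mod N)"
      using mat_exp h by blast
  next
    fix m' assume new: "\<And>h. h < N * N \<Longrightarrow>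
        m' 3 (int (q * (N * N)) + int N + 1 + int h) = mat_val q (h div N) (h mod N)"
      and old: "\<And>a. a < int (q * (N * N)) + int N + 1 \<or> int (q * (N * N)) + int N + 1 + int (N * N) \<le> a
        \<Longrightarrow> m' 3 a = m 3 a"
      and fr: "\<And>b'. b' \<noteq> rh B \<Longrightarrow> b' \<noteq> 3 \<Longrightarrow> m' b' = m b'"
    have "St m'" by (rule St_cong[OF St]) (simp add: fr)
    moreover have "m' 3 (int (q' * (N * N) + h) + int N + 1) = mat_val q' (h div N) (h mod N)"
      if q': "q' < Suc q" and h: "h < N * N" for q' h
    proof (cases "q' = q")
      case True
      then show ?thesis using new[OF h] by (simp add: algebra_simps)
    next
      case False
      then have "q' < q" using q' by simp
      have "(q' + 1) * (N * N) \<le> q * (N * N)" using \<open>q' < q\<close> by (intro mult_right_mono) auto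
      then have "q' * (N * N) + h < q * (N * N)" using h unfolding distrib_right mult_1_left by linarith
      then have "int (q' * (N * N) + h) < int (q * (N * N))" by (rule of_nat_less_iff[THEN iffD2])
      then show ?thesis using old mats[OF \<open>q' < q\<close> h] by simp
    qed
    ultimately show "St m' \<and> m' 0 = m 0 \<and> m' 1 = m 1 \<and> m' 2 = m 2 \<and>
      (\<forall>q' h. q' < Suc q \<longrightarrow> h < N * N \<longrightarrow>
        m' 3 (int (q' * (N * N) + h) + int N + 1) = mat_val q' (h div N) (h mod N))"
      using fr by auto
  qed auto
qed

lemma exec_fill_axes:
  assumes St: "St m"
  shows "exec w (fill_axes B) m 20 (\<lambda>m'. St m' \<and> m' 0 = m 0 \<and> (\<forall>q<6. m' 1 (int q) = int (q mod 3)))"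
  unfolding fill_axes_def
proof (rule exec_fill[where cnt = 6 and base = 0 and V = "\<lambda>h. int (h mod 3)"])
  show "is_word w (int 6 + 1)" "is_word w 0" "is_word w (0 + int 6)"
    using Q2 by (auto intro!: small_is_word)
  show "fits w m (Const 6)" "fits w m (Const 0)" by (rule fitsI; simp)+
  fix h and mh :: mem assume h: "h < 6" "mh (rh B) 0 = int h"
  show "fits w mh (Reg (rh B) [mod] Const 3) \<and> val mh (Reg (rh B) [mod] Const 3) = int (h mod 3)"
  proof
    show "fits w mh (Reg (rh B) [mod] Const 3)" using h Q2 by (intro fitsI) simp_all
  qed (use h in \<open>simp add: zmod_int\<close>)
next
  fix m' assume "\<And>h. h < 6 \<Longrightarrow> m' 1 (0 + int h) = int (h mod 3)"
    and fr: "\<And>b'. b' \<noteq> rh B \<Longrightarrow> b' \<noteq> 1 \<Longrightarrow> m' b' = m b'"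
  moreover have "St m'" by (rule St_cong[OF St]) (simp add: fr)
  ultimately show "St m' \<and> m' 0 = m 0 \<and> (\<forall>q<6. m' 1 (int q) = int (q mod 3))" by simp
qed auto

definition vec_val :: "nat \<Rightarrow> nat \<Rightarrow> int" where
  "vec_val q i = (if q = 0 then of_bool (s \<le> i) else if q = 1 then 1
     else if q = 2 then of_bool (i < s) else 0)"

lemma exec_fill_vecs:
  assumes St: "St m"
  shows "exec w (fill_vecs B) m (18 * N + 2) (\<lambda>m'. St m' \<and> m' 0 = m 0 \<and> m' 1 = m 1 \<and>
    (\<forall>q<6. \<forall>i<N. m' 2 (int (q * N + i) + 1) = vec_val q i))"
  unfolding fill_vecs_def
proof (rule exec_fill[where cnt = "6 * N" and base = 1 and V = "\<lambda>h. vec_val (h div N) (h mod N)"])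
  have c: "m (rN B) 0 = int N" "m (rs B) 0 = int s" using St_facts[OF St] by (auto simp: params_def)
  have N1: "int N \<le> int (N * N)" using size_bounds(9) by simp
  show "val m (Const 6 [*] Reg (rN B)) = int (6 * N)" by (simp add: c)
  have "6 * int N + 2 \<le> Q" using size_bounds(8) N1 by linarith
  then show "is_word w (int (6 * N) + 1)" "is_word w 1" "is_word w (1 + int (6 * N))"
    using Q2 by (auto intro!: small_is_word)
  show "fits w m (Const 6 [*] Reg (rN B))" "fits w m (Const 1)"
    by (rule fitsI; simp add: c size_bounds)+
  fix h and mh :: mem assume h: "h < 6 * N" "mh (rh B) 0 = int h"
    and fr: "\<And>b'. b' \<noteq> rh B \<Longrightarrow> b' \<noteq> 2 \<Longrightarrow> mh b' = m b'"
  have c': "mh (rN B) 0 = int N" "mh (rs B) 0 = int s" using c fr by auto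
  have hQ: "int h \<le> Q" using h(1) size_bounds(8) N1 by linarith
  have hv: "val mh (hrow B) = int (h div N)" "val mh (hcol B) = int (h mod N)"
    using h(2) c' by (auto simp: zdiv_int zmod_int)
  show "fits w mh ((hrow B [=] Const 0) [*] (Const 1 [-] (hcol B [<] Reg (rs B))) [+] (hrow B [=] Const 1)
      [+] (hrow B [=] Const 2) [*] (hcol B [<] Reg (rs B))) \<and>
    val mh ((hrow B [=] Const 0) [*] (Const 1 [-] (hcol B [<] Reg (rs B))) [+] (hrow B [=] Const 1)
      [+] (hrow B [=] Const 2) [*] (hcol B [<] Reg (rs B))) = vec_val (h div N) (h mod N)"
    (is "fits w mh ?e \<and> _")
  proof
    show "fits w mh ?e" by (rule fitsI) (use h(2) c' hQ in \<open>simp_all add: size_bounds\<close>)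
    have "val mh (hrow B [=] Const k) = of_bool (int (h div N) = k)" for k using hv by simp
    moreover have "val mh (hcol B [<] Reg (rs B)) = of_bool (h mod N < s)" using hv c' by simp
    moreover have "int (h div N) = 1 \<longleftrightarrow> h div N = 1" "int (h div N) = 2 \<longleftrightarrow> h div N = 2" by linarith+
    ultimately show "val mh ?e = vec_val (h div N) (h mod N)"
      unfolding vec_val_def val.simps(3)[of _ Mul] val.simps(3)[of _ Add] val.simps(3)[of _ Sub]
      by auto
  qed
next
  fix m' assume new: "\<And>h. h < 6 * N \<Longrightarrow> m' 2 (1 + int h) = vec_val (h div N) (h mod N)"
    and fr: "\<And>b'. b' \<noteq> rh B \<Longrightarrow> b' \<noteq> 2 \<Longrightarrow> m' b' = m b'"
  have "m' 2 (int (q * N + i) + 1) = vec_val q i" if "q < 6" "i < N" for q i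
  proof -
    have "(q + 1) * N \<le> 6 * N" using that by (intro mult_right_mono) auto
    then have "q * N + i < 6 * N" using that unfolding distrib_right mult_1_left by linarith
    from new[OF this] show ?thesis using that(2) by (simp add: add.commute)
  qed
  moreover have "St m'" by (rule St_cong[OF St]) (simp add: fr)
  ultimately show "St m' \<and> m' 0 = m 0 \<and> m' 1 = m 1 \<and>
    (\<forall>q<6. \<forall>i<N. m' 2 (int (q * N + i) + 1) = vec_val q i)" using fr by simp
qed auto

lemma exec_set_block:
  assumes m: "params m" "m (rt B) 0 = int t" "arr m (bD B) D" "arr m (bY B) Y"
  shows "exec w (set_block B) m 3 St"
proof -
  have c: "m (rnb B) 0 = int nb" "m (rs B) 0 = int s" using m(1) by (auto simp: params_def)
  have tQ: "int t \<le> Q" using t size_bounds(6) by linarith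
  note cells = c m(2) tQ size_bounds(2,4)
  let ?m1 = "m(rI B := (m (rI B))(0 := int (t div (nb * nb) * s)))"
  let ?m2 = "?m1(rJ B := (?m1 (rJ B))(0 := int (t div nb mod nb * s)))"
  let ?m3 = "?m2(rK B := (?m2 (rK B))(0 := int (t mod nb * s)))"
  have St: "St ?m3" using m by (simp add: St_def params_def arr_def)
  have v1: "val m (Reg (rt B) [div] (Reg (rnb B) [*] Reg (rnb B)) [*] Reg (rs B)) = int (t div (nb * nb) * s)"
    by (simp add: cells zdiv_int)
  have v2: "val ?m1 (Reg (rt B) [div] Reg (rnb B) [mod] Reg (rnb B) [*] Reg (rs B)) = int (t div nb mod nb * s)"
    by (simp add: cells zdiv_int zmod_int)
  have v3: "val ?m2 (Reg (rt B) [mod] Reg (rnb B) [*] Reg (rs B)) = int (t mod nb * s)"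
    by (simp add: cells zmod_int)
  show ?thesis
    unfolding set_block_def
  proof (rule exec_Seq[where ?\<tau>1.0 = 1 and ?\<tau>2.0 = 2], rule exec_Set, goal_cases)
    case 3
    show ?case unfolding v1
    proof (rule exec_Seq[where ?\<tau>1.0 = 1 and ?\<tau>2.0 = 1], rule exec_Set, goal_cases)
      case 3
      show ?case unfolding v2
      proof (rule exec_Set, goal_cases)
        case 3
        show ?case unfolding v3 by (rule St)
      qed ((rule fitsI; simp add: cells) | simp)+
    qed ((rule fitsI; simp add: cells) | simp)+
  qed ((rule fitsI; simp add: cells) | simp)+
qed

lemma exec_fill_gadget:
  assumes m: "params m" "m (rt B) 0 = int t" "arr m (bD B) D" "arr m (bY B) Y"
  shows "exec w (fill_gadget B) m (18 * (N * N) + 18 * N + 40)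
    (lws2d_slice_input N (gadget s tA tB tC))"
proof -
  \<comment> \<open>\<open>G q\<close> describes a complete instance except for the matrices from
    \<open>q\<close> on; \<open>G 6\<close> is the whole input of the oracle.\<close>
  define G where "G q m \<longleftrightarrow> St m \<and> m 0 0 = int N \<and> (\<forall>q<6. m 1 (int q) = int (q mod 3)) \<and>
      (\<forall>q<6. \<forall>i<N. m 2 (int (q * N + i) + 1) = vec_val q i) \<and>
      (\<forall>q' h. q' < q \<longrightarrow> h < N * N \<longrightarrow>
        m 3 (int (q' * (N * N) + h) + int N + 1) = mat_val q' (h div N) (h mod N))" for q m
  have mat: "exec w (fill_mat B q) m (3 * (N * N) + 2) (G (Suc q))" if "G q m" "q < 6" for q m
    by (rule exec_mono[OF exec_fill_mat[of m q]]) (use that in \<open>auto simp: G_def\<close>)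
  have fin: "lws2d_slice_input N (gadget s tA tB tC) m" if "G 6 m" for m
    unfolding N
  proof (rule lws2d_slice_input_gadget, unfold N[symmetric])
    show "1 \<le> s" by (rule s)
    show "m 0 0 = int N" "\<And>q. q < 6 \<Longrightarrow> m 1 (int q) = int (q mod 3)" using that by (auto simp: G_def)
    show "m 2 (int (q * N + i) + 1) = (if q = 0 then of_bool (s \<le> i) else if q = 1 then 1
       else if q = 2 then of_bool (i < s) else 0)" if "q < 6" "i < N" for q i
      using \<open>G 6 m\<close> that unfolding G_def vec_val_def by blast
    show "m 3 (int ((q * N + i) * N + j) + int N + 1) =
       (if q = 0 then of_bool (j < s) * tB (j mod s) (i mod s)
        else if q = 1 then of_bool (s \<le> i \<and> j < s) * tA (i mod s) (j mod s)
        else if q = 2 then of_bool (s \<le> i) * tC (i mod s) (j mod s) else 0)"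
      if q: "q < 6" and i: "i < N" and j: "j < N" for q i j
    proof -
      have "i * N + N \<le> N * N" using i mult_right_mono[of "i + 1" N N] by (simp add: add.commute)
      then have h: "i * N + j < N * N" using j by linarith
      have e: "(q * N + i) * N + j = q * (N * N) + (i * N + j)" by (simp add: algebra_simps)
      have "m 3 (int (q * (N * N) + (i * N + j)) + int N + 1)
          = mat_val q ((i * N + j) div N) ((i * N + j) mod N)"
        using \<open>G 6 m\<close> q h unfolding G_def by blast
      moreover have "(i * N + j) div N = i" "(i * N + j) mod N = j" using j by auto
      ultimately show ?thesis unfolding e mat_val_def by simp
    qed
  qed
  show ?thesis
    unfolding fill_gadget_def
  proof (rule exec_SeqI[OF exec_set_block[OF m], where ?\<tau>2.0 = "18 * (N * N) + 18 * N + 35"])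
    fix m assume St: "St m"
    let ?m1 = "m(0 := (m 0)(0 := int N))"
    have St1: "St ?m1" by (rule St_cong[OF St]) simp
    have c: "m (rN B) 0 = int N" using St_facts[OF St] by (simp add: params_def)
    show "exec w (Set 0 (Reg (rN B)) ;; fill_axes B ;; fill_vecs B ;; fill_mat B 0 ;; fill_mat B 1 ;;
        fill_mat B 2 ;; fill_mat B 3 ;; fill_mat B 4 ;; fill_mat B 5) m (18 * (N * N) + 18 * N + 35)
        (lws2d_slice_input N (gadget s tA tB tC))"
    proof (rule exec_Seq[where ?\<tau>1.0 = 1 and ?\<tau>2.0 = "18 * (N * N) + 18 * N + 34"], rule exec_Set, goal_cases)
      case 3
      show ?case
      proof (rule exec_SeqI[OF exec_fill_axes, where ?\<tau>2.0 = "18 * (N * N) + 18 * N + 14"], goal_cases)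
        case 1
        show ?case using St1 c by simp
      next
        case (2 m2)
        then have "St m2" by blast
        show ?case
        proof (rule exec_SeqI[OF exec_fill_vecs[OF \<open>St m2\<close>], where ?\<tau>2.0 = "18 * (N * N) + 12"], goal_cases)
          case (1 m3)
          with 2 have "G 0 m3" using c by (simp add: G_def)
          then show ?case
            by (intro exec_SeqI[OF mat, where ?\<tau>2.0 = "15 * (N * N) + 10"] exec_SeqI[OF mat, where ?\<tau>2.0 = "12 * (N * N) + 8"]
                exec_SeqI[OF mat, where ?\<tau>2.0 = "9 * (N * N) + 6"] exec_SeqI[OF mat, where ?\<tau>2.0 = "6 * (N * N) + 4"]
                exec_SeqI[OF mat, where ?\<tau>2.0 = "3 * (N * N) + 2"] exec_mono[OF mat[where q = 5]])
              (assumption | simp add: fin eval_nat_numeral)+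
        qed simp
      qed simp
    qed ((rule fitsI; simp add: c size_bounds) | simp)+
  qed simp
qed

end

section \<open>Min-plus squaring by simultaneous bisection\<close>

context machine
begin

lemma pair_less:
  assumes "u < n" "v < n"
  shows "u * n + v < n * n"
proof -
  have "(u + 1) * n \<le> n * n" using assms by (intro mult_right_mono) auto
  then show ?thesis using assms by simp
qed

lemma pair_le_Q: "u < n \<Longrightarrow> v < n \<Longrightarrow> int (u * n + v) \<le> Q"
  using pair_less[of u v] size_bounds(5) by linarith

end

section \<open>One search by a call of the oracle\<close>

context scan_state
begin

lemma gadget_inst: "gadget s tA tB tC \<in> lws2d_slice_instances 3 c2 (2 * s)"
  by (rule gadget_in_instances[OF s(1) _ _ QN]) (use entry_bounds Q2 in auto)

text \<open>The last summand lies in \<open>[0, n * n)\<close>. Hence division by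
  \<open>n * n\<close> separates the two parts: the sign of the sum is that of the first, and the
  residue is the code of the pair.\<close>

lemma entry_sum:
  "tA i k + tB k j + tC i j =
     (D (gI i) (gK k) + D (gK k) (gJ j) - Y (gI i) (gJ j)) * int (n * n) + int (gI i * n + gJ j)"
  by (simp add: tA_def tB_def tC_def algebra_simps)

text \<open>The sign of the optimum decides. If it is negative, the triple attaining it violates the
  threshold of the pair that is then reset; otherwise minimality excludes every violation within the
  three blocks.\<close>

lemma exec_scan_step:
  assumes wm: "wordmem w m"
    and m: "params m" "m (rt B) 0 = int t" "arr m (bD B) D" "arr m (bY B) Y" "arr m (bX B) X"
  shows "exec w (scan_step B p) m (18 * (N * N) + 18 * N + 42 + \<tau>p) (\<lambda>m'.
    (\<exists>u v k. u < n \<and> v < n \<and> k < n \<and> D u k + D k v < Y u v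
       \<and> arr m' (bY B) (Y(u := (Y u)(v := X u v))) \<and> m' (rt B) 0 = int t)
    \<or> (arr m' (bY B) Y \<and> m' (rt B) 0 = int t + 1
       \<and> (\<forall>i<s. \<forall>j<s. \<forall>k<s. Y (gI i) (gJ j) \<le> D (gI i) (gK k) + D (gK k) (gJ j))))"
    (is "exec w _ m _ ?Q")
  unfolding scan_step_def
proof (rule exec_Seq_frame[OF exec_fill_gadget[OF m(1-4)] wm, where ?\<tau>2.0 = "\<tau>p + 2"])
  fix m1 assume inp: "lws2d_slice_input N (gadget s tA tB tC) m1" and wm1: "wordmem w m1"
    and fr1: "\<And>b. b \<notin> writes (fill_gadget B) \<Longrightarrow> m1 b = m b"
  let ?a = "Reg 4 [mod] (Reg (rn B) [*] Reg (rn B))"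
  show "exec w (p ;; If (Reg 4 [<] Const 0) (Store (bY B) ?a (Cell (bX B) ?a)) (Set (rt B) (Reg (rt B) [+] Const 1)))
    m1 (\<tau>p + 2) ?Q"
  proof (rule exec_Seq_frame[OF p[OF wm1 gadget_inst inp[unfolded N]] wm1, where ?\<tau>2.0 = 2])
    fix m2 assume out: "lws2d_slice_output (2 * s) (gadget s tA tB tC) m2" and wm2: "wordmem w m2"
      and fr2: "\<And>b. b \<notin> writes p \<Longrightarrow> m2 b = m1 b"
    have fr: "m2 b = m b" if "b \<in> {rn B, rs B, rN B, rnb B, rt B, bD B, bY B, bX B}" for b
      using that fr1[of b] fr2[of b]
      by (auto simp: fill_gadget_def set_block_def fill_axes_def fill_vecs_def fill_mat_def)
    have m2: "params m2" "m2 (rt B) 0 = int t" "arr m2 (bD B) D" "arr m2 (bY B) Y" "arr m2 (bX B) X"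
      using m fr by (auto simp: params_def arr_def)
    have c: "m2 (rn B) 0 = int n" using m2(1) by (simp add: params_def)
    have word: "is_word w (m2 b a)" for b a using wm2 by (simp add: wordmem_def)
    have nn: "0 < int (n * n)" using n by simp
    have nnQ: "int (n * n) \<le> Q" using size_bounds(5) by linarith
    have va: "val m2 ?a = m2 4 0 mod int (n * n)" using c by simp
    \<comment> \<open>The optimum itself is a word because runs preserve word-sized memory; its
      residue is at most \<open>Q\<close> whatever the optimum is.\<close>
    have "is_word w (int n)" "is_word w (int (n * n))" "is_word w (m2 4 0 mod int (n * n))"
      using size_bounds(1) nnQ pos_mod_bound[OF nn, of "m2 4 0"] pos_mod_sign[OF nn, of "m2 4 0"]
      by (auto intro!: small_is_word simp del: of_nat_mult)
    then have fa: "fits w m2 ?a" using word c by simp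
    have wQ: "is_word w 1" using Q2 by (auto intro!: small_is_word)
    obtain i j k where ijk: "i < s" "j < s" "k < s" "m2 4 0 = tA i k + tB k j + tC i j"
      using lws2d_gadget(1)[OF s(1) out] by blast
    note min = lws2d_gadget(2)[OF s(1) out]
    have code: "0 \<le> int (gI i * n + gJ j)" "int (gI i * n + gJ j) < int (n * n)" for i j
      using pair_less[of "gI i" "gJ j"] by (auto simp only: of_nat_0_le_iff of_nat_less_iff g_less)
    have neg: "tA i k + tB k j + tC i j < 0 \<longleftrightarrow> D (gI i) (gK k) + D (gK k) (gJ j) < Y (gI i) (gJ j)"
      for i j k
    proof -
      let ?d = "D (gI i) (gK k) + D (gK k) (gJ j) - Y (gI i) (gJ j)"
      have "?d * int (n * n) \<le> - 1 * int (n * n)" if "?d < 0"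
        using that nn by (intro mult_right_mono) auto
      moreover have "0 \<le> ?d * int (n * n)" if "\<not> ?d < 0"
        using that nn by (intro mult_nonneg_nonneg) auto
      ultimately show ?thesis
        unfolding entry_sum using code[of i j] by (cases "?d < 0") linarith+
    qed
    show "exec w (If (Reg 4 [<] Const 0) (Store (bY B) ?a (Cell (bX B) ?a)) (Set (rt B) (Reg (rt B) [+] Const 1)))
        m2 2 ?Q"
    proof (rule exec_If[where \<tau> = 1])
      show "fits w m2 (Reg 4 [<] Const 0)" using word wQ by auto
      show "exec w (Store (bY B) ?a (Cell (bX B) ?a)) m2 1 ?Q" if "val m2 (Reg 4 [<] Const 0) \<noteq> 0"
      proof (rule exec_Store)
        show "fits w m2 (Cell (bX B) ?a)" using fa word by auto
        show "fits w m2 ?a" by (rule fa)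
        have lt: "m2 4 0 < 0" using that by (auto split: if_splits)
        then have less: "D (gI i) (gK k) + D (gK k) (gJ j) < Y (gI i) (gJ j)" using ijk neg by simp
        have "m2 4 0 mod int (n * n) = int (gI i * n + gJ j) mod int (n * n)"
          unfolding ijk(4) entry_sum by (rule mod_mult_self3)
        then have a: "val m2 ?a = int (gI i * n + gJ j)"
          unfolding va using code[of i j] by (metis mod_pos_pos_trivial)
        have x: "val m2 (Cell (bX B) ?a) = X (gI i) (gJ j)"
          using m2(5) unfolding val.simps(2) a arr_def by simp
        have eq: "int (u * n + v) = int (gI i * n + gJ j) \<longleftrightarrow> u = gI i \<and> v = gJ j" if "v < n" for u v
        proof
          assume "int (u * n + v) = int (gI i * n + gJ j)"
          then have e: "u * n + v = gI i * n + gJ j" by (simp only: of_nat_eq_iff)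
          have "(u * n + v) div n = u" "(u * n + v) mod n = v" using that by auto
          moreover have "(gI i * n + gJ j) div n = gI i" "(gI i * n + gJ j) mod n = gJ j" using n by auto
          ultimately show "u = gI i \<and> v = gJ j" by (metis e)
        qed auto
        let ?m3 = "m2((bY B) := (m2 (bY B))(val m2 ?a := val m2 (Cell (bX B) ?a)))"
        have "arr ?m3 (bY B) (Y(gI i := (Y (gI i))(gJ j := X (gI i) (gJ j))))"
          unfolding arr_def
        proof (intro allI impI)
          fix u v assume uv: "u < n" "v < n"
          have "m2 (bY B) (int (u * n + v)) = Y u v" using m2(4) uv by (simp add: arr_def)
          then show "?m3 (bY B) (int (u * n + v)) = (Y(gI i := (Y (gI i))(gJ j := X (gI i) (gJ j)))) u v"
            unfolding a x fun_upd_same fun_upd_apply eq[OF uv(2)] by (simp only: split: if_split) simp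
        qed
        moreover have "?m3 (rt B) 0 = int t" using m2(2) by simp
        ultimately show "?Q ?m3"
          using less g_less by (intro disjI1 exI[of _ "gI i"] exI[of _ "gJ j"] exI[of _ "gK k"] conjI)
      qed simp
      show "exec w (Set (rt B) (Reg (rt B) [+] Const 1)) m2 1 ?Q" if "val m2 (Reg 4 [<] Const 0) = 0"
      proof (rule exec_Set)
        have "int t + 1 \<le> Q" using t size_bounds(6) by linarith
        then show "fits w m2 (Reg (rt B) [+] Const 1)"
          using m2(2) by (intro fitsI) auto
        have "\<not> m2 4 0 < 0" using that by (auto split: if_splits)
        then have "Y (gI i) (gJ j) \<le> D (gI i) (gK k) + D (gK k) (gJ j)"
          if "i < s" "j < s" "k < s" for i j k
          using min[OF that] neg[of i k j] by linarith
        then show "?Q (m2((rt B) := (m2 (rt B))(0 := val m2 (Reg (rt B) [+] Const 1))))"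
          using m2(2,4) by (intro disjI2) (auto simp: arr_def)
      qed simp
    qed simp
  qed simp
qed simp

end

section \<open>A scan over all triples of blocks and the bisection around it\<close>

context machine
begin

lemma exec_fill_square:
  assumes m: "params m" and b: "b \<notin> {rh B, rn B} \<union> reads e"
    and e: "\<And>u v mh. u < n \<Longrightarrow> v < n \<Longrightarrow> mh (rh B) 0 = int (u * n + v) \<Longrightarrow>
      (\<And>b'. b' \<noteq> rh B \<Longrightarrow> b' \<noteq> b \<Longrightarrow> mh b' = m b') \<Longrightarrow> fits w mh e \<and> val mh e = f u v"
    and post: "\<And>m'. arr m' b f \<Longrightarrow> (\<And>b'. b' \<noteq> rh B \<Longrightarrow> b' \<noteq> b \<Longrightarrow> m' b' = m b') \<Longrightarrow> R m'"
  shows "exec w (fill_square B b e) m (3 * (n * n) + 2) R"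
  unfolding fill_square_def
proof (rule exec_fill[where cnt = "n * n" and base = 0 and V = "\<lambda>h. f (h div n) (h mod n)"])
  have c: "m (rn B) 0 = int n" using m by (simp add: params_def)
  have nnQ: "int (n * n) + 1 \<le> Q" using size_bounds(5) by linarith
  show "val m (Reg (rn B) [*] Reg (rn B)) = int (n * n)" by (simp add: c)
  show "fits w m (Reg (rn B) [*] Reg (rn B))" "fits w m (Const 0)"
    by (rule fitsI; simp add: c size_bounds)+
  show "is_word w (int (n * n) + 1)" "is_word w 0" "is_word w (0 + int (n * n))"
    using nnQ by (auto intro!: small_is_word)
  fix h and mh :: mem
  assume h: "h < n * n" "mh (rh B) 0 = int h" and fr: "\<And>b'. b' \<noteq> rh B \<Longrightarrow> b' \<noteq> b \<Longrightarrow> mh b' = m b'"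
  have "h div n < n" "h mod n < n" using h(1) n by (auto simp: less_mult_imp_div_less)
  then show "fits w mh e \<and> val mh e = f (h div n) (h mod n)"
    using fr h(2) by (intro e) auto
next
  fix m' assume new: "\<And>h. h < n * n \<Longrightarrow> m' b (0 + int h) = f (h div n) (h mod n)"
    and fr: "\<And>b'. b' \<noteq> rh B \<Longrightarrow> b' \<noteq> b \<Longrightarrow> m' b' = m b'"
  have "m' b (int (u * n + v)) = f u v" if "u < n" "v < n" for u v
    using new[OF pair_less[OF that]] that by simp
  then have "arr m' b f" by (simp add: arr_def)
  then show "R m'" using fr by (rule post)
qed (use b in auto)

lemma exec_copy_square:
  assumes m: "params m" "arr m b' f" and b: "b \<notin> {rh B, rn B, b'}" "b' \<noteq> rh B"
    and f: "\<And>u v. u < n \<Longrightarrow> v < n \<Longrightarrow> \<bar>f u v\<bar> \<le> Q"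
    and post: "\<And>m'. arr m' b f \<Longrightarrow> (\<And>b'. b' \<noteq> rh B \<Longrightarrow> b' \<noteq> b \<Longrightarrow> m' b' = m b') \<Longrightarrow> R m'"
  shows "exec w (fill_square B b (Cell b' (Reg (rh B)))) m (3 * (n * n) + 2) R"
proof (rule exec_fill_square[where f = f])
  fix u v and mh :: mem
  assume uv: "u < n" "v < n" and h: "mh (rh B) 0 = int (u * n + v)"
    and fr: "\<And>b'. b' \<noteq> rh B \<Longrightarrow> b' \<noteq> b \<Longrightarrow> mh b' = m b'"
  have x: "mh b' (int (u * n + v)) = f u v" using fr[of b'] b m(2) uv by (simp add: arr_def)
  show "fits w mh (Cell b' (Reg (rh B))) \<and> val mh (Cell b' (Reg (rh B))) = f u v"
  proof
    show "fits w mh (Cell b' (Reg (rh B)))"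
      by (rule fitsI) (use h x pair_le_Q[OF uv] f[OF uv] in \<open>simp_all del: of_nat_add of_nat_mult\<close>)
  qed (use h x in \<open>simp del: of_nat_add of_nat_mult\<close>)
qed (use m b post in auto)

text \<open>The first factor bounds the number of rounds: each one finishes a triple of blocks or
  removes a pair. In the second, 43 is the 42 of a search plus the test of the loop.\<close>

definition scan_time :: nat where
  "scan_time = 2 + (nb * nb * nb + n * n) * (43 + 18 * (N * N) + 18 * N + \<tau>p)"

text \<open>The witness has the digits \<open>u div s\<close>, \<open>v div s\<close> and
  \<open>k div s\<close> in base \<open>nb\<close>. The extra 1 in \<open>nb\<close> makes room for
  an incomplete last block.\<close>

lemma blk_cover:
  assumes "u < n" "v < n" "k < n"
  obtains t where "t < nb * nb * nb" "blk (t div (nb * nb)) (u mod s) = u"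
    "blk (t div nb mod nb) (v mod s) = v" "blk (t mod nb) (k mod s) = k"
proof -
  have d: "x div s < nb" if "x < n" for x
    using that unfolding nb by (metis Suc_eq_plus1 div_le_mono le_imp_less_Suc less_or_eq_imp_le)
  define t where "t = (u div s * nb + v div s) * nb + k div s"
  have tnb: "t div nb = u div s * nb + v div s" "t mod nb = k div s"
    unfolding t_def using d[OF assms(3)] by auto
  have td: "t div (nb * nb) = u div s" "t div nb mod nb = v div s"
    unfolding div_mult2_eq tnb using d[OF assms(2)] by auto
  have "t < nb * nb * nb"
  proof -
    have "(u div s + 1) * nb \<le> nb * nb" using d[OF assms(1)] by (intro mult_right_mono) auto
    then have "u div s * nb + v div s + 1 \<le> nb * nb" using d[OF assms(2)] by simp
    then have "(u div s * nb + v div s + 1) * nb \<le> nb * nb * nb" by (rule mult_right_mono) simp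
    then show ?thesis using d[OF assms(3)] unfolding t_def by (simp only: distrib_right mult_1_left)
  qed
  then show thesis
    by (rule that) (use assms td tnb(2) in \<open>simp_all add: blk_def\<close>)
qed

text \<open>By \<open>low\<close> no sum undercuts \<open>X\<close>, so a pair reset to
  \<open>X\<close> can never be found again. Hence the number of unfinished triples of blocks plus
  the number of pairs not yet reset decreases in every round.\<close>

lemma exec_scan:
  fixes X D :: "nat \<Rightarrow> nat \<Rightarrow> int" and \<delta> :: int
  assumes wm: "wordmem w m"
    and m: "params m" "arr m (bD B) D" "arr m (bX B) X" "arr m (bY B) (\<lambda>u v. X u v + \<delta>)"
    and \<delta>: "1 \<le> \<delta>"
    and D: "\<And>u v. u < n \<Longrightarrow> v < n \<Longrightarrow> \<bar>D u v\<bar> \<le> Rm"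
    and X: "\<And>u v. u < n \<Longrightarrow> v < n \<Longrightarrow> \<bar>X u v\<bar> \<le> 2 * Rm \<and> \<bar>X u v + \<delta>\<bar> \<le> 2 * Rm"
    and low: "\<And>u v k. u < n \<Longrightarrow> v < n \<Longrightarrow> k < n \<Longrightarrow> X u v \<le> D u k + D k v"
  shows "exec w (scan B p) m scan_time (\<lambda>m'. \<exists>Y. arr m' (bY B) Y \<and> (\<forall>u<n. \<forall>v<n.
     (Y u v = X u v + \<delta> \<and> (\<forall>k<n. X u v + \<delta> \<le> D u k + D k v))
     \<or> (Y u v = X u v \<and> (\<exists>k<n. D u k + D k v < X u v + \<delta>))))"
    (is "exec w _ m _ ?Q")
proof -
  \<comment> \<open>Read off the memory rather than from a matrix, because the variant of a loop is
    a function of the memory.\<close>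
  define open_pairs where "open_pairs m' = {(u, v). u < n \<and> v < n \<and>
      m' (bY B) (int (u * n + v)) \<noteq> m' (bX B) (int (u * n + v))}" for m' :: mem
  have fin: "finite (open_pairs m')" and card: "card (open_pairs m') \<le> n * n" for m'
  proof -
    have sub: "open_pairs m' \<subseteq> {..<n} \<times> {..<n}" by (auto simp: open_pairs_def)
    then show "finite (open_pairs m')" by (rule finite_subset) simp
    show "card (open_pairs m') \<le> n * n" using card_mono[OF _ sub] by simp
  qed
  define V where "V m' = (nb * nb * nb - nat (m' (rt B) 0)) + card (open_pairs m')" for m' :: mem
  \<comment> \<open>No triangle is left in the triples of blocks numbered below
    \<open>t\<close>.\<close>
  define checked where "checked Y t \<longleftrightarrow> (\<forall>t'<t. \<forall>i<s. \<forall>j<s. \<forall>k<s.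
     Y (blk (t' div (nb * nb)) i) (blk (t' div nb mod nb) j)
       \<le> D (blk (t' div (nb * nb)) i) (blk (t' mod nb) k) + D (blk (t' mod nb) k) (blk (t' div nb mod nb) j))"
    for Y :: "nat \<Rightarrow> nat \<Rightarrow> int" and t
  define valid where "valid Y \<longleftrightarrow> (\<forall>u<n. \<forall>v<n. Y u v = X u v + \<delta>
     \<or> (Y u v = X u v \<and> (\<exists>k<n. D u k + D k v < X u v + \<delta>)))" for Y
  define I where "I m' \<longleftrightarrow> wordmem w m' \<and> params m' \<and> arr m' (bD B) D \<and> arr m' (bX B) X \<and>
     (\<exists>t Y. t \<le> nb * nb * nb \<and> m' (rt B) 0 = int t \<and> arr m' (bY B) Y \<and> valid Y \<and> checked Y t)" for m'
  let ?\<tau> = "18 * (N * N) + 18 * N + 42 + \<tau>p"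
  let ?g = "Reg (rt B) [<] Reg (rnb B) [*] Reg (rnb B) [*] Reg (rnb B)"
  have g: "val m' ?g = of_bool (m' (rt B) 0 < int (nb * nb * nb))" if "params m'" for m'
    using that by (simp add: params_def)
  have step: "exec w (scan_step B p) m' ?\<tau> (\<lambda>m''. I m'' \<and> V m'' < V m')"
    if I: "I m'" and guard: "val m' ?g \<noteq> 0" for m'
  proof -
    from I obtain t Y where m': "wordmem w m'" "params m'" "arr m' (bD B) D" "arr m' (bX B) X"
      "m' (rt B) 0 = int t" "arr m' (bY B) Y" and Y: "valid Y" "checked Y t"
      unfolding I_def by blast
    have t: "t < nb * nb * nb" using guard g[OF m'(2)] m'(5) by (auto split: if_splits simp del: of_nat_mult)
    interpret S: scan_state w n s N nb B c2 \<tau>p p Q Rm t D Y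
    proof unfold_locales
      show "t < nb * nb * nb" by (rule t)
      show "\<bar>D u v\<bar> \<le> Rm" if "u < n" "v < n" for u v using D that .
      show "\<bar>Y u v\<bar> \<le> 8 * Rm" if "u < n" "v < n" for u v
        using Y(1) X[OF that] Rm that unfolding valid_def by (smt (verit))
    qed
    \<comment> \<open>A pair that was just found still had the threshold
      \<open>X u v + \<delta>\<close>, since no sum lies below \<open>X u v\<close>.\<close>
    have YX: "Y u v \<noteq> X u v \<and> (\<exists>k<n. D u k + D k v < X u v + \<delta>)"
      if "u < n" "v < n" "k < n" "D u k + D k v < Y u v" for u v k
      using Y(1) low[OF that(1-3)] that unfolding valid_def by (smt (verit))
    have op: "open_pairs m1 = {(u, v). u < n \<and> v < n \<and> Y' u v \<noteq> X u v}"
      if "arr m1 (bY B) Y'" "arr m1 (bX B) X" for m1 Y'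
      using that unfolding open_pairs_def arr_def by auto
    show ?thesis
    proof (rule exec_frame[OF S.exec_scan_step[OF m'(1,2,5,3,6,4)] m'(1) order_refl])
      fix m1
      assume post: "(\<exists>u v k. u < n \<and> v < n \<and> k < n \<and> D u k + D k v < Y u v
       \<and> arr m1 (bY B) (Y(u := (Y u)(v := X u v))) \<and> m1 (rt B) 0 = int t)
      \<or> (arr m1 (bY B) Y \<and> m1 (rt B) 0 = int t + 1
       \<and> (\<forall>i<s. \<forall>j<s. \<forall>k<s. Y (S.gI i) (S.gJ j) \<le> D (S.gI i) (S.gK k) + D (S.gK k) (S.gJ j)))"
        and wm1: "wordmem w m1" and fr: "\<And>b. b \<notin> writes (scan_step B p) \<Longrightarrow> m1 b = m' b"
      have "m1 b = m' b" if "b \<in> {rn B, rs B, rN B, rnb B, bD B, bX B}" for b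
        using that fr[of b] by (auto simp: scan_step_def fill_gadget_def set_block_def fill_axes_def
            fill_vecs_def fill_mat_def)
      then have m1: "params m1" "arr m1 (bD B) D" "arr m1 (bX B) X"
        using m' by (auto simp: params_def arr_def)
      from post show "I m1 \<and> V m1 < V m'"
      proof (elim disjE exE conjE)
        fix u v k
        assume uvk: "u < n" "v < n" "k < n" "D u k + D k v < Y u v"
          and Y': "arr m1 (bY B) (Y(u := (Y u)(v := X u v)))" and t1: "m1 (rt B) 0 = int t"
        let ?Y = "Y(u := (Y u)(v := X u v))"
        note nX = YX[OF uvk]
        have Yuv: "Y u v = X u v + \<delta>" using Y(1) nX uvk(1,2) unfolding valid_def by blast
        \<comment> \<open>Thresholds only decrease, so triples of blocks finished earlier stay free
          of triangles and the counter never has to go back.\<close>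
        have le: "?Y a b \<le> Y a b" if "a < n" "b < n" for a b
          using Yuv \<delta> by auto
        have "valid ?Y" using Y(1) nX unfolding valid_def by auto
        moreover have "checked ?Y t"
          unfolding checked_def
        proof (intro allI impI)
          fix t' i j k assume "t' < t" "i < s" "j < s" "k < s"
          then show "?Y (blk (t' div (nb * nb)) i) (blk (t' div nb mod nb) j)
            \<le> D (blk (t' div (nb * nb)) i) (blk (t' mod nb) k) + D (blk (t' mod nb) k) (blk (t' div nb mod nb) j)"
            using Y(2)[unfolded checked_def, rule_format] le[OF blk_less blk_less] by (meson order_trans)
        qed
        ultimately have "I m1" using wm1 m1 Y' t1 t unfolding I_def by (meson less_imp_le)
        have "open_pairs m1 \<subset> open_pairs m'"
          unfolding op[OF Y' m1(3)] op[OF m'(6,4)]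
        proof (rule psubsetI)
          show "{(a, b). a < n \<and> b < n \<and> ?Y a b \<noteq> X a b} \<subseteq> {(a, b). a < n \<and> b < n \<and> Y a b \<noteq> X a b}"
            by (auto split: if_splits)
          have "(u, v) \<in> {(a, b). a < n \<and> b < n \<and> Y a b \<noteq> X a b}"
            "(u, v) \<notin> {(a, b). a < n \<and> b < n \<and> ?Y a b \<noteq> X a b}"
            using nX uvk(1,2) by auto
          then show "{(a, b). a < n \<and> b < n \<and> ?Y a b \<noteq> X a b} \<noteq> {(a, b). a < n \<and> b < n \<and> Y a b \<noteq> X a b}"
            by blast
        qed
        then have "card (open_pairs m1) < card (open_pairs m')" by (rule psubset_card_mono[OF fin])
        then show ?thesis using \<open>I m1\<close> t1 m'(5) by (simp add: V_def)
      next
        assume Y': "arr m1 (bY B) Y" and t1: "m1 (rt B) 0 = int t + 1"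
          and new: "\<forall>i<s. \<forall>j<s. \<forall>k<s. Y (S.gI i) (S.gJ j) \<le> D (S.gI i) (S.gK k) + D (S.gK k) (S.gJ j)"
        have "checked Y (Suc t)"
          using Y(2) new unfolding checked_def S.gI_def S.gJ_def S.gK_def less_Suc_eq by blast
        moreover have "m1 (rt B) 0 = int (Suc t)" using t1 by simp
        ultimately have "I m1" using wm1 m1 Y' t Y(1) unfolding I_def by (meson Suc_leI)
        moreover have "open_pairs m1 = open_pairs m'"
          unfolding op[OF Y' m1(3)] op[OF m'(6,4)] ..
        ultimately show ?thesis using t1 m'(5) t by (simp add: V_def)
      qed
    qed
  qed
  let ?m0 = "m((rt B) := (m (rt B))(0 := 0))"
  show ?thesis
    unfolding scan_def
  proof (rule exec_Seq[where ?\<tau>1.0 = 1 and ?\<tau>2.0 = "1 + (nb * nb * nb + n * n) * (1 + ?\<tau>)"], rule exec_Set)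
    show "exec w (While ?g (scan_step B p)) (m((rt B) := (m (rt B))(0 := val m (Const 0))))
        (1 + (nb * nb * nb + n * n) * (1 + ?\<tau>)) ?Q"
    proof (rule exec_While[where I = I and V = V and \<tau> = ?\<tau>])
      fix m' assume I: "I m'"
      then obtain t Y where m': "params m'" "t \<le> nb * nb * nb" "m' (rt B) 0 = int t"
        "arr m' (bY B) Y" "valid Y" "checked Y t" unfolding I_def by blast
      have "int t \<le> Q" using m'(2) size_bounds(6) by linarith
      then show "fits w m' ?g" using m'(1,3) size_bounds
        by (intro fitsI) (simp_all add: params_def)
      show "?Q m'" if "val m' ?g = 0"
      proof (intro exI[of _ Y] conjI allI impI)
        have t: "t = nb * nb * nb" using that g[OF m'(1)] m'(2,3) by (auto split: if_splits simp del: of_nat_mult)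
        fix u v assume uv: "u < n" "v < n"
        have "Y u v \<le> D u k + D k v" if k: "k < n" for k
        proof -
          from blk_cover[OF uv k] obtain t' where t': "t' < nb * nb * nb"
            "blk (t' div (nb * nb)) (u mod s) = u"
            "blk (t' div nb mod nb) (v mod s) = v" "blk (t' mod nb) (k mod s) = k" .
          have ms: "x mod s < s" for x using s by simp
          have "t' < t" using t' t by simp
          from m'(6)[unfolded checked_def, rule_format, OF this ms ms ms, of u v k]
          show ?thesis unfolding t'(2-4) .
        qed
        then show "(Y u v = X u v + \<delta> \<and> (\<forall>k<n. X u v + \<delta> \<le> D u k + D k v))
         \<or> (Y u v = X u v \<and> (\<exists>k<n. D u k + D k v < X u v + \<delta>))"
          using m'(5) uv unfolding valid_def by metis
      qed (rule m'(4))
    next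
      have "wordmem w ?m0" using wm by (auto simp: wordmem_def)
      moreover have "params ?m0" "arr ?m0 (bD B) D" "arr ?m0 (bX B) X" "arr ?m0 (bY B) (\<lambda>u v. X u v + \<delta>)"
        using m by (auto simp: params_def arr_def)
      moreover have "valid (\<lambda>u v. X u v + \<delta>)" "checked (\<lambda>u v. X u v + \<delta>) 0" by (auto simp: valid_def checked_def)
      ultimately have "I ?m0" unfolding I_def by (intro conjI exI[of _ 0] exI[of _ "\<lambda>u v. X u v + \<delta>"]) auto
      then show "I (m((rt B) := (m (rt B))(0 := val m (Const 0))))" by simp
      have "V m' \<le> nb * nb * nb + n * n" for m' unfolding V_def using card[of m'] by linarith
      then show "1 + V (m((rt B) := (m (rt B))(0 := val m (Const 0)))) * (1 + ?\<tau>) \<le> 1 + (nb * nb * nb + n * n) * (1 + ?\<tau>)"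
        by (intro add_left_mono mult_right_mono) auto
    qed (rule step)
  qed (auto simp: scan_time_def)
qed

definition bisect_time :: nat where
  "bisect_time = scan_time + 6 * (n * n) + 5"

text \<open>Every entry of the min-plus square lies in a closed interval of length \<open>g\<close>
  with lower end in \<open>X\<close>; at \<open>g = 0\<close> the square is found. The outer bounds
  exclude overflow.\<close>

definition brackets :: "(nat \<Rightarrow> nat \<Rightarrow> int) \<Rightarrow> (nat \<Rightarrow> nat \<Rightarrow> int) \<Rightarrow> int \<Rightarrow> bool" where
  "brackets D X g \<longleftrightarrow> (\<forall>u<n. \<forall>v<n. - (2 * Rm) \<le> X u v \<and> X u v + g \<le> 2 * Rm \<and>
     (\<forall>k<n. X u v \<le> D u k + D k v) \<and> (\<exists>k<n. D u k + D k v \<le> X u v + g))"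

lemma Rm_Q: "24 * Rm \<le> Q"
proof -
  have "24 * 1 * Rm \<le> 24 * (int n + 1) ^ 3 * Rm" using n3 Rm by (intro mult_right_mono mult_left_mono) auto
  then show ?thesis using QR by linarith
qed

lemma exec_bisect_step:
  assumes wm: "wordmem w m"
    and m: "params m" "arr m (bD B) D" "arr m (bX B) X" "m (rg B) 0 = g"
    and D: "\<And>u v. u < n \<Longrightarrow> v < n \<Longrightarrow> \<bar>D u v\<bar> \<le> Rm"
    and X: "brackets D X g" and g: "0 < g" "g \<le> 4 * Rm"
  shows "exec w (bisect_step B p) m bisect_time
    (\<lambda>m'. m' (rg B) 0 = g div 2 \<and> (\<exists>X'. arr m' (bX B) X' \<and> brackets D X' (g div 2)))"
    (is "exec w _ m _ ?Q")
proof -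
  \<comment> \<open>Rounding up makes \<open>\<delta>\<close> positive even for
    \<open>g = 1\<close>. If no sum lies below \<open>X u v + \<delta>\<close>, the remaining
    interval has length \<open>g - \<delta> = g div 2\<close>; otherwise some sum is at most
    \<open>X u v + \<delta> - 1\<close>, which is at most \<open>X u v + g div 2\<close>.\<close>
  define \<delta> where "\<delta> = (g + 1) div 2"
  have \<delta>: "1 \<le> \<delta>" "\<delta> + g div 2 = g" using g(1) unfolding \<delta>_def by presburger+
  have gd: "0 \<le> g div 2" using g(1) by simp
  have Xb: "\<bar>X u v\<bar> \<le> 2 * Rm \<and> \<bar>X u v + \<delta>\<bar> \<le> 2 * Rm" "\<bar>X u v\<bar> \<le> Q" if "u < n" "v < n" for u v
    using X that \<delta> g(1) gd Rm_Q unfolding brackets_def by (smt (verit))+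
  have gQ: "\<bar>g\<bar> \<le> Q" using g Rm_Q Rm by linarith
  show ?thesis
    unfolding bisect_step_def
  proof (rule exec_Seq_frame[where ?\<tau>2.0 = "scan_time + 3 * (n * n) + 3"])
    show "exec w (fill_square B (bY B) (Cell (bX B) (Reg (rh B)) [+] (Reg (rg B) [+] Const 1) [div] Const 2)) m
      (3 * (n * n) + 2) (\<lambda>m'. arr m' (bY B) (\<lambda>u v. X u v + \<delta>))"
    proof (rule exec_fill_square[where f = "\<lambda>u v. X u v + \<delta>"])
      fix u v and mh :: mem
      assume uv: "u < n" "v < n" and h: "mh (rh B) 0 = int (u * n + v)"
        and fr: "\<And>b'. b' \<noteq> rh B \<Longrightarrow> b' \<noteq> bY B \<Longrightarrow> mh b' = m b'"
      have x: "mh (bX B) (int (u * n + v)) = X u v" using fr m(3) uv by (simp add: arr_def)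
      note hQ = pair_le_Q[OF uv]
      have gh: "mh (rg B) 0 = g" using fr m(4) by simp
      show "fits w mh (Cell (bX B) (Reg (rh B)) [+] (Reg (rg B) [+] Const 1) [div] Const 2) \<and>
        val mh (Cell (bX B) (Reg (rh B)) [+] (Reg (rg B) [+] Const 1) [div] Const 2) = X u v + \<delta>"
      proof
        show "fits w mh (Cell (bX B) (Reg (rh B)) [+] (Reg (rg B) [+] Const 1) [div] Const 2)"
          by (rule fitsI) (use h x gh hQ gQ Xb(2)[OF uv] in \<open>simp_all del: of_nat_add of_nat_mult\<close>)
      qed (use h x gh in \<open>simp add: \<delta>_def del: of_nat_add of_nat_mult\<close>)
    qed (use m in auto)
  next
    fix m1 assume Y1: "arr m1 (bY B) (\<lambda>u v. X u v + \<delta>)" and wm1: "wordmem w m1"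
      and "\<And>b. b \<notin> writes (fill_square B (bY B) (Cell (bX B) (Reg (rh B)) [+] (Reg (rg B) [+] Const 1) [div] Const 2)) \<Longrightarrow> m1 b = m b"
    then have fr1: "m1 b = m b" if "b \<noteq> rh B" "b \<noteq> bY B" for b
      using that by (simp add: fill_square_def)
    have m1: "params m1" "arr m1 (bD B) D" "arr m1 (bX B) X" "m1 (rg B) 0 = g"
      using m fr1 by (auto simp: params_def arr_def)
    have low: "X u v \<le> D u k + D k v" if "u < n" "v < n" "k < n" for u v k
      using X that unfolding brackets_def by blast
    show "exec w (scan B p ;; fill_square B (bX B) (Cell (bY B) (Reg (rh B))) ;;
        Set (rg B) (Reg (rg B) [div] Const 2)) m1 (scan_time + 3 * (n * n) + 3) ?Q"
    proof (rule exec_Seq_frame[OF exec_scan[OF wm1 m1(1-3) Y1 \<delta>(1) D Xb(1) low] wm1, where ?\<tau>2.0 = "3 * (n * n) + 3"])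
      fix m2 assume "\<exists>Y. arr m2 (bY B) Y \<and> (\<forall>u<n. \<forall>v<n.
         (Y u v = X u v + \<delta> \<and> (\<forall>k<n. X u v + \<delta> \<le> D u k + D k v))
         \<or> (Y u v = X u v \<and> (\<exists>k<n. D u k + D k v < X u v + \<delta>)))"
        and wm2: "wordmem w m2" and fr2: "\<And>b. b \<notin> writes (scan B p) \<Longrightarrow> m2 b = m1 b"
      then obtain Y where Y: "arr m2 (bY B) Y" and cases: "\<And>u v. u < n \<Longrightarrow> v < n \<Longrightarrow>
         (Y u v = X u v + \<delta> \<and> (\<forall>k<n. X u v + \<delta> \<le> D u k + D k v))
         \<or> (Y u v = X u v \<and> (\<exists>k<n. D u k + D k v < X u v + \<delta>))" by blast
      have "m2 b = m1 b" if "b \<in> {rn B, rs B, rN B, rnb B, rg B}" for b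
        using that fr2[of b] by (auto simp: scan_def scan_step_def fill_gadget_def set_block_def
            fill_axes_def fill_vecs_def fill_mat_def)
      then have m2: "params m2" "m2 (rg B) 0 = g" using m1 by (auto simp: params_def)
      have new: "brackets D Y (g div 2)"
        unfolding brackets_def
      proof (intro allI impI)
        fix u v assume uv: "u < n" "v < n"
        have x: "- (2 * Rm) \<le> X u v" "X u v + g \<le> 2 * Rm" "\<forall>k<n. X u v \<le> D u k + D k v"
          using X uv unfolding brackets_def by blast+
        obtain k where k: "k < n" "D u k + D k v \<le> X u v + g" using X uv unfolding brackets_def by blast
        from cases[OF uv] show "- (2 * Rm) \<le> Y u v \<and> Y u v + g div 2 \<le> 2 * Rm \<and>
          (\<forall>k<n. Y u v \<le> D u k + D k v) \<and> (\<exists>k<n. D u k + D k v \<le> Y u v + g div 2)"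
        proof (elim disjE conjE exE)
          assume "Y u v = X u v + \<delta>" "\<forall>k<n. X u v + \<delta> \<le> D u k + D k v"
          then show ?thesis using x k \<delta> by auto
        next
          fix k assume "Y u v = X u v" "k < n" "D u k + D k v < X u v + \<delta>"
          moreover have "\<delta> \<le> g div 2 + 1" unfolding \<delta>_def by presburger
          ultimately show ?thesis using x \<delta> by (auto intro!: exI[of _ k])
        qed
      qed
      show "exec w (fill_square B (bX B) (Cell (bY B) (Reg (rh B))) ;; Set (rg B) (Reg (rg B) [div] Const 2))
        m2 (3 * (n * n) + 3) ?Q"
      proof (rule exec_Seq[where ?\<tau>1.0 = "3 * (n * n) + 2" and ?\<tau>2.0 = 1])
        show "exec w (fill_square B (bX B) (Cell (bY B) (Reg (rh B)))) m2 (3 * (n * n) + 2)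
          (\<lambda>m'. exec w (Set (rg B) (Reg (rg B) [div] Const 2)) m' 1 ?Q)"
        proof (rule exec_copy_square[OF m2(1) Y])
          show "\<bar>Y u v\<bar> \<le> Q" if "u < n" "v < n" for u v
            using new that gd Rm_Q Rm unfolding brackets_def by (smt (verit))
        next
          fix m3 assume Y3: "arr m3 (bX B) Y" and fr3: "\<And>b'. b' \<noteq> rh B \<Longrightarrow> b' \<noteq> bX B \<Longrightarrow> m3 b' = m2 b'"
          have g3: "m3 (rg B) 0 = g" using fr3 m2 by simp
          show "exec w (Set (rg B) (Reg (rg B) [div] Const 2)) m3 1 ?Q"
          proof (rule exec_Set)
            show "fits w m3 (Reg (rg B) [div] Const 2)" by (rule fitsI) (use g3 gQ in simp_all)
            show "?Q (m3((rg B) := (m3 (rg B))(0 := val m3 (Reg (rg B) [div] Const 2))))"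
              using g3 Y3 new by (auto simp: arr_def intro!: exI[of _ Y])
          qed simp
        qed auto
      qed simp
    qed simp_all
  qed (simp_all add: wm bisect_time_def)
qed

definition minplus_time :: nat where
  "minplus_time = floorlog 2 (nat (4 * Rm)) * (1 + bisect_time) + 6 * (n * n) + 6"

text \<open>\<open>floorlog 2\<close> counts binary digits, with none for 0, and halving removes
  one. So it is the variant of a loop that halves down to 0.\<close>

lemma floorlog_halve:
  assumes "0 < g"
  shows "floorlog 2 (nat (g div 2)) < floorlog 2 (nat g)"
proof -
  have "nat (g div 2) = nat g div 2" by (simp add: nat_div_distrib')
  then show ?thesis using assms by (subst (2) compute_floorlog) simp
qed

text \<open>Sums of two entries lie between \<open>- 2 * R\<close> and \<open>2 * R\<close>, whence
  the initial interval of length \<open>4 * R\<close>. \<open>R\<close> is the bound for the current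
  matrix; the running time is stated with \<open>Rm\<close>, so that it is the same for all
  squarings.\<close>

lemma exec_minplus_square:
  assumes wm: "wordmem w m"
    and m: "params m" "arr m (bD B) D" "m (rR B) 0 = R"
    and R: "1 \<le> R" "R \<le> Rm"
    and D: "\<And>u v. u < n \<Longrightarrow> v < n \<Longrightarrow> \<bar>D u v\<bar> \<le> R"
  shows "exec w (minplus_square B p) m minplus_time (\<lambda>m'. \<exists>X. arr m' (bD B) X \<and> is_minplus_square n D X)"
    (is "exec w _ m _ ?Q")
proof -
  have DR: "\<bar>D u v\<bar> \<le> Rm" if "u < n" "v < n" for u v using D[OF that] R by linarith
  have RQ: "24 * R \<le> Q" using Rm_Q R by linarith
  define L where "L = floorlog 2 (nat (4 * Rm))"
  have Lg: "floorlog 2 (nat (4 * R)) \<le> L" unfolding L_def using R by (intro floorlog_mono) simp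
  define I where "I m' \<longleftrightarrow> wordmem w m' \<and> params m' \<and> arr m' (bD B) D \<and>
    (\<exists>g X. 0 \<le> g \<and> g \<le> 4 * Rm \<and> m' (rg B) 0 = g \<and> arr m' (bX B) X \<and> brackets D X g)" for m'
  define V where "V m' = floorlog 2 (nat (m' (rg B) 0))" for m' :: mem
  show ?thesis
    unfolding minplus_square_def
  proof (rule exec_Seq_frame[where ?\<tau>2.0 = "L * (1 + bisect_time) + 3 * (n * n) + 4"])
    show "exec w (fill_square B (bX B) (Const 0 [-] Const 2 [*] Reg (rR B))) m (3 * (n * n) + 2)
      (\<lambda>m'. arr m' (bX B) (\<lambda>u v. - (2 * R)))"
    proof (rule exec_fill_square[where f = "\<lambda>u v. - (2 * R)"])
      fix u v and mh :: mem
      assume "\<And>b'. b' \<noteq> rh B \<Longrightarrow> b' \<noteq> bX B \<Longrightarrow> mh b' = m b'"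
      then have r: "mh (rR B) 0 = R" using m by simp
      show "fits w mh (Const 0 [-] Const 2 [*] Reg (rR B)) \<and> val mh (Const 0 [-] Const 2 [*] Reg (rR B)) = - (2 * R)"
      proof
        show "fits w mh (Const 0 [-] Const 2 [*] Reg (rR B))" by (rule fitsI) (use r R RQ in simp_all)
      qed (simp add: r)
    qed (use m in auto)
  next
    fix m1 assume X1: "arr m1 (bX B) (\<lambda>u v. - (2 * R))" and wm1: "wordmem w m1"
      and "\<And>b. b \<notin> writes (fill_square B (bX B) (Const 0 [-] Const 2 [*] Reg (rR B))) \<Longrightarrow> m1 b = m b"
    then have fr1: "m1 b = m b" if "b \<noteq> rh B" "b \<noteq> bX B" for b
      using that by (simp add: fill_square_def)
    have m1: "params m1" "arr m1 (bD B) D" "m1 (rR B) 0 = R"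
      using m fr1 by (auto simp: params_def arr_def)
    let ?fin = "fill_square B (bD B) (Cell (bX B) (Reg (rh B)))"
    let ?m2 = "m1((rg B) := (m1 (rg B))(0 := 4 * R))"
    have f2: "fits w m1 (Const 4 [*] Reg (rR B))" by (rule fitsI) (use m1 R RQ in simp_all)
    show "exec w (Set (rg B) (Const 4 [*] Reg (rR B)) ;; While (Reg (rg B)) (bisect_step B p) ;; ?fin)
      m1 (L * (1 + bisect_time) + 3 * (n * n) + 4) ?Q"
    proof (rule exec_Seq[where ?\<tau>1.0 = 1 and ?\<tau>2.0 = "L * (1 + bisect_time) + 3 * (n * n) + 3"], rule exec_Set[OF f2])
      have "wordmem w ?m2" using wm1 fits_val[OF f2] m1 by (auto simp: wordmem_def)
      moreover have "brackets D (\<lambda>u v. - (2 * R)) (4 * R)"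
        unfolding brackets_def
      proof (intro allI impI conjI)
        fix u v assume uv: "u < n" "v < n"
        have b: "- R \<le> D u k \<and> D u k \<le> R \<and> - R \<le> D k v \<and> D k v \<le> R" if "k < n" for k
          using D[OF uv(1) that] D[OF that uv(2)] by linarith
        show "- (2 * R) \<le> D u k + D k v" if "k < n" for k using b[OF that] by linarith
        show "\<exists>k<n. D u k + D k v \<le> - (2 * R) + 4 * R"
          using b[of 0] n by (intro exI[of _ 0]) auto
      qed (use R in auto)
      moreover have "params ?m2" "arr ?m2 (bD B) D" "arr ?m2 (bX B) (\<lambda>u v. - (2 * R))"
        using m1 X1 by (auto simp: params_def arr_def)
      ultimately have I2: "I ?m2" unfolding I_def using R
        by (intro conjI exI[of _ "4 * R"] exI[of _ "\<lambda>u v. - (2 * R)"]) auto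
      have V2: "V ?m2 \<le> L" using Lg by (simp add: V_def)
      have fin: "exec w ?fin m' (3 * (n * n) + 2) ?Q" if I: "I m'" and g0: "val m' (Reg (rg B)) = 0" for m'
      proof -
        from I obtain g X where m': "params m'" "m' (rg B) 0 = g" "arr m' (bX B) X" "brackets D X g"
          unfolding I_def by blast
        have g: "g = 0" using g0 m'(2) by simp
        show ?thesis
        proof (rule exec_copy_square[OF m'(1,3)])
          show "\<bar>X u v\<bar> \<le> Q" if "u < n" "v < n" for u v
            using m'(4) g that Rm_Q Rm unfolding brackets_def by (smt (verit))
        next
          fix m3 assume "arr m3 (bD B) X"
          moreover have "is_minplus_square n D X"
            using m'(4) g unfolding brackets_def is_minplus_square_def
            by (metis add.right_neutral order_antisym)
          ultimately show "?Q m3" by blast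
        qed auto
      qed
      have "exec w (While (Reg (rg B)) (bisect_step B p) ;; ?fin) ?m2 (L * (1 + bisect_time) + 3 * (n * n) + 3) ?Q"
      proof (rule exec_Seq[where ?\<tau>1.0 = "1 + L * (1 + bisect_time)" and ?\<tau>2.0 = "3 * (n * n) + 2"])
        show "exec w (While (Reg (rg B)) (bisect_step B p)) ?m2 (1 + L * (1 + bisect_time))
          (\<lambda>m'. exec w ?fin m' (3 * (n * n) + 2) ?Q)"
        proof (rule exec_While[where I = I and V = V and \<tau> = bisect_time])
          show "I ?m2" by (rule I2)
          show "1 + V ?m2 * (1 + bisect_time) \<le> 1 + L * (1 + bisect_time)"
            using V2 by (intro add_left_mono mult_right_mono) auto
          show "exec w ?fin m' (3 * (n * n) + 2) ?Q" if "I m'" "val m' (Reg (rg B)) = 0" for m'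
            by (rule fin[OF that])
          show "fits w m' (Reg (rg B))" if "I m'" for m'
            using that unfolding I_def wordmem_def by auto
          fix m' assume I: "I m'" and "val m' (Reg (rg B)) \<noteq> 0"
          then obtain g X where m': "wordmem w m'" "params m'" "arr m' (bD B) D" "0 < g" "g \<le> 4 * Rm"
            "m' (rg B) 0 = g" "arr m' (bX B) X" "brackets D X g"
            unfolding I_def by (auto simp: less_le)
          show "exec w (bisect_step B p) m' bisect_time (\<lambda>m''. I m'' \<and> V m'' < V m')"
          proof (rule exec_frame[OF exec_bisect_step[OF m'(1-3,7,6) DR m'(8,4,5)] m'(1) order_refl])
            fix m3 assume post: "m3 (rg B) 0 = g div 2 \<and> (\<exists>X'. arr m3 (bX B) X' \<and> brackets D X' (g div 2))"
              and wm3: "wordmem w m3" and fr3: "\<And>b. b \<notin> writes (bisect_step B p) \<Longrightarrow> m3 b = m' b"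
            have "m3 b = m' b" if "b \<in> {rn B, rs B, rN B, rnb B, bD B}" for b
              using that fr3[of b] by (auto simp: bisect_step_def fill_square_def scan_def scan_step_def
                  fill_gadget_def set_block_def fill_axes_def fill_vecs_def fill_mat_def)
            then have "params m3" "arr m3 (bD B) D" using m' by (auto simp: params_def arr_def)
            moreover have "0 \<le> g div 2" "g div 2 \<le> 4 * Rm" using m'(4,5) by auto
            ultimately have "I m3" using post wm3 unfolding I_def by blast
            moreover have "V m3 < V m'" using post m'(6) floorlog_halve[OF m'(4)] by (simp add: V_def)
            ultimately show "I m3 \<and> V m3 < V m'" ..
          qed
        qed
      qed simp
      then show "exec w (While (Reg (rg B)) (bisect_step B p) ;; ?fin)
        (m1((rg B) := (m1 (rg B))(0 := val m1 (Const 4 [*] Reg (rR B)))))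
        (L * (1 + bisect_time) + 3 * (n * n) + 3) ?Q" using m1(3) by simp
    qed simp_all
  qed (simp_all add: wm minplus_time_def L_def)
qed

end

section \<open>The program for all-pairs shortest paths\<close>

text \<open>The exponent is a constant of the problem, so the power is one expression of fixed size
  and needs no loop.\<close>

fun pow_exp :: "exp \<Rightarrow> nat \<Rightarrow> exp" where
  "pow_exp e 0 = Const 1"
| "pow_exp e (Suc k) = pow_exp e k [*] e"

lemma val_pow_exp: "val m (pow_exp e k) = val m e ^ k"
  by (induction k) auto

context
  fixes B c :: nat
begin

text \<open>The cube root of \<open>n\<close>, rounded up, is found by counting; its
  \<open>O(s)\<close> steps are negligible.\<close>

definition set_params :: com where
  "set_params =
     (Set (rn B) (Reg 0) ;;
      Set (rs B) (Const 1) ;;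
      While (Reg (rs B) [*] Reg (rs B) [*] Reg (rs B) [<] Reg (rn B)) (Set (rs B) (Reg (rs B) [+] Const 1)) ;;
      Set (rN B) (Const 2 [*] Reg (rs B)) ;;
      Set (rnb B) (Reg (rn B) [div] Reg (rs B) [+] Const 1) ;;
      Set (rM B) (Const 4 [*] pow_exp (Reg (rn B)) (c + 1)))"

text \<open>Free of branches, because a fill evaluates one expression per cell. Where there is no
  arc, bank 2 holds an arbitrary word, which the factor 0 cancels; the first factor puts 0 on the
  diagonal.\<close>

definition init_exp :: exp where
  "init_exp =
     (Const 1 [-] (Reg (rh B) [div] Reg (rn B) [=] Reg (rh B) [mod] Reg (rn B))) [*]
     (Cell 1 (Reg (rh B)) [*] Cell 2 (Reg (rh B)) [+] (Const 1 [-] Cell 1 (Reg (rh B))) [*] Reg (rM B))"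

text \<open>\<open>rR\<close> stays equal to the arc weight \<open>M\<close> times the walk length
  in \<open>rlen\<close>, the entry bound that goes with that length.\<close>

definition double_step :: "com \<Rightarrow> com" where
  "double_step p =
     (minplus_square B p ;;
      Set (rlen B) (Const 2 [*] Reg (rlen B)) ;;
      Set (rR B) (Const 2 [*] Reg (rR B)))"

definition apsp_prog :: "com \<Rightarrow> com" where
  "apsp_prog p =
     (set_params ;;
      fill_square B (bD B) init_exp ;;
      Set (rlen B) (Const 1) ;;
      Set (rR B) (Reg (rM B)) ;;
      While (Reg (rlen B) [<] Reg (rn B)) (double_step p) ;;
      fill_square B 3 (Const 2 [*] Cell (bD B) (Reg (rh B)) [<] Reg (rM B)) ;;
      fill_square B 4 (Cell (bD B) (Reg (rh B))))"

end

lemma exec_Set_Seq: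
  assumes "wordmem w m" "fits w m e"
    and "\<And>m'. wordmem w m' \<Longrightarrow> m' r 0 = val m e \<Longrightarrow> (\<And>b. b \<noteq> r \<Longrightarrow> m' b = m b) \<Longrightarrow> exec w c m' \<tau> Q"
    and "1 + \<tau> \<le> \<tau>'"
  shows "exec w (Set r e ;; c) m \<tau>' Q"
proof (rule exec_Seq[where ?\<tau>1.0 = 1, OF exec_Set[OF assms(2)] assms(4)])
  show "exec w c (m(r := (m r)(0 := val m e))) \<tau> Q"
    using assms(1) fits_val[OF assms(2)] by (intro assms(3)) (auto simp: wordmem_def)
qed simp

lemma exec_Set_last:
  assumes "fits w m e"
    and "\<And>m'. m' r 0 = val m e \<Longrightarrow> (\<And>b. b \<noteq> r \<Longrightarrow> m' b = m b) \<Longrightarrow> Q m'"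
  shows "exec w (Set r e) m 1 Q"
  by (rule exec_Set[OF assms(1)]) (auto intro: assms(2))

text \<open>\<open>cube\<close> makes \<open>s\<close> the cube root of \<open>n\<close> rounded up.
  The walk length never exceeds \<open>2 * n\<close>, so entries are at most
  \<open>2 * n * M = 8 * n ^ (c + 2)\<close>, which is \<open>Rm\<close>.\<close>

locale apsp_machine = machine +
  fixes c :: nat and E :: "(nat \<times> nat) set" and wt :: "nat \<times> nat \<Rightarrow> int"
  assumes inst: "(E, wt) \<in> apsp_instances c n"
    and cube: "n \<le> s * s * s" "\<And>k. k < s \<Longrightarrow> k * k * k < n"
    and Rm_eq: "Rm = 8 * int n ^ (c + 2)"
begin

sublocale A: apsp_instance n c E wt
  using n inst by unfold_locales

lemma M_bounds: "1 \<le> A.M" "A.M * (2 * int n) = Rm" "A.M \<le> Rm" "A.M \<le> Q" "int n ^ c \<le> Q"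
proof -
  show 1: "1 \<le> A.M" using A.W by linarith
  show 2: "A.M * (2 * int n) = Rm" by (simp add: Rm_eq)
  have "A.M * 1 \<le> A.M * (2 * int n)" using 1 n by (intro mult_left_mono) auto
  then show 3: "A.M \<le> Rm" using 2 by linarith
  then show "A.M \<le> Q" using Rm_Q Rm by linarith
  then show "int n ^ c \<le> Q" using A.W by linarith
qed

text \<open>The degree of this expression grows with \<open>c\<close>, beyond any fixed bound;
  instead, every intermediate power is at most \<open>M\<close> and hence at most
  \<open>Q\<close>.\<close>

lemma fits_pow_exp:
  assumes "m r 0 = int n" "k \<le> c + 1"
  shows "fits w m (pow_exp (Reg r) k)"
  using assms(2)
proof (induction k)
  case 0
  then show ?case using Q2 by (auto intro!: small_is_word)
next
  case (Suc k)
  have "int n ^ Suc k \<le> int n ^ (c + 1)" using n Suc.prems by (intro power_increasing) auto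
  then have "int n ^ Suc k \<le> Q" using M_bounds(1,4) by linarith
  then have "is_word w (int n ^ Suc k)" by (intro small_is_word) simp
  moreover have "is_word w (int n)" using size_bounds(1) by (intro small_is_word) simp
  ultimately show ?case using Suc assms(1) by (simp add: val_pow_exp mult.commute)
qed

lemma exec_set_params:
  assumes wm: "wordmem w m" and m: "m 0 0 = int n"
  shows "exec w (set_params B c) m (2 * s + 6) (\<lambda>m'. params m' \<and> m' (rM B) 0 = A.M)"
    (is "exec w _ m _ ?Q")
proof -
  let ?W = "While (Reg (rs B) [*] Reg (rs B) [*] Reg (rs B) [<] Reg (rn B)) (Set (rs B) (Reg (rs B) [+] Const 1))"
  let ?C3 = "Set (rM B) (Const 4 [*] pow_exp (Reg (rn B)) (c + 1))"
  let ?C2 = "Set (rnb B) (Reg (rn B) [div] Reg (rs B) [+] Const 1) ;; ?C3"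
  let ?C1 = "Set (rN B) (Const 2 [*] Reg (rs B)) ;; ?C2"
  have C1: "exec w ?C1 m' 3 ?Q" if wm': "wordmem w m'" and m': "m' (rn B) 0 = int n" "m' (rs B) 0 = int s" for m'
  proof (rule exec_Set_Seq[where \<tau> = 2, OF wm'])
    show "fits w m' (Const 2 [*] Reg (rs B))" by (rule fitsI) (simp_all add: m' size_bounds)
    fix m1 assume wm1: "wordmem w m1" and "m1 (rN B) 0 = val m' (Const 2 [*] Reg (rs B))"
      and "\<And>b. b \<noteq> rN B \<Longrightarrow> m1 b = m' b"
    then have m1: "m1 (rN B) 0 = int N" "m1 (rn B) 0 = int n" "m1 (rs B) 0 = int s" using m' N by auto
    show "exec w ?C2 m1 2 ?Q"
    proof (rule exec_Set_Seq[where \<tau> = 1, OF wm1])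
      show "fits w m1 (Reg (rn B) [div] Reg (rs B) [+] Const 1)" by (rule fitsI) (simp_all add: m1 size_bounds)
      fix m2 assume wm2: "wordmem w m2" and "m2 (rnb B) 0 = val m1 (Reg (rn B) [div] Reg (rs B) [+] Const 1)"
        and "\<And>b. b \<noteq> rnb B \<Longrightarrow> m2 b = m1 b"
      then have m2: "m2 (rnb B) 0 = int nb" "m2 (rN B) 0 = int N" "m2 (rn B) 0 = int n" "m2 (rs B) 0 = int s"
        using m1 nb by (auto simp: zdiv_int)
      have v: "val m2 (Const 4 [*] pow_exp (Reg (rn B)) (c + 1)) = A.M"
        using m2(3) by (simp add: val_pow_exp)
      have "is_word w 4" "is_word w A.M" using Q2 M_bounds by (auto intro!: small_is_word)
      then have f: "fits w m2 (Const 4 [*] pow_exp (Reg (rn B)) (c + 1))"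
        using fits_pow_exp[of m2 "rn B" "c + 1"] m2(3) v by (simp del: pow_exp.simps Suc_eq_plus1 add: add.commute[of _ 1] del: power_Suc)
      show "exec w ?C3 m2 1 ?Q"
        by (rule exec_Set_last[OF f]) (use m2 v in \<open>simp add: params_def\<close>)
    qed simp
  qed simp
  define I where "I m' \<longleftrightarrow> wordmem w m' \<and> m' (rn B) 0 = int n \<and> (\<exists>k\<le>s. m' (rs B) 0 = int k)" for m'
  define V where "V m' = s - nat (m' (rs B) 0)" for m' :: mem
  have kQ: "int k \<le> Q" if "k \<le> s" for k using that size_bounds(2) by linarith
  have guard: "val m' (Reg (rs B) [*] Reg (rs B) [*] Reg (rs B) [<] Reg (rn B)) = of_bool (k < s)"
    if "m' (rn B) 0 = int n" "m' (rs B) 0 = int k" "k \<le> s" for m' k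
  proof -
    have "int k * int k * int k < int n \<longleftrightarrow> k * k * k < n" by (metis of_nat_less_iff of_nat_mult)
    also have "\<dots> \<longleftrightarrow> k < s"
      using cube(1) cube(2)[of k] that(3) by (metis le_neq_implies_less not_less)
    finally show ?thesis using that by simp
  qed
  have W: "exec w (?W ;; ?C1) m' (2 * s + 4) ?Q"
    if wm': "wordmem w m'" and m': "m' (rn B) 0 = int n" "m' (rs B) 0 = 1" for m'
  proof (rule exec_Seq[where ?\<tau>1.0 = "1 + s * 2" and ?\<tau>2.0 = 3])
    show "exec w ?W m' (1 + s * 2) (\<lambda>m'. exec w ?C1 m' 3 ?Q)"
    proof (rule exec_While[where I = I and V = V and \<tau> = 1])
      show "I m'" using wm' m' s unfolding I_def by (auto intro!: exI[of _ 1])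
      show "1 + V m' * (1 + 1) \<le> 1 + s * 2" by (simp add: V_def)
      fix m1 assume "I m1"
      then obtain k where k: "wordmem w m1" "m1 (rn B) 0 = int n" "k \<le> s" "m1 (rs B) 0 = int k"
        unfolding I_def by blast
      show "fits w m1 (Reg (rs B) [*] Reg (rs B) [*] Reg (rs B) [<] Reg (rn B))"
        by (rule fitsI) (use k kQ size_bounds in simp_all)
      show "exec w ?C1 m1 3 ?Q" if "val m1 (Reg (rs B) [*] Reg (rs B) [*] Reg (rs B) [<] Reg (rn B)) = 0"
        using that k C1 unfolding guard[where m' = m1, OF k(2,4,3)] by (cases "k = s") auto
      assume "val m1 (Reg (rs B) [*] Reg (rs B) [*] Reg (rs B) [<] Reg (rn B)) \<noteq> 0"
      then have ks: "k < s" unfolding guard[where m' = m1, OF k(2,4,3)] by simp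
      have f: "fits w m1 (Reg (rs B) [+] Const 1)" by (rule fitsI) (use k kQ in simp_all)
      let ?m2 = "m1((rs B) := (m1 (rs B))(0 := val m1 (Reg (rs B) [+] Const 1)))"
      have "wordmem w ?m2" using k(1) fits_val[OF f] by (auto simp: wordmem_def)
      then have "I ?m2" using k ks unfolding I_def by (auto intro!: exI[of _ "Suc k"])
      moreover have "V ?m2 < V m1" using k ks by (simp add: V_def)
      ultimately show "exec w (Set (rs B) (Reg (rs B) [+] Const 1)) m1 1 (\<lambda>m'. I m' \<and> V m' < V m1)"
        by (intro exec_Set[OF f]) auto
    qed
  qed simp
  show ?thesis
    unfolding set_params_def
  proof (rule exec_Set_Seq[where \<tau> = "2 * s + 5", OF wm])
    show "fits w m (Reg 0)" by (rule fitsI) (simp_all add: m size_bounds)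
    fix m1 assume wm1: "wordmem w m1" and "m1 (rn B) 0 = val m (Reg 0)"
    then have m1: "m1 (rn B) 0 = int n" using m by simp
    show "exec w (Set (rs B) (Const 1) ;; ?W ;; ?C1) m1 (2 * s + 5) ?Q"
    proof (rule exec_Set_Seq[where \<tau> = "2 * s + 4", OF wm1])
      show "fits w m1 (Const 1)" by (rule fitsI) auto
      fix m2 assume wm2: "wordmem w m2" and "m2 (rs B) 0 = val m1 (Const 1)" and "\<And>b. b \<noteq> rs B \<Longrightarrow> m2 b = m1 b"
      then show "exec w (?W ;; ?C1) m2 (2 * s + 4) ?Q" using m1 by (intro W[OF wm2]) auto
    qed simp
  qed simp
qed

lemma init_exp:
  assumes uv: "u < n" "v < n" and h: "m (rh B) 0 = int (u * n + v)"
    and word: "\<And>a. is_word w (m 2 a)" and m: "m (rn B) 0 = int n" "m (rM B) 0 = A.M"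
    and inp: "m 1 (int (u * n + v)) = (if (u, v) \<in> E then 1 else 0)"
      "(u, v) \<in> E \<Longrightarrow> m 2 (int (u * n + v)) = wt (u, v)"
  shows "fits w m (init_exp B) \<and>
    val m (init_exp B) = (if u = v then 0 else if (u, v) \<in> E then wt (u, v) else A.M)"
proof -
  note hQ = pair_le_Q[OF uv]
  define flag where "flag = Cell 1 (Reg (rh B))"
  define wc where "wc = Cell 2 (Reg (rh B))"
  define eq where "eq = (Const 1 [-] (Reg (rh B) [div] Reg (rn B) [=] Reg (rh B) [mod] Reg (rn B)))"
  have e: "init_exp B = eq [*] (flag [*] wc [+] (Const 1 [-] flag) [*] Reg (rM B))"
    by (simp add: init_exp_def flag_def wc_def eq_def)
  have "int (u * n + v) div int n = int u" "int (u * n + v) mod int n = int v"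
    using uv by (simp_all add: zdiv_int[symmetric] zmod_int[symmetric] del: of_nat_add of_nat_mult)
  then have v: "val m eq = of_bool (u \<noteq> v)" "val m flag = of_bool ((u, v) \<in> E)"
    using h m inp by (auto simp: eq_def flag_def)
  have f: "fits w m eq" "fits w m flag" "fits w m ((Const 1 [-] flag) [*] Reg (rM B))"
    unfolding eq_def flag_def
    by (rule fitsI; use h m inp(1) hQ size_bounds(1) Q2 M_bounds(1,4) in \<open>simp del: of_nat_add of_nat_mult\<close>)+
  have fw: "fits w m wc"
    using word f(2) by (auto simp: wc_def flag_def)
  have words: "is_word w A.M" "(u, v) \<in> E \<Longrightarrow> is_word w (wt (u, v))"
    using M_bounds A.wt[of "(u, v)"] by (auto intro!: small_is_word)
  show ?thesis
  proof (cases "(u, v) \<in> E")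
    case True
    then have "val m wc = wt (u, v)" using h inp by (simp add: wc_def)
    then show ?thesis unfolding e using True v f fw words m by auto
  next
    case False
    then show ?thesis unfolding e using v f fw words m by auto
  qed
qed

definition apsp_time :: nat where
  "apsp_time = 2 * s + 9 * (n * n) + 15 + floorlog 2 n * (3 + minplus_time)"

lemma exec_double_step:
  assumes wm: "wordmem w m" and m: "params m" "arr m (bD B) D" "m (rlen B) 0 = int len"
      "m (rR B) 0 = A.M * int len"
    and len: "1 \<le> len" "len < n" and D: "A.approx len D"
  shows "exec w (double_step B p) m (2 + minplus_time) (\<lambda>m'. m' (rlen B) 0 = int (2 * len) \<and>
    m' (rR B) 0 = A.M * int (2 * len) \<and> (\<exists>X. arr m' (bD B) X \<and> A.approx (2 * len) X))"
    (is "exec w _ m _ ?Q")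
proof -
  \<comment> \<open>A squaring is started only while \<open>len < n\<close>, so the doubled length
    is still at most \<open>2 * n\<close>.\<close>
  have R2: "A.M * int (2 * len) \<le> Rm"
    unfolding M_bounds(2)[symmetric] using len M_bounds(1) by (intro mult_left_mono) auto
  have R1: "1 * 1 \<le> A.M * int len" using M_bounds(1) len by (intro mult_mono) auto
  have e2: "A.M * int (2 * len) = 2 * (A.M * int len)" by simp
  have R: "1 \<le> A.M * int len" "A.M * int len \<le> Rm" "A.M * int len \<le> Q"
    using R1 R2 Rm_Q unfolding e2 by linarith+
  have Db: "\<bar>D u v\<bar> \<le> A.M * int len" if "u < n" "v < n" for u v
  proof -
    have "- (int len * int n ^ c) \<le> D u v" "D u v \<le> int len * A.M"
      using D that unfolding A.approx_def by auto
    moreover have "int len * int n ^ c \<le> int len * A.M" using A.W(2) by (intro mult_left_mono) auto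
    ultimately show ?thesis by (simp only: mult.commute[of A.M])
  qed
  have lenQ: "int len \<le> Q" using len size_bounds(1) by linarith
  show ?thesis
    unfolding double_step_def
  proof (rule exec_Seq_frame[OF exec_minplus_square[OF wm m(1,2,4) R(1,2) Db] wm, where ?\<tau>2.0 = 2])
    fix m1 assume "\<exists>X. arr m1 (bD B) X \<and> is_minplus_square n D X" and wm1: "wordmem w m1"
      and fr: "\<And>b. b \<notin> writes (minplus_square B p) \<Longrightarrow> m1 b = m b"
    then obtain X where X: "arr m1 (bD B) X" "A.approx (2 * len) X" using A.approx_square[OF D] by blast
    have "m1 b = m b" if "b \<in> {rlen B, rR B}" for b
      using that fr[of b] by (auto simp: minplus_square_def bisect_step_def fill_square_def scan_def
          scan_step_def fill_gadget_def set_block_def fill_axes_def fill_vecs_def fill_mat_def)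
    then have m1: "m1 (rlen B) 0 = int len" "m1 (rR B) 0 = A.M * int len" using m by auto
    show "exec w (Set (rlen B) (Const 2 [*] Reg (rlen B)) ;; Set (rR B) (Const 2 [*] Reg (rR B))) m1 2 ?Q"
    proof (rule exec_Set_Seq[where \<tau> = 1, OF wm1])
      show "fits w m1 (Const 2 [*] Reg (rlen B))" by (rule fitsI) (use m1 lenQ in simp_all)
      fix m2 assume l2: "m2 (rlen B) 0 = val m1 (Const 2 [*] Reg (rlen B))"
        and fr2: "\<And>b. b \<noteq> rlen B \<Longrightarrow> m2 b = m1 b"
      have r2: "m2 (rR B) 0 = A.M * int len" using fr2 m1 by simp
      have D2: "arr m2 (bD B) X" using fr2 X by (simp add: arr_def)
      show "exec w (Set (rR B) (Const 2 [*] Reg (rR B))) m2 1 ?Q"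
      proof (rule exec_Set_last)
        show "fits w m2 (Const 2 [*] Reg (rR B))"
        proof (rule fitsI)
          show "small_cells Q m2 (Const 2 [*] Reg (rR B))"
            unfolding small_cells.simps val.simps r2 using R(1,3) by (intro conjI TrueI) linarith
        qed simp_all
        fix m3 assume r3: "m3 (rR B) 0 = val m2 (Const 2 [*] Reg (rR B))"
          and fr3: "\<And>b. b \<noteq> rR B \<Longrightarrow> m3 b = m2 b"
        have "m3 (rR B) 0 = A.M * int (2 * len)" unfolding r3 e2 by (simp add: r2)
        moreover have "m3 (rlen B) 0 = int (2 * len)" using fr3 l2 m1 by simp
        moreover have "arr m3 (bD B) X" using fr3 D2 by (simp add: arr_def)
        ultimately show "?Q m3" using X(2) by blast
      qed
    qed simp
  qed (simp_all add: minplus_time_def)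
qed

lemma exec_apsp_prog:
  assumes wm: "wordmem w m" and inp: "apsp_input n (E, wt) m"
  shows "exec w (apsp_prog B c p) m apsp_time (apsp_output n (E, wt))"
    (is "exec w _ m _ ?Q")
proof -
  let ?F4 = "fill_square B 4 (Cell (bD B) (Reg (rh B)))"
  let ?F3 = "fill_square B 3 (Const 2 [*] Cell (bD B) (Reg (rh B)) [<] Reg (rM B)) ;; ?F4"
  let ?W = "While (Reg (rlen B) [<] Reg (rn B)) (double_step B p)"
  let ?L = "floorlog 2 n * (3 + minplus_time)"
  have F3: "exec w ?F3 m' (6 * (n * n) + 4) ?Q"
    if m': "params m'" "arr m' (bD B) D" "m' (rM B) 0 = A.M"
      and D: "A.approx len D" and len: "n \<le> len" "len \<le> 2 * n" for m' D len
  proof -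
    have DQ: "\<bar>D u v\<bar> \<le> Q" if "u < n" "v < n" for u v
    proof -
      have "- (int len * int n ^ c) \<le> D u v" "D u v \<le> int len * A.M"
        using D that unfolding A.approx_def by auto
      moreover have "int len * int n ^ c \<le> int len * A.M" using A.W(2) by (intro mult_left_mono) auto
      moreover have "int len * A.M \<le> 2 * int n * A.M" using len M_bounds(1) by (intro mult_right_mono) auto
      ultimately show ?thesis using M_bounds(2) Rm_Q Rm by (simp only: mult.commute[of _ A.M])
    qed
    show ?thesis
    proof (rule exec_Seq[where ?\<tau>1.0 = "3 * (n * n) + 2" and ?\<tau>2.0 = "3 * (n * n) + 2"])
      show "exec w (fill_square B 3 (Const 2 [*] Cell (bD B) (Reg (rh B)) [<] Reg (rM B))) m' (3 * (n * n) + 2)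
        (\<lambda>m'. exec w ?F4 m' (3 * (n * n) + 2) ?Q)"
      proof (rule exec_fill_square[where f = "\<lambda>u v. of_bool (2 * D u v < A.M)"])
        fix u v and mh :: mem
        assume uv: "u < n" "v < n" and h: "mh (rh B) 0 = int (u * n + v)"
          and fr: "\<And>b'. b' \<noteq> rh B \<Longrightarrow> b' \<noteq> 3 \<Longrightarrow> mh b' = m' b'"
        have d: "mh (bD B) (int (u * n + v)) = D u v" using fr m'(2) uv by (simp add: arr_def)
        have M: "mh (rM B) 0 = A.M" using fr m'(3) by simp
        show "fits w mh (Const 2 [*] Cell (bD B) (Reg (rh B)) [<] Reg (rM B)) \<and>
          val mh (Const 2 [*] Cell (bD B) (Reg (rh B)) [<] Reg (rM B)) = of_bool (2 * D u v < A.M)"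
        proof
          show "fits w mh (Const 2 [*] Cell (bD B) (Reg (rh B)) [<] Reg (rM B))"
            by (rule fitsI) (use h d M pair_le_Q[OF uv] DQ[OF uv] M_bounds(1,4)
                in \<open>simp_all del: of_nat_add of_nat_mult\<close>)
        qed (use h d M in \<open>simp del: of_nat_add of_nat_mult\<close>)
      next
        fix m1 assume F: "arr m1 3 (\<lambda>u v. of_bool (2 * D u v < A.M))"
          and fr1: "\<And>b'. b' \<noteq> rh B \<Longrightarrow> b' \<noteq> 3 \<Longrightarrow> m1 b' = m' b'"
        have m1: "params m1" "arr m1 (bD B) D" using m' fr1 by (auto simp: params_def arr_def)
        show "exec w ?F4 m1 (3 * (n * n) + 2) ?Q"
        proof (rule exec_copy_square[OF m1 _ _ DQ])
          fix m2 assume D4: "arr m2 4 D" and fr2: "\<And>b'. b' \<noteq> rh B \<Longrightarrow> b' \<noteq> 4 \<Longrightarrow> m2 b' = m1 b'"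
          have F2: "arr m2 3 (\<lambda>u v. of_bool (2 * D u v < A.M))" using F fr2 by (simp add: arr_def)
          show "?Q m2"
            unfolding apsp_output_def case_prod_conv Let_def
          proof (intro allI impI)
            fix u v assume uv: "u < n" "v < n"
            have "m2 3 (int (u * n + v)) = of_bool (2 * D u v < A.M)" "m2 4 (int (u * n + v)) = D u v"
              using F2 D4 uv by (simp_all add: arr_def)
            then show "if A.G.\<mu> (\<lambda>e. real_of_int (wt e)) u v = \<infinity> then m2 3 (int (u * n + v)) = 0
              else m2 3 (int (u * n + v)) = 1 \<and>
                A.G.\<mu> (\<lambda>e. real_of_int (wt e)) u v = ereal (real_of_int (m2 4 (int (u * n + v))))"
              using A.approx_dist[OF D len uv] by (auto split: if_splits)
          qed
        qed auto
      qed (use m' in auto)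
    qed simp
  qed
  define I where "I m' \<longleftrightarrow> wordmem w m' \<and> params m' \<and> m' (rM B) 0 = A.M \<and>
     (\<exists>len D. 1 \<le> len \<and> len \<le> 2 * n \<and> m' (rlen B) 0 = int len \<and> m' (rR B) 0 = A.M * int len \<and>
        arr m' (bD B) D \<and> A.approx len D)" for m'
  \<comment> \<open>Doubling the length halves this quotient, which is positive exactly while the
    length is below \<open>n\<close>.\<close>
  define V where "V m' = floorlog 2 ((n - 1) div nat (m' (rlen B) 0))" for m' :: mem
  have V_le: "V m' \<le> floorlog 2 n" for m'
    unfolding V_def by (rule floorlog_mono) (meson diff_le_self div_le_dividend le_trans)
  have W: "exec w (?W ;; ?F3) m' (?L + 6 * (n * n) + 5) ?Q" if I: "I m'" for m'
  proof (rule exec_Seq[where ?\<tau>1.0 = "1 + ?L" and ?\<tau>2.0 = "6 * (n * n) + 4"])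
    show "exec w ?W m' (1 + ?L) (\<lambda>m'. exec w ?F3 m' (6 * (n * n) + 4) ?Q)"
    proof (rule exec_While[where I = I and V = V and \<tau> = "2 + minplus_time", OF _ _ _ I])
      show "1 + V m' * (1 + (2 + minplus_time)) \<le> 1 + ?L"
        using V_le[of m'] by (intro add_left_mono mult_mono) auto
      fix m1 assume "I m1"
      then obtain len D where m1: "wordmem w m1" "params m1" "arr m1 (bD B) D" "m1 (rlen B) 0 = int len"
        "m1 (rR B) 0 = A.M * int len" "m1 (rM B) 0 = A.M" and len: "1 \<le> len" "len \<le> 2 * n"
        and D: "A.approx len D" unfolding I_def by blast
      have rn: "m1 (rn B) 0 = int n" using m1(2) by (simp add: params_def)
      have lenQ: "int len \<le> Q" using len(2) size_bounds(7) by linarith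
      show "fits w m1 (Reg (rlen B) [<] Reg (rn B))"
        by (rule fitsI) (use m1(4) rn lenQ size_bounds(1) in simp_all)
      show "exec w ?F3 m1 (6 * (n * n) + 4) ?Q" if "val m1 (Reg (rlen B) [<] Reg (rn B)) = 0"
        using that m1(4) rn len by (intro F3[OF m1(2,3,6) D]) (auto split: if_splits)
      assume "val m1 (Reg (rlen B) [<] Reg (rn B)) \<noteq> 0"
      then have ln: "len < n" using m1(4) rn by (auto split: if_splits)
      show "exec w (double_step B p) m1 (2 + minplus_time) (\<lambda>m'. I m' \<and> V m' < V m1)"
      proof (rule exec_frame[OF exec_double_step[OF m1(1-5) len(1) ln D] m1(1) order_refl], elim conjE exE)
        fix m2 X
        assume l2: "m2 (rlen B) 0 = int (2 * len)" and R2: "m2 (rR B) 0 = A.M * int (2 * len)"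
          and X: "arr m2 (bD B) X" "A.approx (2 * len) X" and wm2: "wordmem w m2"
          and fr2: "\<And>b. b \<notin> writes (double_step B p) \<Longrightarrow> m2 b = m1 b"
        have "m2 b = m1 b" if "b \<in> {rn B, rs B, rN B, rnb B, rM B}" for b
          using that fr2[of b] by (auto simp: double_step_def minplus_square_def bisect_step_def fill_square_def
              scan_def scan_step_def fill_gadget_def set_block_def fill_axes_def fill_vecs_def fill_mat_def)
        then have "params m2" "m2 (rM B) 0 = A.M" using m1 by (auto simp: params_def)
        moreover have "1 \<le> 2 * len" "2 * len \<le> 2 * n" using len ln by auto
        ultimately have "I m2" using wm2 l2 R2 X unfolding I_def by blast
        moreover have "V m2 < V m1"
        proof -
          have d: "(n - 1) div (2 * len) = (n - 1) div len div 2" by (metis div_mult2_eq mult.commute)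
          have "0 < (n - 1) div len" using ln len by (simp add: div_greater_zero_iff)
          then have "floorlog 2 ((n - 1) div len div 2) < floorlog 2 ((n - 1) div len)"
            by (subst (2) compute_floorlog) simp
          then show ?thesis unfolding V_def l2 m1(4) nat_int d .
        qed
        ultimately show "I m2 \<and> V m2 < V m1" ..
      qed
    qed
  qed simp
  show ?thesis
    unfolding apsp_prog_def
  proof (rule exec_Seq_frame[OF exec_set_params[OF wm] wm, where ?\<tau>2.0 = "?L + 9 * (n * n) + 9"])
    show "m 0 0 = int n" using inp by (simp add: apsp_input_def)
    fix m1 assume m1: "params m1 \<and> m1 (rM B) 0 = A.M" and wm1: "wordmem w m1"
      and fr1: "\<And>b. b \<notin> writes (set_params B c) \<Longrightarrow> m1 b = m b"
    have in1: "m1 1 = m 1" "m1 2 = m 2" by (auto intro!: fr1 simp: set_params_def)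
    define D where "D u v = (if u = v then 0 else if (u, v) \<in> E then wt (u, v) else A.M)" for u v
    have D1: "A.approx 1 D" by (rule A.approx_init) (simp add: D_def)
    show "exec w (fill_square B (bD B) (init_exp B) ;; Set (rlen B) (Const 1) ;; Set (rR B) (Reg (rM B)) ;;
        ?W ;; ?F3) m1 (?L + 9 * (n * n) + 9) ?Q"
    proof (rule exec_Seq_frame[where ?\<tau>1.0 = "3 * (n * n) + 2" and ?\<tau>2.0 = "?L + 6 * (n * n) + 7", OF _ wm1])
      show "exec w (fill_square B (bD B) (init_exp B)) m1 (3 * (n * n) + 2) (\<lambda>m'. arr m' (bD B) D)"
      proof (rule exec_fill_square[where f = D])
        fix u v and mh :: mem
        assume uv: "u < n" "v < n" and h: "mh (rh B) 0 = int (u * n + v)"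
          and fr: "\<And>b'. b' \<noteq> rh B \<Longrightarrow> b' \<noteq> bD B \<Longrightarrow> mh b' = m1 b'"
        show "fits w mh (init_exp B) \<and> val mh (init_exp B) = D u v"
          unfolding D_def
        proof (rule init_exp[where m = mh, OF uv h])
          show "is_word w (mh 2 a)" for a using wm1 fr by (simp add: wordmem_def)
          show "mh (rn B) 0 = int n" "mh (rM B) 0 = A.M" using m1 fr by (auto simp: params_def)
          show "mh 1 (int (u * n + v)) = (if (u, v) \<in> E then 1 else 0)"
            "(u, v) \<in> E \<Longrightarrow> mh 2 (int (u * n + v)) = wt (u, v)"
            using inp uv fr in1 by (auto simp: apsp_input_def)
        qed
      qed (use m1 in \<open>auto simp: init_exp_def\<close>)
    next
      fix m2 assume D2: "arr m2 (bD B) D" and wm2: "wordmem w m2"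
        and "\<And>b. b \<notin> writes (fill_square B (bD B) (init_exp B)) \<Longrightarrow> m2 b = m1 b"
      then have fr2: "m2 b = m1 b" if "b \<noteq> rh B" "b \<noteq> bD B" for b using that by (simp add: fill_square_def)
      have m2: "params m2" "m2 (rM B) 0 = A.M" using m1 fr2 by (auto simp: params_def)
      show "exec w (Set (rlen B) (Const 1) ;; Set (rR B) (Reg (rM B)) ;; ?W ;; ?F3) m2 (?L + 6 * (n * n) + 7) ?Q"
      proof (rule exec_Set_Seq[where \<tau> = "?L + 6 * (n * n) + 6", OF wm2])
        show "fits w m2 (Const 1)" by (rule fitsI) auto
        fix m3 assume wm3: "wordmem w m3" and l3: "m3 (rlen B) 0 = val m2 (Const 1)"
          and fr3: "\<And>b. b \<noteq> rlen B \<Longrightarrow> m3 b = m2 b"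
        have m3: "params m3" "m3 (rM B) 0 = A.M" "m3 (rlen B) 0 = 1" "arr m3 (bD B) D"
          using m2 D2 fr3 l3 by (auto simp: params_def arr_def)
        show "exec w (Set (rR B) (Reg (rM B)) ;; ?W ;; ?F3) m3 (?L + 6 * (n * n) + 6) ?Q"
        proof (rule exec_Set_Seq[where \<tau> = "?L + 6 * (n * n) + 5", OF wm3])
          show "fits w m3 (Reg (rM B))" using wm3 by (simp add: wordmem_def)
          fix m4 assume wm4: "wordmem w m4" and R4: "m4 (rR B) 0 = val m3 (Reg (rM B))"
            and fr4: "\<And>b. b \<noteq> rR B \<Longrightarrow> m4 b = m3 b"
          have "params m4" "m4 (rM B) 0 = A.M" "m4 (rlen B) 0 = int 1" "arr m4 (bD B) D" "m4 (rR B) 0 = A.M * int 1"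
            using m3 fr4 R4 by (auto simp: params_def arr_def)
          moreover have "1 \<le> 2 * n" using n by simp
          ultimately have "I m4" using wm4 D1 unfolding I_def by blast
          then show "exec w (?W ;; ?F3) m4 (?L + 6 * (n * n) + 5) ?Q" by (rule W)
        qed simp
      qed simp
    qed simp
  qed (simp_all add: apsp_time_def)
qed

end

section \<open>Running time\<close>

text \<open>In \<open>apsp_time_le\<close>, 79 is 43 + 18 + 18 for one round of a scan, and 576 is 9
  * 64, for at most \<open>9 * n^2\<close> rounds and for \<open>4 powr 3\<close>, from
  \<open>N \<le> 4 * n^(1/3)\<close>. The squared factor comes from two logarithms, each bounded by
  a multiple of \<open>n powr (\<epsilon> / 12)\<close>.\<close>

definition time_const :: "nat \<Rightarrow> real \<Rightarrow> real \<Rightarrow> real" where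
  "time_const c C \<epsilon> = (29 + (real c + 20) * (14 + 576 * (79 + C))) * (1 + 12 / (\<epsilon> * ln 2))\<^sup>2"

lemma floorlog_le: "1 \<le> k \<Longrightarrow> real (floorlog 2 k) \<le> 1 + log 2 (real k)"
proof -
  assume k: "1 \<le> k"
  then have "0 \<le> log 2 (real k)" by simp
  then have "real (nat \<lfloor>log 2 (real k)\<rfloor>) \<le> log 2 (real k)" by linarith
  then show ?thesis using k by (simp add: floorlog_def)
qed

context apsp_machine
begin

text \<open>With \<open>y = n^(1/3)\<close>, \<open>s\<close> lies between \<open>y\<close> and
  \<open>2 * y\<close> and \<open>nb\<close> is at most \<open>2 * y^2\<close>, so a scan has
  \<open>O(n^2)\<close> rounds of cost \<open>O(y powr (3 - \<epsilon>))\<close>. That gives the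
  exponent \<open>3 - \<epsilon> / 3\<close>, and the logarithms raise it to
  \<open>3 - \<epsilon> / 6\<close>.\<close>

lemma apsp_time_le:
  fixes \<epsilon> C :: real
  assumes \<epsilon>: "0 < \<epsilon>" "\<epsilon> \<le> 1" and C: "1 \<le> C" and \<tau>p: "real \<tau>p \<le> C * real N powr (3 - \<epsilon>)"
  shows "real apsp_time \<le> time_const c C \<epsilon> * real n powr (3 - \<epsilon> / 6)"
proof -
  define x where "x = real n"
  have x: "1 \<le> x" using n by (simp add: x_def)
  define y where "y = x powr (1/3)"
  have y: "1 \<le> y" using x by (simp add: y_def ge_one_powr_ge_zero)
  have y3: "y ^ 3 = x" using x by (simp add: y_def powr_power)
  have s_ge: "y \<le> real s"
  proof (rule power_le_imp_le_base)
    have "real n \<le> real (s * s * s)" using cube(1) by (simp only: of_nat_le_iff)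
    then show "y ^ Suc 2 \<le> real s ^ Suc 2" using y3 by (simp add: x_def eval_nat_numeral mult.assoc)
  qed simp
  have s_le: "real s \<le> 2 * y"
  proof -
    obtain k where k: "s = Suc k" using s by (cases s) auto
    have "real (k * k * k) \<le> real n" using cube(2)[of k] k by (simp only: of_nat_le_iff) simp
    then have "real k ^ Suc 2 \<le> y ^ Suc 2" using y3 by (simp add: x_def eval_nat_numeral mult.assoc)
    then have "real k \<le> y" by (rule power_le_imp_le_base) (use y in simp)
    then show ?thesis using k y by simp
  qed
  have nb_le: "real nb \<le> 2 * y ^ 2"
  proof -
    have "real (n div s * s) \<le> real n" by (rule of_nat_mono) simp
    then have "real (n div s) \<le> x / real s" using s by (simp add: x_def pos_le_divide_eq)
    also have "\<dots> \<le> x / y" using s_ge y x by (intro divide_left_mono) auto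
    also have "\<dots> = y ^ 2" using y by (simp add: y3[symmetric] power2_eq_square power3_eq_cube)
    finally show ?thesis using nb one_le_power[OF y, of 2] by simp
  qed
  have nb3: "real (nb * nb * nb) \<le> 8 * x ^ 2"
  proof -
    have "real (nb * nb * nb) = real nb ^ 3" by (simp add: power3_eq_cube)
    also have "\<dots> \<le> (2 * y ^ 2) ^ 3" using nb_le by (intro power_mono) auto
    also have "\<dots> = 8 * (y ^ 3) ^ 2" by (simp add: power_mult_distrib flip: power_mult)
    finally show ?thesis using y3 by simp
  qed
  define a where "a = 3 - \<epsilon>"
  \<comment> \<open>From \<open>2 \<le> a\<close>, the quadratic cost of writing an instance is
    covered by the bound for solving it.\<close>
  have a: "2 \<le> a" "a \<le> 3" using \<epsilon> by (auto simp: a_def)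
  define z where "z = real N"
  have z: "1 \<le> z" "z \<le> 4 * y" using N s s_le by (auto simp: z_def)
  define Z where "Z = z powr a"
  have zZ: "z ^ 2 \<le> Z" unfolding Z_def using powr_mono[OF a(1) z(1)] z(1) by simp
  have "z \<le> z ^ 2" using z(1) by (simp add: power2_eq_square)
  then have zZ': "z \<le> Z" "1 \<le> Z" using zZ z(1) by auto
  have body: "real (43 + 18 * (N * N) + 18 * N + \<tau>p) \<le> (79 + C) * Z"
  proof -
    have "real (43 + 18 * (N * N) + 18 * N + \<tau>p) = 43 + 18 * z ^ 2 + 18 * z + real \<tau>p"
      by (simp add: z_def power2_eq_square)
    also have "\<dots> \<le> 43 * Z + 18 * Z + 18 * Z + C * Z"
      using zZ zZ' \<tau>p by (intro add_mono) (auto simp: Z_def z_def a_def)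
    finally show ?thesis by (simp add: algebra_simps)
  qed
  define b where "b = 2 + a / 3"
  define P where "P = x powr b"
  have ZX: "Z \<le> 64 * x powr (a / 3)"
  proof -
    have "Z \<le> (4 * y) powr a" unfolding Z_def using z a by (intro powr_mono2) auto
    also have "\<dots> = 4 powr a * y powr a" using y by (intro powr_mult) 
    also have "4 powr a \<le> 4 powr (3::real)" using a by (intro powr_mono) auto
    also have "4 powr (3::real) = 64" by (simp flip: powr_realpow)
    also have "y powr a = x powr (a / 3)" by (simp add: y_def powr_powr)
    finally show ?thesis by (simp add: mult_right_mono)
  qed
  have xP: "x ^ 2 \<le> P" "1 \<le> P" "x \<le> P"
  proof -
    show 1: "x ^ 2 \<le> P" unfolding P_def b_def using powr_mono[of 2 "2 + a / 3" x] a x by simp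
    have "x \<le> x ^ 2" using x by (simp add: power2_eq_square)
    with 1 show "1 \<le> P" "x \<le> P" using x by auto
  qed
  have split: "x ^ 2 * x powr (a / 3) = P" unfolding P_def b_def using x by (simp add: powr_add)
  have scan: "real scan_time \<le> (2 + 576 * (79 + C)) * P"
  proof -
    have "real scan_time = 2 + (real (nb * nb * nb) + x ^ 2) * real (43 + 18 * (N * N) + 18 * N + \<tau>p)"
      by (simp add: scan_time_def x_def power2_eq_square)
    also have "\<dots> \<le> 2 + (9 * x ^ 2) * ((79 + C) * (64 * x powr (a / 3)))"
      using nb3 body ZX C by (intro add_left_mono mult_mono) (auto intro: order_trans mult_left_mono)
    also have "\<dots> = 2 + 576 * (79 + C) * (x ^ 2 * x powr (a / 3))" by (simp add: algebra_simps)
    also have "\<dots> \<le> 2 * P + 576 * (79 + C) * P" unfolding split using xP by simp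
    finally show ?thesis by (simp add: algebra_simps)
  qed
  define K1 where "K1 = 2 + 576 * (79 + C)"
  have K1: "1 \<le> K1" using C by (simp add: K1_def)
  have nn: "real (n * n) = x ^ 2" by (simp add: x_def power2_eq_square)
  have bisect: "1 + real bisect_time \<le> (K1 + 12) * P"
  proof -
    have "1 + real bisect_time = real scan_time + 6 * x ^ 2 + 6"
      unfolding bisect_time_def nn[symmetric] by simp
    also have "\<dots> \<le> K1 * P + 6 * P + 6 * P" using scan xP unfolding K1_def by (intro add_mono) auto
    finally show ?thesis by (simp add: algebra_simps)
  qed
  define l where "l = 1 + log 2 x"
  have l: "1 \<le> l" using x by (simp add: l_def)
  have L1: "real (floorlog 2 (nat (4 * Rm))) \<le> (real c + 8) * l"
  proof -
    have e: "nat (4 * Rm) = 32 * n ^ (c + 2)" by (simp add: Rm_eq nat_mult_distrib nat_power_eq)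
    have "real (floorlog 2 (nat (4 * Rm))) \<le> 1 + log 2 (real (32 * n ^ (c + 2)))"
      unfolding e using n by (intro floorlog_le) simp
    also have "real (32 * n ^ (c + 2)) = 2 ^ 5 * x ^ (c + 2)" by (simp add: x_def)
    also have "log 2 (2 ^ 5 * x ^ (c + 2)) = log 2 (2 ^ 5) + log 2 (x ^ (c + 2))"
      using x by (subst log_mult) (auto simp del: power_Suc power_add)
    also have "\<dots> = 5 + real (c + 2) * log 2 x"
      using x log_nat_power[of x 2 "c + 2"] log_nat_power[of 2 2 5] by (simp only:) simp
    also have "1 + (5 + real (c + 2) * log 2 x) \<le> (real c + 8) * l"
      using x by (simp add: l_def algebra_simps)
    finally show ?thesis .
  qed
  have L2: "real (floorlog 2 n) \<le> l" unfolding l_def x_def using n by (intro floorlog_le)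
  define K2 where "K2 = (real c + 20) * (K1 + 12)"
  have lP: "P \<le> l * P" "0 \<le> l * P" using l xP by auto
  have minplus: "real minplus_time \<le> K2 * (l * P)"
  proof -
    have "real minplus_time = real (floorlog 2 (nat (4 * Rm))) * (1 + real bisect_time) + 6 * x ^ 2 + 6"
      unfolding minplus_time_def nn[symmetric] by (simp add: distrib_left)
    also have "\<dots> \<le> ((real c + 8) * l) * ((K1 + 12) * P) + 6 * P + 6 * P"
      using L1 bisect xP l by (intro add_mono mult_mono) auto
    also have "\<dots> \<le> (real c + 8) * (K1 + 12) * (l * P) + 12 * (l * P)" using lP by (simp add: algebra_simps)
    also have "\<dots> \<le> (real c + 8) * (K1 + 12) * (l * P) + 12 * (K1 + 12) * (l * P)"
      using lP K1 by (intro add_left_mono mult_right_mono) auto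
    finally show ?thesis by (simp add: K2_def algebra_simps)
  qed
  have llP: "l * P \<le> l * (l * P)" using l lP mult_right_mono[of 1 l "l * P"] by simp
  have main: "real apsp_time \<le> (29 + K2) * (l ^ 2 * P)"
  proof -
    have "real apsp_time = 2 * real s + 9 * x ^ 2 + 15 + real (floorlog 2 n) * (3 + real minplus_time)"
      unfolding apsp_time_def nn[symmetric] by (simp add: distrib_left)
    also have "\<dots> \<le> 2 * P + 9 * P + 15 * P + l * (3 * (l * P) + K2 * (l * P))"
    proof (intro add_mono mult_mono L2 minplus)
      show "real s \<le> P" using s xP by (simp add: x_def)
      show "3 \<le> 3 * (l * P)" using lP xP by linarith
    qed (use xP l in auto)
    also have "\<dots> = 26 * P + (3 + K2) * (l * (l * P))" by (simp add: algebra_simps)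
    also have "\<dots> \<le> 26 * (l * (l * P)) + (3 + K2) * (l * (l * P))" using lP llP by linarith
    finally show ?thesis by (simp add: algebra_simps power2_eq_square)
  qed
  \<comment> \<open>A quarter of the gain \<open>\<epsilon> / 3\<close> for each of the two
    logarithms, which leaves \<open>\<epsilon> / 6\<close>.\<close>
  define \<eta> where "\<eta> = \<epsilon> / 12"
  have \<eta>: "0 < \<eta>" using \<epsilon> by (simp add: \<eta>_def)
  define K3 where "K3 = 1 + 1 / (\<eta> * ln 2)"
  have K3: "0 \<le> K3" using \<eta> by (simp add: K3_def)
  have "l \<le> K3 * x powr \<eta>"
  proof -
    have "log 2 x \<le> (x powr \<eta> / \<eta>) / ln 2"
      unfolding log_def using ln_powr_bound[OF x \<eta>] by (intro divide_right_mono) auto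
    moreover have "1 \<le> x powr \<eta>" using x \<eta> by (simp add: ge_one_powr_ge_zero)
    ultimately show ?thesis by (simp add: l_def K3_def algebra_simps)
  qed
  then have "l ^ 2 \<le> (K3 * x powr \<eta>) ^ 2" using l by (intro power_mono) auto
  also have "\<dots> = K3 ^ 2 * x powr (2 * \<eta>)" using x by (simp add: power_mult_distrib powr_power mult.commute)
  finally have "l ^ 2 * P \<le> K3 ^ 2 * (x powr (2 * \<eta>) * P)"
    using xP mult_right_mono[of "l ^ 2" "K3 ^ 2 * x powr (2 * \<eta>)" P] by (simp add: mult.assoc)
  also have "x powr (2 * \<eta>) * P = x powr (3 - \<epsilon> / 6)"
    unfolding P_def b_def a_def \<eta>_def powr_add[symmetric] by (simp add: field_simps)
  finally have "(29 + K2) * (l ^ 2 * P) \<le> (29 + K2) * (K3 ^ 2 * x powr (3 - \<epsilon> / 6))"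
    using K1 by (intro mult_left_mono) (auto simp: K2_def)
  with main have "real apsp_time \<le> (29 + K2) * K3 ^ 2 * x powr (3 - \<epsilon> / 6)" by (simp add: mult.assoc)
  moreover have "(29 + K2) * K3 ^ 2 = time_const c C \<epsilon>"
    by (simp add: time_const_def K2_def K1_def K3_def \<eta>_def)
  ultimately show ?thesis by (simp add: x_def)
qed

end

text \<open>The oracle is called on small sizes too, so an asymptotic bound does not suffice. The
  finitely many sizes below the threshold are absorbed by the sum of their values, as
  \<open>1 \<le> real n powr b\<close>.\<close>

lemma uniform_bound:
  fixes T :: "nat \<Rightarrow> real"
  assumes "T \<in> O(\<lambda>n. real n powr a)" "a \<le> b" "0 \<le> b"
  obtains C where "1 \<le> C" "\<And>n. 1 \<le> n \<Longrightarrow> T n \<le> C * real n powr b"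
proof -
  from assms(1) obtain C0 where "eventually (\<lambda>n. norm (T n) \<le> C0 * norm (real n powr a)) at_top"
    by (rule landau_o.bigE)
  then obtain n0 where n0: "\<And>n. n0 \<le> n \<Longrightarrow> \<bar>T n\<bar> \<le> C0 * real n powr a"
    by (auto simp: eventually_at_top_linorder)
  define S where "S = (\<Sum>n<n0. \<bar>T n\<bar>)"
  have S: "0 \<le> S" by (simp add: S_def sum_nonneg)
  show thesis
  proof (rule that[of "1 + \<bar>C0\<bar> + S"])
    fix n :: nat assume n: "1 \<le> n"
    have p: "1 \<le> real n powr b" using n assms(3) by (simp add: ge_one_powr_ge_zero)
    have ab: "real n powr a \<le> real n powr b" using n assms(2) by (intro powr_mono) auto
    have "T n \<le> (\<bar>C0\<bar> + S) * real n powr b"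
    proof (cases "n < n0")
      case True
      then have "\<bar>T n\<bar> \<le> S" unfolding S_def by (intro member_le_sum) auto
      also have "\<dots> \<le> (\<bar>C0\<bar> + S) * 1" by simp
      also have "\<dots> \<le> (\<bar>C0\<bar> + S) * real n powr b" using p S by (intro mult_left_mono) auto
      finally show ?thesis by simp
    next
      case False
      then have "T n \<le> C0 * real n powr a" using n0[of n] by simp
      also have "\<dots> \<le> \<bar>C0\<bar> * real n powr b" using ab by (intro mult_mono) auto
      also have "\<dots> \<le> (\<bar>C0\<bar> + S) * real n powr b" using S by (intro mult_right_mono) auto
      finally show ?thesis .
    qed
    then show "T n \<le> (1 + \<bar>C0\<bar> + S) * real n powr b" using p by (simp add: algebra_simps)
  qed (use S in simp)
qed

text \<open>\<open>\<kappa> c = 8 + 3 + (c + 2)\<close> is chosen so that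
  \<open>Q = (n + 1) ^ \<kappa> c\<close> is large enough: in \<open>QR\<close> the constant 24 * 8
  = 192 is at most \<open>2 ^ 8\<close>, hence at most \<open>(n + 1) ^ 8\<close>. In
  \<open>3 * \<kappa> c + 2\<close>, the factor 3 is the price of the block size, from
  \<open>n + 1 \<le> (2 * s) ^ 3\<close>, and the 2 pays for the factor 3 in
  \<open>QN\<close>.\<close>

lemma apsp_truly_subcubic:
  defines "\<kappa> \<equiv> \<lambda>c::nat. c + 13"
  assumes lws: "truly_subcubic (lws2d_slice_instances 3 (3 * \<kappa> c + 2)) lws2d_slice_input lws2d_slice_output"
  shows "truly_subcubic (apsp_instances c) apsp_input apsp_output"
proof -
  obtain p d0 \<epsilon>0 T where \<epsilon>0: "\<epsilon>0 > 0" and T: "T \<in> O(\<lambda>n. real n powr (3 - \<epsilon>0))"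
    and p: "\<And>N D w m. 1 \<le> N \<Longrightarrow> D \<in> lws2d_slice_instances 3 (3 * \<kappa> c + 2) N \<Longrightarrow>
      (N + 1) ^ d0 \<le> 2 ^ w \<Longrightarrow> \<forall>b i. is_word w (m b i) \<Longrightarrow> lws2d_slice_input N D m \<Longrightarrow>
      \<exists>t m'. run w p m t m' \<and> real t \<le> T N \<and> lws2d_slice_output N D m'"
    using lws unfolding truly_subcubic_def by blast
  \<comment> \<open>A smaller gain is a weaker claim about the oracle, and the time analysis asks
    for \<open>\<epsilon> \<le> 1\<close>.\<close>
  define \<epsilon> where "\<epsilon> = min \<epsilon>0 1"
  have \<epsilon>: "0 < \<epsilon>" "\<epsilon> \<le> 1" "\<epsilon> \<le> \<epsilon>0" using \<epsilon>0 by (auto simp: \<epsilon>_def)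
  obtain C where C: "1 \<le> C" "\<And>N. 1 \<le> N \<Longrightarrow> T N \<le> C * real N powr (3 - \<epsilon>)"
    using uniform_bound[OF T, of "3 - \<epsilon>"] \<epsilon> by auto
  \<comment> \<open>Only the banks written by the oracle have to be avoided. Whatever else it reads
    counts as uninitialised memory, on which its correctness does not depend; 5 keeps the reduction
    clear of the input and output banks.\<close>
  obtain B0 where "\<forall>b\<in>writes p. b < B0" using finite_nat_set_iff_bounded finite_writes by blast
  then obtain B where B: "5 \<le> B" "writes p \<subseteq> {..<B}" by (intro that[of "max 5 B0"]) auto
  \<comment> \<open>The first summand provides the word length required by the oracle, as
    \<open>2 * s + 1 \<le> (n + 1) ^ 2\<close>; the second gives
    \<open>Q ^ 20 \<le> 2 ^ w\<close>.\<close>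
  define d where "d = 2 * d0 + 20 * \<kappa> c"
  define T' where "T' n = time_const c C \<epsilon> * real n powr (3 - \<epsilon> / 6)" for n :: nat
  have alg: "\<exists>t m'. run w (apsp_prog B c p) m t m' \<and> real t \<le> T' n \<and> apsp_output n X m'"
    if n: "1 \<le> n" and X: "X \<in> apsp_instances c n" and d: "(n + 1) ^ d \<le> 2 ^ w"
      and wm: "\<forall>b i. is_word w (m b i)" and inp: "apsp_input n X m" for n X w m
  proof -
    obtain E wt where X_eq: "X = (E, wt)" by (cases X)
    define s where "s = (LEAST k. n \<le> k * k * k)"
    have n3: "n \<le> n * n * n" using n by simp
    have s: "n \<le> s * s * s" "s \<le> n"
      unfolding s_def using LeastI[of "\<lambda>k. n \<le> k * k * k" n] Least_le[of "\<lambda>k. n \<le> k * k * k" n] n3 by auto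
    have s_least: "k * k * k < n" if "k < s" for k using not_less_Least[of k] that unfolding s_def by force
    have s1: "1 \<le> s" using s(1) n by (cases s) auto
    define N where "N = 2 * s"
    define Q where "Q = (int n + 1) ^ \<kappa> c"
    define Rm where "Rm = 8 * int n ^ (c + 2)"
    have w0: "(n + 1) ^ (2 * d0) * (n + 1) ^ (20 * \<kappa> c) \<le> 2 ^ w" using d unfolding d_def by (simp add: power_add)
    have "(N + 1) ^ d0 \<le> ((n + 1) ^ 2) ^ d0"
      using s unfolding N_def by (intro power_mono) (auto simp: power2_eq_square)
    also have "\<dots> = (n + 1) ^ (2 * d0) * 1" by (simp add: power_mult)
    also have "\<dots> \<le> (n + 1) ^ (2 * d0) * (n + 1) ^ (20 * \<kappa> c)" by (intro mult_left_mono) auto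
    finally have wN: "(N + 1) ^ d0 \<le> 2 ^ w" using w0 by linarith
    have "1 * (n + 1) ^ (20 * \<kappa> c) \<le> (n + 1) ^ (2 * d0) * (n + 1) ^ (20 * \<kappa> c)"
      by (intro mult_right_mono) auto
    then have "(n + 1) ^ (20 * \<kappa> c) \<le> 2 ^ w" using w0 by linarith
    then have "int ((n + 1) ^ (20 * \<kappa> c)) \<le> int (2 ^ w)" by (rule of_nat_mono)
    then have Qw: "Q ^ 20 \<le> 2 ^ w" unfolding Q_def by (simp add: mult.commute add.commute flip: power_mult)
    have Rm1: "1 \<le> Rm" using n one_le_power[of "int n" "c + 2"] unfolding Rm_def by linarith
    have QR: "24 * (int n + 1) ^ 3 * Rm \<le> Q"
    proof -
      have "24 * (int n + 1) ^ 3 * Rm = 192 * ((int n + 1) ^ 3 * int n ^ (c + 2))" by (simp add: Rm_def)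
      also have "\<dots> \<le> (int n + 1) ^ 8 * ((int n + 1) ^ 3 * (int n + 1) ^ (c + 2))"
      proof (intro mult_mono power_mono)
        have "(192::int) \<le> 2 ^ 8" by simp
        also have "\<dots> \<le> (int n + 1) ^ 8" using n by (intro power_mono) auto
        finally show "192 \<le> (int n + 1) ^ 8" .
      qed auto
      also have "\<dots> = Q" unfolding Q_def \<kappa>_def power_add[symmetric] by (simp add: add.commute)
      finally show ?thesis .
    qed
    have QN: "3 * Q \<le> int (2 * s) ^ (3 * \<kappa> c + 2)"
    proof -
      have "n + 1 \<le> 8 * (s * s * s)" using s n by linarith
      also have "\<dots> = (2 * s) ^ 3" by (simp add: power3_eq_cube)
      finally have "int (n + 1) \<le> int ((2 * s) ^ 3)" by (rule of_nat_mono)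
      then have "Q \<le> (int (2 * s) ^ 3) ^ \<kappa> c" unfolding Q_def by (intro power_mono) auto
      also have "\<dots> = int (2 * s) ^ (3 * \<kappa> c)" by (simp only: power_mult)
      finally have q: "Q \<le> int (2 * s) ^ (3 * \<kappa> c)" .
      have "(2::int) ^ 2 \<le> int (2 * s) ^ 2" using s1 by (intro power_mono) auto
      then have "3 * Q \<le> int (2 * s) ^ 2 * int (2 * s) ^ (3 * \<kappa> c)"
        using q by (intro mult_mono) (auto simp: Q_def)
      then show ?thesis by (simp only: power_add mult.commute)
    qed
    interpret apsp_machine w n s N "n div s + 1" B "3 * \<kappa> c + 2" "nat \<lfloor>T N\<rfloor>" p Q Rm c E wt
    proof unfold_locales
      fix m D assume "wordmem w m" "D \<in> lws2d_slice_instances 3 (3 * \<kappa> c + 2) (2 * s)"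
        "lws2d_slice_input (2 * s) D m"
      then obtain t m' where "run w p m t m'" "real t \<le> T N" "lws2d_slice_output (2 * s) D m'"
        using p[of N D w m] s1 wN unfolding N_def wordmem_def by auto
      then show "exec w p m (nat \<lfloor>T N\<rfloor>) (lws2d_slice_output (2 * s) D)"
        unfolding exec_def by (meson le_nat_floor)
    qed (use n s s1 B Qw Rm1 QR QN X X_eq s_least in \<open>auto simp: N_def Rm_def\<close>)
    have "real (nat \<lfloor>T N\<rfloor>) \<le> max 0 (T N)" by linarith
    also have "\<dots> \<le> C * real N powr (3 - \<epsilon>)" using C(1) C(2)[of N] s1 by (auto simp: N_def)
    finally have time: "real apsp_time \<le> T' n" unfolding T'_def by (rule apsp_time_le[OF \<epsilon>(1,2) C(1)])
    have "exec w (apsp_prog B c p) m apsp_time (apsp_output n (E, wt))"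
      using wm inp unfolding X_eq by (intro exec_apsp_prog) (auto simp: wordmem_def)
    then show ?thesis using time unfolding exec_def X_eq by (meson of_nat_mono order_trans)
  qed
  have "T' \<in> O(\<lambda>n. real n powr (3 - \<epsilon> / 6))" unfolding T'_def by simp
  moreover have "0 < \<epsilon> / 6" using \<epsilon> by simp
  ultimately show ?thesis
    unfolding truly_subcubic_def using alg by blast
qed

theorem theorem3p5:
  assumes "APSP_conjecture"
  shows "\<exists>c. \<not> truly_subcubic (lws2d_slice_instances 3 c) lws2d_slice_input lws2d_slice_output"
  using assms apsp_truly_subcubic unfolding APSP_conjecture_def by blast

end
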